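(* Let $T$ be an admissible triangulation of $\mathbb{V}=\mathbb{V}(M_1,M_2)$ and, for every $i\in\mathbb{Z}$, let $a_i$ be the number of triangles of $T$ incident with $(i,0)$. Then $(a_i)_{i\in\mathbb{Z}}$ is the quiddity row of an infinite frieze $\mathcal{F}=(m_{ij})_{i,j}$. Moreover, $$m_{ij}=|\mathcal{M}_{ij}|\quad\text{for all } i\le j,$$ where $\mathcal{M}_{ij}=\mathcal{M}_{ij}(T)$ is the set of matchings between the vertices $\{(i,0),(i+1,0),\dots,(j,0)\}$ and triangles of $T$.
   Context: An infinite frieze (of positive integers) is an array $(m_{ij})_{i,j\in\mathbb{Z},\,j\ge i-2}$ such that $m_{i,i-2}=0$, $m_{i,i-1}=1$ for all $i$, $m_{ij}\in\mathbb{Z}_{>0}$ for all $i\le j$, and $m_{ij}m_{i+1,j+1}-m_{i+1,j}m_{i,j+1}=1$ for all $i,j$ with $j\ge i-1$. Its quiddity row is $(a_i)_{i\in\mathbb{Z}}$, $a_i=m_{ii}$. $\mathbb{V}=\mathbb{V}(M_1,M_2)$ denotes an infinite strip of height one in the plane with lower boundary $\{(x,0)\mid x\in\mathbb{R}\}$ and upper boundary $\{(x,1)\mid x\in\mathbb{R}\}$, with vertices (marked points) $M_1=\{(i,0)\mid i\in\mathbb{Z}\}$ on the lower boundary and $M_2=\{(q,1)\mid q\in A\}$, $A\subseteq\mathbb{Q}$ (possibly empty), on the upper boundary, together with two limit points $+\infty$ and $-\infty$ at the right and left extremities of the strip. Arcs are curves in $\mathbb{V}$ without self-intersections, up to isotopy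 fixing endpoints, of the following types (boundary segments between neighbouring vertices are not arcs): bridging arcs, joining vertices on different boundaries; peripheral arcs, joining two vertices on the same boundary; asymptotic arcs, starting at a vertex on a boundary and tending to $+\infty$ or $-\infty$; and the generic arc, connecting the two limit points. Two arcs are compatible if they have representatives which do not cross. A triangulation of $\mathbb{V}$ is a maximal collection of pairwise compatible arcs. It is admissible if every vertex on the lower boundary is incident with only finitely many arcs of it. The triangles of a triangulation are the three-sided regions into which the arcs cut the strip, where limit points are allowed as vertices. A matching between the vertices $\{(i,0),\dots,(j,0)\}$ and triangles of $T$ is an assignment to each of these vertices of a triangle of $T$ incident with it, such that different vertices are assigned different triangles. *)

theory Defs
  imports "HOL-Analysis.Analysis"
begin

section \<open>Infinite friezes\<close>

text \<open>Only the values \<open>m i j\<close> with \<open>j \<ge> i - 2\<close> are constrained; the others carry no meaning.\<close>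

definition infinite_frieze :: "(int \<Rightarrow> int \<Rightarrow> int) \<Rightarrow> bool" where
  "infinite_frieze m \<longleftrightarrow>
     (\<forall>i. m i (i - 2) = 0) \<and>
     (\<forall>i. m i (i - 1) = 1) \<and>
     (\<forall>i j. i \<le> j \<longrightarrow> m i j > 0) \<and>
     (\<forall>i j. i - 1 \<le> j \<longrightarrow> m i j * m (i + 1) (j + 1) - m (i + 1) j * m i (j + 1) = 1)"

definition quiddity_row :: "(int \<Rightarrow> int \<Rightarrow> int) \<Rightarrow> int \<Rightarrow> int" where
  "quiddity_row m i = m i i"


section \<open>The infinite strip\<close>

text \<open>The plane is \<open>complex\<close>, the point \<open>(x, y)\<close> being \<open>Complex x y\<close>.  The upper vertices are given
  by the set \<open>A\<close> of their abscissae.\<close>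

definition open_strip :: "complex set" where
  "open_strip = {z. 0 < Im z \<and> Im z < 1}"

definition lower_vertex :: "int \<Rightarrow> complex" where
  "lower_vertex i = Complex (of_int i) 0"

definition lower_vertices :: "complex set" where
  "lower_vertices = range lower_vertex"

definition upper_vertices :: "real set \<Rightarrow> complex set" where
  "upper_vertices A = (\<lambda>q. Complex q 1) ` A"

definition vertices :: "real set \<Rightarrow> complex set" where
  "vertices A = lower_vertices \<union> upper_vertices A"

definition neighbouring :: "real set \<Rightarrow> complex \<Rightarrow> complex \<Rightarrow> bool" where
  "neighbouring A v w \<longleftrightarrow> v \<in> vertices A \<and> w \<in> vertices A \<and> v \<noteq> w \<and> Im v = Im w \<and>
     open_segment v w \<inter> vertices A = {}"

text \<open>A possible end of an arc: a point of the plane, or one of the limit points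
  \<open>+\<infinity>\<close>, \<open>-\<infinity>\<close>.\<close>

datatype strip_end = Point complex | PosLimit | NegLimit

fun approaches :: "('b \<Rightarrow> complex) \<Rightarrow> strip_end \<Rightarrow> 'b filter \<Rightarrow> bool" where
  "approaches f (Point p) F \<longleftrightarrow> (f \<longlongrightarrow> p) F"
| "approaches f PosLimit F \<longleftrightarrow> filterlim (\<lambda>x. Re (f x)) at_top F"
| "approaches f NegLimit F \<longleftrightarrow> filterlim (\<lambda>x. Re (f x)) at_bot F"


section \<open>Arcs\<close>

text \<open>A curve is parametrised by the open interval from 0 to 1, because an end may be a limit point;
  values outside this interval are irrelevant.  Its ends are on the boundary (or at infinity), the
  rest of it is in the open strip.\<close>

definition curve_trace :: "(real \<Rightarrow> complex) \<Rightarrow> complex set" where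
  "curve_trace c = c ` {0<..<1}"

definition simple_curve :: "strip_end \<Rightarrow> strip_end \<Rightarrow> (real \<Rightarrow> complex) \<Rightarrow> bool" where
  "simple_curve p q c \<longleftrightarrow>
     continuous_on {0<..<1} c \<and> inj_on c {0<..<1} \<and> curve_trace c \<subseteq> open_strip \<and>
     approaches c p (at_right 0) \<and> approaches c q (at_left 1)"

definition bridging_ends :: "real set \<Rightarrow> strip_end \<Rightarrow> strip_end \<Rightarrow> bool" where
  "bridging_ends A p q \<longleftrightarrow>
     (\<exists>v\<in>lower_vertices. \<exists>w\<in>upper_vertices A. {p, q} = {Point v, Point w})"

definition peripheral_ends :: "real set \<Rightarrow> strip_end \<Rightarrow> strip_end \<Rightarrow> bool" where
  "peripheral_ends A p q \<longleftrightarrow>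
     (\<exists>v\<in>vertices A. \<exists>w\<in>vertices A. v \<noteq> w \<and> Im v = Im w \<and> \<not> neighbouring A v w \<and>
        p = Point v \<and> q = Point w)"

definition asymptotic_ends :: "real set \<Rightarrow> strip_end \<Rightarrow> strip_end \<Rightarrow> bool" where
  "asymptotic_ends A p q \<longleftrightarrow>
     (\<exists>v\<in>vertices A. {p, q} = {Point v, PosLimit} \<or> {p, q} = {Point v, NegLimit})"

definition generic_ends :: "strip_end \<Rightarrow> strip_end \<Rightarrow> bool" where
  "generic_ends p q \<longleftrightarrow> {p, q} = {NegLimit, PosLimit}"

definition arc_curve :: "real set \<Rightarrow> strip_end \<Rightarrow> strip_end \<Rightarrow> (real \<Rightarrow> complex) \<Rightarrow> bool" where
  "arc_curve A p q c \<longleftrightarrow> simple_curve p q c \<and>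
     (bridging_ends A p q \<or> peripheral_ends A p q \<or> asymptotic_ends A p q \<or> generic_ends p q)"

text \<open>Deformation with fixed ends.  The product filters make the deformation continuous at the two
  ends, also when these are limit points.  The intermediate curves may intersect themselves; for
  curves that do not, as in \<open>arc_class\<close>, being homotopic with fixed ends and being isotopic with
  fixed ends are the same relation (Baer, Epstein).\<close>

definition homotopic_curves ::
  "strip_end \<Rightarrow> strip_end \<Rightarrow> (real \<Rightarrow> complex) \<Rightarrow> (real \<Rightarrow> complex) \<Rightarrow> bool" where
  "homotopic_curves p q c d \<longleftrightarrow>
     (\<exists>H :: real \<times> real \<Rightarrow> complex.
        continuous_on ({0..1} \<times> {0<..<1}) H \<and>
        H ` ({0..1} \<times> {0<..<1}) \<subseteq> open_strip \<and>
        (\<forall>t\<in>{0<..<1}. H (0, t) = c t \<and> H (1, t) = d t) \<and>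
        approaches H p (principal {0..1} \<times>\<^sub>F at_right 0) \<and>
        approaches H q (principal {0..1} \<times>\<^sub>F at_left 1))"

text \<open>An arc is a class of curves, without regard to orientation.\<close>

type_synonym strip_arc = "(real \<Rightarrow> complex) set"

definition arc_class :: "strip_end \<Rightarrow> strip_end \<Rightarrow> (real \<Rightarrow> complex) \<Rightarrow> strip_arc" where
  "arc_class p q c =
     {d. simple_curve p q d \<and> homotopic_curves p q c d \<or>
         simple_curve q p d \<and> homotopic_curves q p (\<lambda>t. c (1 - t)) d}"

definition strip_arcs :: "real set \<Rightarrow> strip_arc set" where
  "strip_arcs A = {arc_class p q c | p q c. arc_curve A p q c}"

definition arc_incident :: "strip_arc \<Rightarrow> strip_end \<Rightarrow> bool" where
  "arc_incident \<alpha> p \<longleftrightarrow> (\<exists>q. \<exists>c\<in>\<alpha>. simple_curve p q c \<or> simple_curve q p c)"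

definition compatible :: "strip_arc \<Rightarrow> strip_arc \<Rightarrow> bool" where
  "compatible \<alpha> \<beta> \<longleftrightarrow> (\<exists>c\<in>\<alpha>. \<exists>d\<in>\<beta>. curve_trace c \<inter> curve_trace d = {})"


section \<open>Triangulations\<close>

definition strip_triangulation :: "real set \<Rightarrow> strip_arc set \<Rightarrow> bool" where
  "strip_triangulation A T \<longleftrightarrow>
     T \<subseteq> strip_arcs A \<and> pairwise compatible T \<and>
     (\<forall>T'. T \<subseteq> T' \<and> T' \<subseteq> strip_arcs A \<and> pairwise compatible T' \<longrightarrow> T' = T)"

definition admissible :: "strip_arc set \<Rightarrow> bool" where
  "admissible T \<longleftrightarrow> (\<forall>i. finite {\<alpha> \<in> T. arc_incident \<alpha> (Point (lower_vertex i))})"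

text \<open>To speak of the regions into which the arcs cut the strip, the arcs of \<open>T\<close> are represented
  simultaneously by curves \<open>D \<alpha>\<close> that do not cross.\<close>

definition drawing :: "strip_arc set \<Rightarrow> (strip_arc \<Rightarrow> real \<Rightarrow> complex) \<Rightarrow> bool" where
  "drawing T D \<longleftrightarrow> (\<forall>\<alpha>\<in>T. D \<alpha> \<in> \<alpha>) \<and> pairwise (\<lambda>\<alpha> \<beta>. curve_trace (D \<alpha>) \<inter> curve_trace (D \<beta>) = {}) T"

definition regions :: "strip_arc set \<Rightarrow> (strip_arc \<Rightarrow> real \<Rightarrow> complex) \<Rightarrow> complex set set" where
  "regions T D = components (open_strip - (\<Union>\<alpha>\<in>T. curve_trace (D \<alpha>)))"

text \<open>A side of a region is an arc of \<open>T\<close> or a boundary segment between neighbouring vertices.\<close>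

definition side ::
  "real set \<Rightarrow> strip_arc set \<Rightarrow> (strip_arc \<Rightarrow> real \<Rightarrow> complex) \<Rightarrow>
   strip_end \<Rightarrow> strip_end \<Rightarrow> complex set \<Rightarrow> bool" where
  "side A T D p q s \<longleftrightarrow>
     (\<exists>\<alpha>\<in>T. (simple_curve p q (D \<alpha>) \<or> simple_curve q p (D \<alpha>)) \<and> s = curve_trace (D \<alpha>)) \<or>
     (\<exists>v w. neighbouring A v w \<and> p = Point v \<and> q = Point w \<and> s = open_segment v w)"

text \<open>The closure (in the plane) of a side adds those of its ends that are not limit points.\<close>

definition triangle_corners ::
  "real set \<Rightarrow> strip_arc set \<Rightarrow> (strip_arc \<Rightarrow> real \<Rightarrow> complex) \<Rightarrow> complex set \<Rightarrow>
   strip_end \<Rightarrow> strip_end \<Rightarrow> strip_end \<Rightarrow> bool" where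
  "triangle_corners A T D R p q r \<longleftrightarrow>
     R \<in> regions T D \<and> distinct [p, q, r] \<and>
     (\<exists>s t u. side A T D p q s \<and> side A T D q r t \<and> side A T D r p u \<and>
        frontier R = closure s \<union> closure t \<union> closure u)"

definition incident_triangles ::
  "real set \<Rightarrow> strip_arc set \<Rightarrow> (strip_arc \<Rightarrow> real \<Rightarrow> complex) \<Rightarrow> int \<Rightarrow> complex set set" where
  "incident_triangles A T D i =
     {R. \<exists>q r. triangle_corners A T D R (Point (lower_vertex i)) q r}"

text \<open>Assignments are extensional functions on \<open>{i..j}\<close>, so that each one is counted once.\<close>

definition matchings ::
  "real set \<Rightarrow> strip_arc set \<Rightarrow> (strip_arc \<Rightarrow> real \<Rightarrow> complex) \<Rightarrow> int \<Rightarrow> int \<Rightarrow>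
   (int \<Rightarrow> complex set) set" where
  "matchings A T D i j =
     {f \<in> (\<Pi>\<^sub>E k\<in>{i..j}. incident_triangles A T D k). inj_on f {i..j}}"

end

theory Submission
  imports Defs
begin

text \<open>The strip is convex, so curves with the same ends are homotopic and an arc amounts to an unordered
  pair of ends on the boundary circle. Interlaced pairs always meet (Fashoda's theorem) and the
  others are represented by disjoint geodesics, so a triangulation is a maximal noncrossing set of
  pairs. For any drawing, the Jordan curve theorem gives a bijection between triangles and triples of
  pairwise linked ends, where two ends are linked if an arc of the triangulation or a boundary
  segment joins them.

  The matchings of a chain of lower vertices are then counted by induction. If two neighbours of a
  vertex of the chain are linked, then this vertex lies in one triangle only and both can be removed.
  Otherwise only consecutive vertices have a common triangle, namely exactly one. In both cases the
  number of matchings is the continuant of the numbers of triangles at the vertices, and continuants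
  satisfy the frieze rule.\<close>

section \<open>Continuants and distinct representatives\<close>

text \<open>The upper vertices may accumulate and a limit point may carry infinitely many arcs, so
  the strip cannot simply be cut down to a finite triangulated polygon. The count therefore uses
  nothing global: it starts from the chain (i-1,0), ..., (j+1,0) and needs finitely many links only
  at the vertices of the chain, which admissibility provides. The two outer vertices are not
  matched; they are in the chain because removing a vertex needs both of its neighbours. A removal
  replaces two links by one, and what lies behind the new link is no longer looked at.

  Continuants contain a subtraction, so their positivity, which a frieze needs, is not visible; it
  is obtained by showing that a matching exists.

  On the topological side the obstacle is that the limit points are not points of the plane: curves
  run off to infinity, and closures in the plane miss these corners. In the closed unit disc they
  are ordinary boundary points, and the theorems on paths in the plane apply.\<close>

fun continuant :: "int list \<Rightarrow> int" where
  "continuant [] = 1"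
| "continuant [a] = a"
| "continuant (a # b # xs) = a * continuant (b # xs) - continuant xs"

text \<open>\<open>continuant\<close> is the determinant of the tridiagonal matrix with the given
  diagonal and ones beside it. In the induction the terms with the factor \<open>x\<close> cancel,
  and what remains is the same expression for a list shorter by one.\<close>

lemma continuant_frieze:
  "continuant (x # ms) * continuant (ms @ [y]) - continuant ms * continuant (x # ms @ [y]) = 1"
proof (induction ms arbitrary: x)
  case Nil
  then show ?case by simp
next
  case (Cons z ms)
  have "continuant (x # z # ms) * continuant (z # ms @ [y])
      - continuant (z # ms) * continuant (x # z # ms @ [y])
      = continuant (z # ms) * continuant (ms @ [y]) - continuant ms * continuant (z # ms @ [y])"
    by (simp add: algebra_simps)
  then show ?case using Cons.IH[of z] by simp
qed

lemma continuant_one_Cons: "continuant (1 # b # ys) = continuant ((b - 1) # ys)"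
  by (cases ys) (auto simp: algebra_simps)

text \<open>The recursion sees a tail only through the values of the continuant on the tail and on
  the tail with one more entry in front, so a rewriting that keeps both may be done behind any
  prefix.\<close>

lemma continuant_append_cong:
  assumes "continuant us = continuant vs" "\<And>x. continuant (x # us) = continuant (x # vs)"
  shows "continuant (xs @ us) = continuant (xs @ vs)"
proof (induction xs rule: continuant.induct)
  case (2 a)
  then show ?case using assms by simp
next
  case (3 a b xs)
  then show ?case by simp
qed (use assms in auto)

lemma continuant_one_last: "continuant (xs @ [a, 1]) = continuant (xs @ [a - 1])"
  by (rule continuant_append_cong) (auto simp: algebra_simps)

text \<open>The arithmetic of cutting an ear: a vertex with a single triangle disappears, and each
  of its two neighbours loses this triangle.\<close>

lemma continuant_one_middle:
  "continuant (xs @ a # 1 # b # ys) = continuant (xs @ (a - 1) # (b - 1) # ys)"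
proof (rule continuant_append_cong)
  have *: "continuant ((b - 1) # ys) = continuant (b # ys) - continuant ys"
    using continuant_one_Cons[of b ys] by simp
  show eq: "continuant (a # 1 # b # ys) = continuant ((a - 1) # (b - 1) # ys)"
    by (simp add: * algebra_simps)
  show "continuant (x # a # 1 # b # ys) = continuant (x # (a - 1) # (b - 1) # ys)" for x
    by (simp add: * algebra_simps)
qed

section \<open>Systems of distinct representatives of a list of sets\<close>

definition sdrs :: "'a set list \<Rightarrow> 'a list set" where
  "sdrs Ss = {xs. list_all2 (\<in>) xs Ss \<and> distinct xs}"

lemma sdrs_Nil [simp]: "sdrs [] = {[]}"
  by (auto simp: sdrs_def)

lemma sdrs_Cons: "sdrs (S # Ss) = {x # xs | x xs. x \<in> S \<and> xs \<in> sdrs Ss \<and> x \<notin> set xs}"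
  by (auto simp: sdrs_def list_all2_Cons2)

lemma set_sdr_subset: "xs \<in> sdrs Ss \<Longrightarrow> set xs \<subseteq> \<Union> (set Ss)"
  by (induction Ss arbitrary: xs) (auto simp: sdrs_Cons, blast)

lemma finite_sdrs: "(\<And>S. S \<in> set Ss \<Longrightarrow> finite S) \<Longrightarrow> finite (sdrs Ss)"
proof (induction Ss)
  case (Cons S Ss)
  have "sdrs (S # Ss) \<subseteq> (\<lambda>(x, xs). x # xs) ` (S \<times> sdrs Ss)"
    by (auto simp: sdrs_Cons)
  moreover have "finite (S \<times> sdrs Ss)" using Cons by auto
  ultimately show ?case using finite_surj by blast
qed auto

lemma sdrs_common_element:
  assumes "\<tau> \<in> S" "\<And>S'. S' \<in> set Ss \<Longrightarrow> \<tau> \<notin> S'"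
  shows "{xs \<in> sdrs (S # Ss). \<tau> \<in> set xs} = (#) \<tau> ` sdrs Ss"
proof -
  have "\<tau> \<notin> set xs" if "xs \<in> sdrs Ss" for xs
    using set_sdr_subset[OF that] assms(2) by auto
  then show ?thesis unfolding sdrs_Cons using assms(1) by fastforce
qed

text \<open>Of the \<open>|S| * N\<close> ways to prepend an element of \<open>S\<close>, the ones that repeat an element
  repeat the single common element of \<open>S\<close> and the next set.\<close>

lemma card_sdrs_Cons_Cons:
  assumes fin: "\<And>U. U \<in> set (S # S' # Ss) \<Longrightarrow> finite U"
    and com: "S \<inter> S' = {\<tau>}"
    and dis: "\<And>U. U \<in> set Ss \<Longrightarrow> S \<inter> U = {}"
  shows "int (card (sdrs (S # S' # Ss)))
    = int (card S) * int (card (sdrs (S' # Ss))) - int (card (sdrs Ss))"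
proof -
  let ?B = "{xs \<in> sdrs (S' # Ss). \<tau> \<in> set xs}"
  have fin1: "finite (sdrs (S' # Ss))" "finite (sdrs Ss)" by (rule finite_sdrs, simp add: fin)+
  have B: "?B = (#) \<tau> ` sdrs Ss"
    by (rule sdrs_common_element) (use com dis in auto)
  have cB: "card ?B = card (sdrs Ss)" unfolding B by (rule card_image) (simp add: inj_on_def)
  have eq: "S \<times> sdrs (S' # Ss) - {\<tau>} \<times> ?B = {(x, xs). x \<in> S \<and> xs \<in> sdrs (S' # Ss) \<and> x \<notin> set xs}"
  proof -
    have "x = \<tau>" if "x \<in> S" "xs \<in> sdrs (S' # Ss)" "x \<in> set xs" for x xs
      using set_sdr_subset[OF that(2)] that com dis by auto
    then show ?thesis using com by auto
  qed
  have "sdrs (S # S' # Ss) = (\<lambda>(x, xs). x # xs) ` (S \<times> sdrs (S' # Ss) - {\<tau>} \<times> ?B)"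
    unfolding eq by (subst sdrs_Cons) auto
  moreover have "inj_on (\<lambda>(x, xs). x # xs) (S \<times> sdrs (S' # Ss) - {\<tau>} \<times> ?B)"
    by (auto intro!: inj_onI)
  ultimately have "card (sdrs (S # S' # Ss)) = card (S \<times> sdrs (S' # Ss) - {\<tau>} \<times> ?B)"
    by (simp only: card_image)
  also have "\<dots> = card (S \<times> sdrs (S' # Ss)) - card ({\<tau>} \<times> ?B)"
    by (rule card_Diff_subset) (use com fin1 in auto)
  finally have "card (sdrs (S # S' # Ss)) = card S * card (sdrs (S' # Ss)) - card (sdrs Ss)"
    using cB by (simp add: card_cartesian_product)
  moreover have "card ({\<tau>} \<times> ?B) \<le> card (S \<times> sdrs (S' # Ss))"
    by (rule card_mono) (use com fin fin1 in auto)
  ultimately show ?thesis using cB by (simp add: card_cartesian_product of_nat_diff)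
qed

text \<open>The recursion in \<open>card_sdrs_Cons_Cons\<close> is that of
  \<open>continuant\<close>. The induction runs over the list of cardinalities, so that the three
  equations of \<open>continuant\<close> become the cases of the proof.\<close>

lemma card_sdrs_path:
  assumes "\<And>S. S \<in> set Ss \<Longrightarrow> finite S"
    and "\<And>k. Suc k < length Ss \<Longrightarrow> \<exists>\<tau>. Ss ! k \<inter> Ss ! Suc k = {\<tau>}"
    and "\<And>k l. Suc k < l \<Longrightarrow> l < length Ss \<Longrightarrow> Ss ! k \<inter> Ss ! l = {}"
  shows "int (card (sdrs Ss)) = continuant (map (int \<circ> card) Ss)"
  using assms
proof (induction "map (int \<circ> card) Ss" arbitrary: Ss rule: continuant.induct)
  case 1
  then show ?case by simp
next
  case (2 a)
  then obtain S where "Ss = [S]" by auto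
  moreover have "sdrs [S] = (\<lambda>x. [x]) ` S" by (auto simp: sdrs_Cons)
  ultimately show ?case by (simp add: card_image inj_on_def)
next
  case (3 a b xs)
  then obtain S S' Rs where Ss: "Ss = S # S' # Rs" and xs: "xs = map (int \<circ> card) Rs"
    and b: "b = int (card S')"
    by (auto simp: map_eq_Cons_conv Cons_eq_map_conv)
  have "\<exists>\<tau>. Ss ! 0 \<inter> Ss ! Suc 0 = {\<tau>}" by (rule 3(5)) (simp add: Ss)
  then obtain \<tau> where "S \<inter> S' = {\<tau>}" unfolding Ss nth_Cons_0 nth_Cons_Suc by (elim exE)
  moreover have "S \<inter> U = {}" if U: "U \<in> set Rs" for U
  proof -
    obtain l where "l < length Rs" "U = Rs ! l" using U by (metis in_set_conv_nth)
    then show ?thesis using 3(6)[of 0 "Suc (Suc l)"] Ss by auto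
  qed
  ultimately have "int (card (sdrs Ss))
      = int (card S) * int (card (sdrs (S' # Rs))) - int (card (sdrs Rs))"
    unfolding Ss using 3(4) by (intro card_sdrs_Cons_Cons) (simp_all add: Ss)
  moreover have "int (card (sdrs (S' # Rs))) = continuant (map (int \<circ> card) (S' # Rs))"
  proof (rule 3(1))
    show "b # xs = map (int \<circ> card) (S' # Rs)" using xs b by simp
    show "finite U" if "U \<in> set (S' # Rs)" for U using 3(4) Ss that by auto
    show "\<exists>\<tau>. (S' # Rs) ! k \<inter> (S' # Rs) ! Suc k = {\<tau>}" if "Suc k < length (S' # Rs)" for k
      using 3(5)[of "Suc k"] Ss that by auto
    show "(S' # Rs) ! k \<inter> (S' # Rs) ! l = {}" if "Suc k < l" "l < length (S' # Rs)" for k l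
      using 3(6)[of "Suc k" "Suc l"] Ss that by auto
  qed
  moreover have "int (card (sdrs Rs)) = continuant (map (int \<circ> card) Rs)"
  proof (rule 3(2))
    show "xs = map (int \<circ> card) Rs" by (rule xs)
    show "finite U" if "U \<in> set Rs" for U using 3(4) Ss that by auto
    show "\<exists>\<tau>. Rs ! k \<inter> Rs ! Suc k = {\<tau>}" if "Suc k < length Rs" for k
      using 3(5)[of "Suc (Suc k)"] Ss that by auto
    show "Rs ! k \<inter> Rs ! l = {}" if "Suc k < l" "l < length Rs" for k l
      using 3(6)[of "Suc (Suc k)" "Suc (Suc l)"] Ss that by auto
  qed
  ultimately show ?case using Ss by simp
qed

text \<open>The singleton forces \<open>\<tau>\<close> at its place, and every other set has to do
  without it. Nonemptiness is a separate conclusion because cardinality 0 does not tell empty sets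
  from infinite ones.\<close>

lemma card_sdrs_insert_singleton:
  "card (sdrs (Ps @ {\<tau>} # Qs)) = card (sdrs (map (\<lambda>S. S - {\<tau>}) (Ps @ Qs)))" (is "?l = card ?R")
  and sdrs_insert_singleton_nonempty:
  "sdrs (map (\<lambda>S. S - {\<tau>}) (Ps @ Qs)) \<noteq> {} \<Longrightarrow> sdrs (Ps @ {\<tau>} # Qs) \<noteq> {}"
proof -
  let ?f = "\<lambda>xs. take (length Ps) xs @ \<tau> # drop (length Ps) xs"
  have "sdrs (Ps @ {\<tau>} # Qs) = ?f ` ?R"
  proof (intro equalityI subsetI)
    fix xs assume "xs \<in> sdrs (Ps @ {\<tau>} # Qs)"
    then obtain ys zs where xs: "xs = ys @ \<tau> # zs" "list_all2 (\<in>) ys Ps" "list_all2 (\<in>) zs Qs"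
      and d: "distinct xs"
      by (auto simp: sdrs_def list_all2_append2 list_all2_Cons2)
    have len: "length ys = length Ps" using xs(2) list_all2_lengthD by blast
    have "list_all2 (\<lambda>x S. x \<in> S - {\<tau>}) ys Ps" "list_all2 (\<lambda>x S. x \<in> S - {\<tau>}) zs Qs"
      using xs d by (fastforce simp: list_all2_conv_all_nth in_set_conv_nth)+
    then have "list_all2 (\<in>) (ys @ zs) (map (\<lambda>S. S - {\<tau>}) (Ps @ Qs))"
      by (simp add: list_all2_map2 list_all2_appendI)
    then have "ys @ zs \<in> ?R" using d xs by (auto simp: sdrs_def)
    moreover have "xs = ?f (ys @ zs)" using xs(1) len by simp
    ultimately show "xs \<in> ?f ` ?R" by blast
  next
    fix xs assume "xs \<in> ?f ` ?R"
    then obtain us where us: "us \<in> ?R" "xs = ?f us" by blast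
    then have "list_all2 (\<lambda>x S. x \<in> S - {\<tau>}) us (Ps @ Qs)" and d: "distinct us"
      by (auto simp: sdrs_def list_all2_map2 simp flip: map_append)
    then obtain ys zs where u: "us = ys @ zs" "length ys = length Ps"
      and ys: "list_all2 (\<lambda>x S. x \<in> S - {\<tau>}) ys Ps" and zs: "list_all2 (\<lambda>x S. x \<in> S - {\<tau>}) zs Qs"
      by (auto simp: list_all2_append2)
    have "\<tau> \<notin> set ys" "\<tau> \<notin> set zs" "list_all2 (\<in>) ys Ps" "list_all2 (\<in>) zs Qs"
      using ys zs by (auto simp: list_all2_conv_all_nth in_set_conv_nth)
    then show "xs \<in> sdrs (Ps @ {\<tau>} # Qs)"
      using u d us(2) by (auto simp: sdrs_def list_all2_appendI)
  qed
  moreover have "inj_on ?f ?R"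
  proof (rule inj_onI)
    fix us vs assume "us \<in> ?R" "vs \<in> ?R" and eq: "?f us = ?f vs"
    then have "length us = length (Ps @ Qs)" "length vs = length (Ps @ Qs)"
      by (auto simp: sdrs_def dest: list_all2_lengthD)
    then have "take (length Ps) us = take (length Ps) vs \<and> drop (length Ps) us = drop (length Ps) vs"
      using eq by (subst (asm) append_eq_append_conv) auto
    then show "us = vs" by (metis append_take_drop_id)
  qed
  ultimately show "?l = card ?R" and "?R \<noteq> {} \<Longrightarrow> sdrs (Ps @ {\<tau>} # Qs) \<noteq> {}"
    by (simp_all add: card_image)
qed

section \<open>Noncrossing links between points of a line\<close>

text \<open>Triangles are encoded by their sets of corners. Restricting the corners to
  \<open>V\<close> makes it possible to discard a piece of the picture while \<open>L\<close> stays
  the same.\<close>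

definition inner_triangles :: "('a \<Rightarrow> 'a \<Rightarrow> bool) \<Rightarrow> 'a set \<Rightarrow> 'a set set" where
  "inner_triangles L V = {\<tau>. \<tau> \<subseteq> V \<and> card \<tau> = 3 \<and> (\<forall>p\<in>\<tau>. \<forall>q\<in>\<tau>. p \<noteq> q \<longrightarrow> L p q)}"

definition triangles_at :: "('a \<Rightarrow> 'a \<Rightarrow> bool) \<Rightarrow> 'a set \<Rightarrow> 'a \<Rightarrow> 'a set set" where
  "triangles_at L V v = {\<tau> \<in> inner_triangles L V. v \<in> \<tau>}"

text \<open>The circle of ends, cut open at one point: crossing chords become interlaced pairs of
  reals. \<open>noncrossing\<close> and \<open>maximal\<close> are written for one orientation of a
  link, and \<open>sym\<close> supplies the other.\<close>

locale noncrossing_links =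
  fixes E :: "real set" and L :: "real \<Rightarrow> real \<Rightarrow> bool"
  assumes sym: "L p q \<Longrightarrow> L q p"
    and in_E: "L p q \<Longrightarrow> p \<in> E"
    and irrefl: "\<not> L p p"
    and noncrossing: "L p q \<Longrightarrow> L r s \<Longrightarrow> p < r \<Longrightarrow> r < q \<Longrightarrow> q < s \<Longrightarrow> False"
    and maximal: "p \<in> E \<Longrightarrow> q \<in> E \<Longrightarrow> p < q \<Longrightarrow>
      (\<And>r s. L r s \<Longrightarrow> p < r \<Longrightarrow> r < q \<Longrightarrow> p \<le> s \<and> s \<le> q) \<Longrightarrow> L p q"
begin

lemma in_E2: "L p q \<Longrightarrow> q \<in> E"
  using sym in_E by blast

lemma link_under: "L p q \<Longrightarrow> L r s \<Longrightarrow> p < r \<Longrightarrow> r < q \<Longrightarrow> p \<le> s \<and> s \<le> q"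
  using noncrossing[of p q r s] noncrossing[of s r p q] sym[of r s] by force

text \<open>Finiteness is demanded at the vertices of the chain only; it allows the choice of an
  extremal neighbour there, while other points may have infinitely many links.\<close>

definition link_chain :: "real list \<Rightarrow> bool" where
  "link_chain vs \<longleftrightarrow> sorted_wrt (<) vs \<and> successively L vs \<and> (\<forall>v\<in>set vs. v \<in> E \<and> finite {x. L v x})"

text \<open>The points that the chain does not cut off.\<close>

definition region_vertices :: "real list \<Rightarrow> real set" where
  "region_vertices vs = {x \<in> E. x \<le> hd vs \<or> last vs \<le> x \<or> x \<in> set vs}"

lemma finite_triangles_at:
  assumes "finite {x. L v x}"
  shows "finite (triangles_at L V v)"
proof (rule finite_subset)
  show "triangles_at L V v \<subseteq> Pow (insert v {x. L v x})"
    unfolding triangles_at_def inner_triangles_def by auto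
qed (use assms in auto)

lemma inner_triangleI:
  "p \<in> V \<Longrightarrow> q \<in> V \<Longrightarrow> r \<in> V \<Longrightarrow> L p q \<Longrightarrow> L q r \<Longrightarrow> L p r \<Longrightarrow> {p, q, r} \<in> inner_triangles L V"
  using irrefl sym by (auto simp: inner_triangles_def card_insert_if)

lemma inner_triangle_third:
  assumes "\<tau> \<in> inner_triangles L V" "p \<in> \<tau>" "q \<in> \<tau>" "p \<noteq> q"
  obtains z where "\<tau> = {p, q, z}" "z \<noteq> p" "z \<noteq> q" "z \<in> V" "L p z" "L q z"
proof -
  have c: "card \<tau> = 3" using assms(1) by (auto simp: inner_triangles_def)
  have "card (\<tau> - {p, q}) = 1" using assms c by (subst card_Diff_subset) auto
  then obtain z where z: "\<tau> - {p, q} = {z}" by (auto simp: card_1_singleton_iff)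
  then have "\<tau> = {p, q, z}" "z \<noteq> p" "z \<noteq> q" using assms by auto
  then show ?thesis using that assms(1) by (auto simp: inner_triangles_def)
qed

text \<open>Each edge of the chain separates the points below it from everything else. This is why
  such points can be ignored: they are no vertices of the region, and their links never leave the
  gap.\<close>

lemma chain_gap:
  assumes "link_chain vs" "Suc k < length vs" "vs ! k < x" "x < vs ! Suc k"
  shows "x \<notin> region_vertices vs"
    and "L x y \<Longrightarrow> vs ! k \<le> y \<and> y \<le> vs ! Suc k"
proof -
  have s: "sorted_wrt (<) vs" using assms(1) by (simp add: link_chain_def)
  have ne: "vs \<noteq> []" using assms(2) by auto
  have le: "vs ! i \<le> vs ! j" if "i \<le> j" "j < length vs" for i j
    using sorted_wrt_nth_less[OF s, of i j] that by (cases "i = j") auto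
  have "hd vs \<le> vs ! k" "vs ! Suc k \<le> last vs"
    using assms(2) le[of 0 k] le[of "Suc k" "length vs - 1"] ne by (auto simp: hd_conv_nth last_conv_nth)
  moreover have "x \<notin> set vs"
  proof
    assume "x \<in> set vs"
    then obtain m where m: "m < length vs" "x = vs ! m" by (metis in_set_conv_nth)
    show False
    proof (cases "m \<le> k")
      case True then show False using le[of m k] assms m by auto
    next
      case False then show False using le[of "Suc k" m] assms m by auto
    qed
  qed
  ultimately show "x \<notin> region_vertices vs" using assms(3,4) by (auto simp: region_vertices_def)
  have "L (vs ! k) (vs ! Suc k)" using assms(1,2) by (auto simp: link_chain_def successively_conv_nth)
  then show "L x y \<Longrightarrow> vs ! k \<le> y \<and> y \<le> vs ! Suc k" using link_under assms(3,4) by blast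
qed

lemma chain_mem_region: "link_chain vs \<Longrightarrow> v \<in> set vs \<Longrightarrow> v \<in> region_vertices vs"
  by (auto simp: link_chain_def region_vertices_def)

lemma chain_locate:
  assumes "link_chain vs" "vs \<noteq> []" "x \<in> E" "x \<notin> region_vertices vs"
  obtains k where "Suc k < length vs" "vs ! k < x" "x < vs ! Suc k"
proof -
  have ne: "vs \<noteq> []" and x: "hd vs < x" "x < last vs" "x \<notin> set vs"
    using assms by (auto simp: region_vertices_def)
  define k where "k = Max {k. k < length vs \<and> vs ! k < x}"
  have fin: "finite {k. k < length vs \<and> vs ! k < x}" by auto
  have "0 \<in> {k. k < length vs \<and> vs ! k < x}" using ne x by (auto simp: hd_conv_nth)
  then have k: "k < length vs" "vs ! k < x" using Max_in[OF fin] unfolding k_def by blast+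
  have "k \<noteq> length vs - 1" using k x ne by (auto simp: last_conv_nth)
  then have sk: "Suc k < length vs" using k by auto
  have "\<not> vs ! Suc k < x"
  proof
    assume "vs ! Suc k < x"
    then have "Suc k \<le> k" unfolding k_def using sk k_def by (intro Max_ge[OF fin]) auto
    then show False by simp
  qed
  moreover have "vs ! Suc k \<noteq> x" using x(3) sk nth_mem by blast
  ultimately show ?thesis using that k sk by force
qed

text \<open>In a chain without ears, maximality would turn a chord of shortest length into an ear.\<close>

lemma no_chord:
  assumes "link_chain vs"
    and no_ear: "\<And>k. k + 2 < length vs \<Longrightarrow> \<not> L (vs ! k) (vs ! (k + 2))"
  shows "a + 2 \<le> b \<Longrightarrow> b < length vs \<Longrightarrow> \<not> L (vs ! a) (vs ! b)"
proof (induction "b - a" arbitrary: a b rule: less_induct)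
  case less
  show ?case
  proof
    assume L: "L (vs ! a) (vs ! b)"
    have less_nth: "i < j \<Longrightarrow> j < length vs \<Longrightarrow> vs ! i < vs ! j" for i j
      using assms(1) by (auto simp: link_chain_def sorted_wrt_nth_less)
    have ab: "a + 3 \<le> b" using L no_ear[of a] less.prems by (cases "b = a + 2") auto
    have E: "vs ! i \<in> E" if "i < length vs" for i using assms(1) that by (auto simp: link_chain_def)
    \<comment> \<open>No link crosses this short chord: one that starts in a gap stays in the gap,
      and one that starts at \<open>vs ! Suc a\<close> is confined by the long chord and by the
      induction hypothesis.\<close>
    have "L (vs ! a) (vs ! (a + 2))"
    proof (rule maximal)
      fix r s assume rs: "L r s" "vs ! a < r" "r < vs ! (a + 2)"
      show "vs ! a \<le> s \<and> s \<le> vs ! (a + 2)"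
      proof (cases "r = vs ! Suc a")
        case False
        then consider "r < vs ! Suc a" | "vs ! Suc a < r" by linarith
        then show ?thesis
        proof cases
          case 1
          then show ?thesis using chain_gap(2)[OF assms(1), of a r s] rs less.prems
              less_nth[of "Suc a" "a+2"] by force
        next
          case 2
          then show ?thesis using chain_gap(2)[OF assms(1), of "Suc a" r s] rs less.prems
              less_nth[of a "Suc a"] by force
        qed
      next
        case True
        have sab: "vs ! a \<le> s" "s \<le> vs ! b"
          using link_under[OF L rs(1)] True less_nth[of a "Suc a"] less_nth[of "Suc a" b] less.prems by auto
        show ?thesis
        proof (rule ccontr)
          assume "\<not> ?thesis"
          then have s: "vs ! (a + 2) < s" using sab by auto
          show False
          proof (cases "s \<in> set vs")
            case True
            then obtain j where j: "j < length vs" "s = vs ! j" by (metis in_set_conv_nth)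
            \<comment> \<open>A link from \<open>vs ! Suc a\<close> to a later chain vertex
              \<open>vs ! j\<close> would be a chord shorter than the given one.\<close>
            have "a + 2 < j" using s j less_nth[of j "a + 2"] less.prems
              by (metis add_leD1 le_less_linear le_neq_implies_less not_less_iff_gr_or_eq order_le_less_trans)
            moreover have "j \<le> b" using sab(2) j less_nth[of b j] less.prems by force
            ultimately show False
              using less.hyps[of j "Suc a"] j rs(1) \<open>r = vs ! Suc a\<close> by auto
          next
            case False
            have "vs \<noteq> []" using less.prems by auto
            have "hd vs \<le> vs ! a" using less_nth[of 0 a] \<open>vs \<noteq> []\<close> less.prems
              by (cases "a = 0") (auto simp: hd_conv_nth)
            then have "hd vs < s" using s less_nth[of a "a + 2"] less.prems by auto
            moreover have "vs ! b \<le> last vs" using less_nth[of b "length vs - 1"] \<open>vs \<noteq> []\<close> less.prems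
              by (cases "b = length vs - 1") (force simp: last_conv_nth)+
            moreover have "s \<noteq> last vs" using False \<open>vs \<noteq> []\<close> last_in_set by blast
            ultimately have "s \<notin> region_vertices vs" using sab(2) False by (auto simp: region_vertices_def)
            then obtain k where k: "Suc k < length vs" "vs ! k < s" "s < vs ! Suc k"
              using chain_locate[OF assms(1) \<open>vs \<noteq> []\<close>] in_E2[OF rs(1)] by blast
            \<comment> \<open>Read from its end \<open>s\<close>, which lies in a gap, the link
              stays in that gap; since it also reaches \<open>vs ! Suc a\<close>, the gap ends at
              \<open>vs ! (a + 2)\<close> at the latest.\<close>
            have "vs ! k \<le> vs ! Suc a" using chain_gap(2)[OF assms(1) k sym[OF rs(1)]] \<open>r = _\<close> by auto
            then have "k \<le> Suc a" using less_nth[of "Suc a" k] k by force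
            then have "vs ! Suc k \<le> vs ! (a + 2)" using less_nth[of "Suc k" "a + 2"] less.prems
              by (cases "k = Suc a") auto
            then show False using s k by auto
          qed
        qed
      qed
    qed (use E less_nth less.prems in auto)
    then show False using no_ear[of a] less.prems by auto
  qed
qed

end

context noncrossing_links begin

section \<open>Triangles on the edges of a chain\<close>

lemma chain_nth:
  assumes "link_chain vs"
  shows "i < j \<Longrightarrow> j < length vs \<Longrightarrow> vs ! i < vs ! j"
    and "i < length vs \<Longrightarrow> vs ! i \<in> region_vertices vs"
    and "i < length vs \<Longrightarrow> vs ! i \<in> E"
    and "i < length vs \<Longrightarrow> finite {x. L (vs ! i) x}"
    and "Suc i < length vs \<Longrightarrow> L (vs ! i) (vs ! Suc i)"
  using assms chain_mem_region[OF assms]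
  by (auto simp: link_chain_def sorted_wrt_nth_less successively_conv_nth)

lemma region_vertices_cases:
  assumes "link_chain vs" "x \<in> region_vertices vs" "Suc k < length vs"
  shows "x \<le> vs ! k \<or> vs ! Suc k \<le> x"
  using chain_gap(1)[OF assms(1,3)] assms(2) by force

text \<open>The third corner is the first neighbour of \<open>u = vs ! k\<close> met when one turns around \<open>u\<close>
  starting at \<open>v\<close>; a link crossing the third side would be a link at \<open>u\<close> met earlier.\<close>

lemma triangle_on_chain_edge:
  assumes ch: "link_chain vs"
    and no_ear: "\<And>k. k + 2 < length vs \<Longrightarrow> \<not> L (vs ! k) (vs ! (k + 2))"
    and k: "0 < k" "Suc k < length vs"
  shows "\<exists>\<tau>\<in>inner_triangles L (region_vertices vs). vs ! k \<in> \<tau> \<and> vs ! Suc k \<in> \<tau>"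
proof -
  let ?V = "region_vertices vs"
  let ?t = "vs ! (k - 1)" and ?u = "vs ! k" and ?v = "vs ! Suc k"
  define N where "N = {x \<in> ?V. L ?u x \<and> x \<noteq> ?v}"
  have tuv: "?t < ?u" "?u < ?v" using chain_nth(1)[OF ch] k by auto
  have Luv: "L ?u ?v" using chain_nth(5)[OF ch] k by auto
  have Ltu: "L ?t ?u" using chain_nth(5)[OF ch, of "k - 1"] k by simp
  have finN: "finite N" unfolding N_def
    by (rule finite_subset[OF _ chain_nth(4)[OF ch, of k]]) (use k in auto)
  have tN: "?t \<in> N" unfolding N_def using chain_nth(2)[OF ch, of "k - 1"] sym[OF Ltu] tuv k by auto
  have gap1: "vs ! (k - 1) \<le> y \<and> y \<le> vs ! k" if "L x y" "?t < x" "x < ?u" for x y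
    using chain_gap(2)[OF ch, of "k - 1" x y] k that by auto
  have gap2: "vs ! k \<le> y \<and> y \<le> ?v" if "L x y" "?u < x" "x < ?v" for x y
    using chain_gap(2)[OF ch, of k x y] k that by auto
  \<comment> \<open>A point outside the region lies in a gap of the chain, and its links stay in the
    closed gap; being linked with \<open>?u\<close>, it lies in one of the two gaps next to
    \<open>?u\<close>.\<close>
  have between: "?t < x \<and> x < ?v" if x: "L ?u x" "x \<notin> ?V" for x
  proof -
    obtain j where j: "Suc j < length vs" "vs ! j < x" "x < vs ! Suc j"
      using chain_locate[OF ch _ in_E2[OF x(1)] x(2)] k by (metis list.size(3) not_less_zero)
    have ju: "vs ! j \<le> ?u" "?u \<le> vs ! Suc j" using chain_gap(2)[OF ch j sym[OF x(1)]] by auto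
    have "j \<le> k" using j ju chain_nth(1)[OF ch, of k j] by force
    moreover have "k \<le> Suc j" using j ju k chain_nth(1)[OF ch, of "Suc j" k] by force
    ultimately have "j = k \<or> j = k - 1" by auto
    then show ?thesis using j tuv k by auto
  qed
  have NV: "x \<le> ?u \<or> ?v \<le> x" if "x \<in> ?V" for x
    using region_vertices_cases[OF ch that k(2)] .
  obtain z where z: "z \<in> N" "L ?v z"
  proof (cases "\<exists>x\<in>N. ?v < x")
    case True
    define z where "z = Min {x \<in> N. ?v < x}"
    have "z \<in> {x \<in> N. ?v < x}" unfolding z_def using finN True by (intro Min_in) auto
    then have z: "z \<in> N" "?v < z" by auto
    have zmin: "z \<le> x" if "x \<in> N" "?v < x" for x
      unfolding z_def using that finN by (intro Min_le) auto
    have Luz: "L ?u z" using z by (auto simp: N_def)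
    have "L ?v z"
    proof (rule maximal)
      fix r s assume rs: "L r s" "?v < r" "r < z"
      have s: "?u \<le> s \<and> s \<le> z" using link_under[OF Luz rs(1)] rs tuv by auto
      have "s \<noteq> ?u"
      proof
        assume "s = ?u"
        then have Lur: "L ?u r" using rs sym by blast
        show False
        proof (cases "r \<in> ?V")
          case True
          then show False using zmin[of r] rs Lur by (auto simp: N_def)
        next
          case False
          then show False using between[OF Lur] rs by auto
        qed
      qed
      moreover have "\<not> (?u < s \<and> s < ?v)" using gap2[of s r] sym[OF rs(1)] rs by auto
      ultimately show "?v \<le> s \<and> s \<le> z" using s by auto
    qed (use in_E2[OF Luv] in_E2[OF Luz] z in auto)
    then show ?thesis using that z by blast
  next
    case False
    \<comment> \<open>No neighbour lies beyond \<open>?v\<close>, so the turn around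
      \<open>?u\<close> passes the point where the circle was cut and goes on from the far left. The
      set \<open>N\<close> is not empty because it contains \<open>?t\<close>.\<close>
    define z where "z = Min N"
    have z: "z \<in> N" using Min_in[OF finN] tN unfolding z_def by auto
    have zmin: "z \<le> x" if "x \<in> N" for x
      unfolding z_def using that finN by (intro Min_le) auto
    have Luz: "L ?u z" using z by (auto simp: N_def)
    have zt: "z \<le> ?t" using zmin[OF tN] .
    have "L z ?v"
    proof (rule maximal)
      fix r s assume rs: "L r s" "z < r" "r < ?v"
      consider "r = ?u" | "?u < r" | "r < ?u" by linarith
      then show "z \<le> s \<and> s \<le> ?v"
      proof cases
        case 1
        show ?thesis
        proof (cases "s \<in> ?V \<and> s \<noteq> ?v")
          case True
          then have "s \<in> N" using rs 1 by (auto simp: N_def)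
          then show ?thesis using zmin False by force
        next
          case False
          then show ?thesis using between[of s] rs 1 zt tuv by force
        qed
      next
        case 2
        then show ?thesis using gap2[OF rs(1)] rs zt tuv by auto
      next
        case 3
        then show ?thesis using link_under[OF sym[OF Luz] rs(1)] rs zt tuv by auto
      qed
    qed (use in_E2[OF Luv] in_E2[OF Luz] zt tuv in auto)
    then show ?thesis using that z sym by blast
  qed
  then have "{?u, ?v, z} \<in> inner_triangles L ?V"
    using chain_nth(2)[OF ch] k Luv by (intro inner_triangleI) (auto simp: N_def)
  then show ?thesis by blast
qed

text \<open>The region has no vertex below the edge, so two different third corners lie on the same
  side of it on the circle. Then a side of one triangle crosses a side of the other; the cases are
  the positions of the two corners on the line.\<close>

lemma triangle_on_chain_edge_unique:
  assumes ch: "link_chain vs" and k: "Suc k < length vs"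
    and \<tau>: "\<tau> \<in> inner_triangles L (region_vertices vs)" "vs ! k \<in> \<tau>" "vs ! Suc k \<in> \<tau>"
    and \<sigma>: "\<sigma> \<in> inner_triangles L (region_vertices vs)" "vs ! k \<in> \<sigma>" "vs ! Suc k \<in> \<sigma>"
  shows "\<tau> = \<sigma>"
proof -
  let ?u = "vs ! k" and ?v = "vs ! Suc k"
  have uv: "?u < ?v" using chain_nth(1)[OF ch, of k "Suc k"] k by auto
  have False if "x < y" "x \<in> region_vertices vs" "y \<in> region_vertices vs"
    "x \<notin> {?u, ?v}" "y \<notin> {?u, ?v}" "L ?u x" "L ?u y" "L ?v x" "L ?v y" for x y
  proof -
    have "x < ?u \<or> ?v < x" "y < ?u \<or> ?v < y"
      using region_vertices_cases[OF ch that(2) k] region_vertices_cases[OF ch that(3) k] that by auto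
    then consider "y < ?u" | "x < ?u" "?v < y" | "?v < x" using \<open>x < y\<close> by linarith
    then show False
      using noncrossing[of x ?u y ?v] noncrossing[of ?u y ?v x] noncrossing[of x ?v ?u y] noncrossing[of ?u x ?v y] that uv sym by metis
  qed
  note key = this
  obtain x where x: "\<tau> = {?u, ?v, x}" "x \<noteq> ?u" "x \<noteq> ?v" "x \<in> region_vertices vs" "L ?u x" "L ?v x"
    using inner_triangle_third[OF \<tau>] uv by auto
  obtain y where y: "\<sigma> = {?u, ?v, y}" "y \<noteq> ?u" "y \<noteq> ?v" "y \<in> region_vertices vs" "L ?u y" "L ?v y"
    using inner_triangle_third[OF \<sigma>] uv by auto
  have "x = y" using key[of x y] key[of y x] x y by (metis insert_iff empty_iff linorder_neqE)
  then show ?thesis using x y by simp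
qed

section \<open>Matchings of a chain\<close>

lemma sdrs_chain_no_ear:
  fixes lo hi :: real and ws :: "real list"
  defines "vs \<equiv> lo # ws @ [hi]"
  assumes ch: "link_chain vs"
    and no_ear: "\<And>k. k + 2 < length vs \<Longrightarrow> \<not> L (vs ! k) (vs ! (k + 2))"
  defines "S \<equiv> triangles_at L (region_vertices vs)"
  shows "int (card (sdrs (map S ws))) = continuant (map (int \<circ> card \<circ> S) ws)"
    and "sdrs (map S ws) \<noteq> {}"
proof -
  have len: "length vs = length ws + 2" by (simp add: vs_def)
  have nth: "ws ! i = vs ! Suc i" if "i < length ws" for i using that by (auto simp: vs_def nth_append)
  have fin: "finite (S w)" if w: "w \<in> set ws" for w
    unfolding S_def using ch w by (intro finite_triangles_at) (auto simp: link_chain_def vs_def)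
  have "int (card (sdrs (map S ws))) = continuant (map (int \<circ> card) (map S ws))"
  proof (rule card_sdrs_path)
    show "finite U" if "U \<in> set (map S ws)" for U using that fin by auto
    show "\<exists>\<tau>. map S ws ! k \<inter> map S ws ! Suc k = {\<tau>}" if k: "Suc k < length (map S ws)" for k
    proof -
      obtain \<tau> where \<tau>: "\<tau> \<in> inner_triangles L (region_vertices vs)" "vs ! Suc k \<in> \<tau>"
        "vs ! Suc (Suc k) \<in> \<tau>"
        using triangle_on_chain_edge[OF ch no_ear, of "Suc k"] k len by auto
      have "S (vs ! Suc k) \<inter> S (vs ! Suc (Suc k)) = {\<tau>}"
      proof (intro equalityI subsetI)
        fix \<sigma> assume "\<sigma> \<in> S (vs ! Suc k) \<inter> S (vs ! Suc (Suc k))"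
        then show "\<sigma> \<in> {\<tau>}"
          using triangle_on_chain_edge_unique[OF ch _ _ _ _ \<tau>, of \<sigma>] k len by (auto simp: S_def triangles_at_def)
      qed (use \<tau> in \<open>auto simp: S_def triangles_at_def\<close>)
      then show ?thesis using nth[of k] nth[of "Suc k"] k by (intro exI[of _ \<tau>]) simp
    qed
    show "map S ws ! k \<inter> map S ws ! l = {}" if kl: "Suc k < l" "l < length (map S ws)" for k l
    proof -
      have "\<not> L (vs ! Suc k) (vs ! Suc l)"
        using no_chord[OF ch no_ear, of "Suc k" "Suc l"] kl len by auto
      moreover have "vs ! Suc k \<noteq> vs ! Suc l"
        using chain_nth(1)[OF ch, of "Suc k" "Suc l"] kl len by auto
      ultimately have "S (vs ! Suc k) \<inter> S (vs ! Suc l) = {}"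
        by (auto simp: S_def triangles_at_def inner_triangles_def)
      then show ?thesis using nth[of k] nth[of l] kl by simp
    qed
  qed
  then show "int (card (sdrs (map S ws))) = continuant (map (int \<circ> card \<circ> S) ws)" by simp
  \<comment> \<open>An explicit matching: every inner vertex gets the triangle on the chain edge to
    its right. If two vertices got the same triangle, it would have a chord of the chain as a side,
    which \<open>no_chord\<close> excludes.\<close>
  have "\<forall>i. \<exists>\<tau>. i < length ws \<longrightarrow> \<tau> \<in> inner_triangles L (region_vertices vs) \<and>
      vs ! Suc i \<in> \<tau> \<and> vs ! Suc (Suc i) \<in> \<tau>"
    using triangle_on_chain_edge[OF ch no_ear] len by fastforce
  then obtain t where t: "\<And>i. i < length ws \<Longrightarrow> t i \<in> inner_triangles L (region_vertices vs)"
    "\<And>i. i < length ws \<Longrightarrow> vs ! Suc i \<in> t i" "\<And>i. i < length ws \<Longrightarrow> vs ! Suc (Suc i) \<in> t i"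
    by metis
  have neq: "t i \<noteq> t j" if ij: "i < j" "j < length ws" for i j
  proof
    assume eq: "t i = t j"
    have "vs ! Suc i \<in> t i" "vs ! Suc (Suc j) \<in> t i" "t i \<in> inner_triangles L (region_vertices vs)"
      using t ij eq by auto
    moreover have "vs ! Suc i \<noteq> vs ! Suc (Suc j)"
      using chain_nth(1)[OF ch, of "Suc i" "Suc (Suc j)"] ij len by auto
    ultimately have "L (vs ! Suc i) (vs ! Suc (Suc j))"
      by (auto simp: inner_triangles_def)
    then show False using no_chord[OF ch no_ear, of "Suc i" "Suc (Suc j)"] ij len by auto
  qed
  have "map t [0..<length ws] \<in> sdrs (map S ws)"
    unfolding sdrs_def
  proof (intro CollectI conjI)
    show "list_all2 (\<in>) (map t [0..<length ws]) (map S ws)"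
      using t nth by (auto simp: list_all2_conv_all_nth S_def triangles_at_def)
    show "distinct (map t [0..<length ws])"
      unfolding distinct_map inj_on_def using neq
      by (auto, metis linorder_neqE_nat)
  qed
  then show "sdrs (map S ws) \<noteq> {}" by blast
qed

text \<open>Here \<open>f\<close> counts the triangles before and \<open>g\<close> after the removal
  of the ear at \<open>v\<close>. A neighbour of \<open>v\<close> may be \<open>lo\<close> or
  \<open>hi\<close>, whose count does not enter; hence the four cases, with \<open>v\<close> the
  only, the first, the last or a middle entry.\<close>

lemma continuant_cut_ear:
  assumes "\<And>w. w \<in> set as \<union> set bs \<Longrightarrow> g w = f w - (if w = last (lo # as) \<or> w = hd (bs @ [hi]) then 1 else 0)"
    and "f v = (1::int)" "distinct (lo # as @ v # bs @ [hi])"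
  shows "continuant (map f (as @ v # bs)) = continuant (map g (as @ bs))"
proof -
  have A: "as = [] \<or> (\<exists>as' x. as = as' @ [x])" by (cases as rule: rev_cases) auto
  have B: "bs = [] \<or> (\<exists>y bs'. bs = y # bs')" by (cases bs) auto
  have eq: "map g us = map f us" if "set us \<subseteq> set as \<union> set bs" "last (lo # as) \<notin> set us" "hd (bs @ [hi]) \<notin> set us" for us
    using that assms(1) by (auto simp: subset_iff)
  consider "as = []" "bs = []" | y bs' where "as = []" "bs = y # bs'"
    | as' x where "as = as' @ [x]" "bs = []" | as' x y bs' where "as = as' @ [x]" "bs = y # bs'"
    using A B by blast
  then show ?thesis
  proof cases
    case 1
    then show ?thesis using assms(2) by simp
  next
    case 2
    then have e: "map g bs' = map f bs'" "g y = f y - 1" using eq[of bs'] assms(1,3) by auto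
    show ?thesis using continuant_one_Cons[of "f y" "map f bs'"] by (simp add: 2 e assms(2))
  next
    case 3
    then have e: "map g as' = map f as'" "g x = f x - 1" using eq[of as'] assms(1,3) by auto
    show ?thesis by (simp add: 3 e assms(2) continuant_one_last)
  next
    case 4
    then have e: "map g as' = map f as'" "g x = f x - 1" "map g bs' = map f bs'" "g y = f y - 1"
      using eq[of as'] eq[of bs'] assms(1,3) by auto
    show ?thesis by (simp add: 4 e assms(2) continuant_one_middle)
  qed
qed

text \<open>Nonemptiness is carried through the induction because it is what makes the continuant
  positive in the end.\<close>

theorem sdrs_chain:
  assumes "link_chain (lo # ws @ [hi])"
  shows "int (card (sdrs (map (triangles_at L (region_vertices (lo # ws @ [hi]))) ws)))
      = continuant (map (int \<circ> card \<circ> triangles_at L (region_vertices (lo # ws @ [hi]))) ws)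
    \<and> sdrs (map (triangles_at L (region_vertices (lo # ws @ [hi]))) ws) \<noteq> {}"
  using assms
proof (induction "length ws" arbitrary: ws)
  case 0
  then show ?case by simp
next
  case (Suc n)
  let ?vs = "lo # ws @ [hi]"
  note ch = Suc.prems
  show ?case
  proof (cases "\<exists>k. k + 2 < length ?vs \<and> L (?vs ! k) (?vs ! (k + 2))")
    case False
    then show ?thesis using sdrs_chain_no_ear[OF ch] by (meson add_2_eq_Suc')
  next
    case True
    then obtain k where k: "k + 2 < length ?vs" "L (?vs ! k) (?vs ! (k + 2))" by blast
    define as where "as = take k ws"
    define bs where "bs = drop (Suc k) ws"
    define v where "v = ws ! k"
    have kl: "k < length ws" using k by auto
    have ws: "ws = as @ v # bs" unfolding as_def bs_def v_def using kl by (simp add: id_take_nth_drop)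
    have len: "length as = k" using kl by (simp add: as_def)
    define x where "x = last (lo # as)"
    define y where "y = hd (bs @ [hi])"
    have nx: "?vs ! k = x" unfolding x_def ws using len
      by (cases as rule: rev_cases) (auto simp: nth_append)
    have nv: "?vs ! Suc k = v" unfolding ws using len by (auto simp: nth_append)
    have ny: "?vs ! (k + 2) = y" unfolding ws y_def using len
      by (cases bs) (auto simp: nth_append)
    let ?vs' = "lo # (as @ bs) @ [hi]"
    let ?V = "region_vertices ?vs" and ?V' = "region_vertices ?vs'"
    define \<tau> where "\<tau> = {x, v, y}"
    have Lxy: "L x y" using k nx ny by simp
    have Lxv: "L x v" and Lvy: "L v y"
      using chain_nth(5)[OF ch, of k] chain_nth(5)[OF ch, of "Suc k"] nx nv ny k by auto
    have xvy: "x < v" "v < y" using chain_nth(1)[OF ch, of k "Suc k"] chain_nth(1)[OF ch, of "Suc k" "k + 2"] nx nv ny k by auto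
    have sorted: "sorted_wrt (<) ?vs" using ch by (simp add: link_chain_def)
    \<comment> \<open>The new edge from \<open>x\<close> to \<open>y\<close> hides \<open>v\<close>
      and the two gaps beside it, and these gaps were hidden before.\<close>
    have V': "?V' = ?V - {v}"
      using sorted ch unfolding ws by (auto simp: region_vertices_def link_chain_def sorted_wrt_append)
    \<comment> \<open>A link at \<open>v\<close> cannot leave the interval under the link from
      \<open>x\<close> to \<open>y\<close>, and strictly between \<open>x\<close> and
      \<open>y\<close> the region has no vertex except \<open>v\<close>.\<close>
    have nbr: "z = x \<or> z = y" if "L v z" "z \<in> ?V" for z
    proof -
      have "x \<le> z" "z \<le> y" using link_under[OF Lxy that(1)] xvy by auto
      moreover have "z \<le> x \<or> v \<le> z" "z \<le> v \<or> y \<le> z"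
        using region_vertices_cases[OF ch that(2), of k] region_vertices_cases[OF ch that(2), of "Suc k"]
          k nx nv ny by auto
      moreover have "z \<noteq> v" using that irrefl by blast
      ultimately show ?thesis by auto
    qed
    have \<tau>: "\<tau> \<in> inner_triangles L ?V" unfolding \<tau>_def
      using chain_nth(2)[OF ch, of k] chain_nth(2)[OF ch, of "Suc k"] chain_nth(2)[OF ch, of "k + 2"] k nx nv ny Lxy Lxv Lvy
      by (intro inner_triangleI) auto
    have only: "\<sigma> = \<tau>" if "\<sigma> \<in> inner_triangles L ?V" "v \<in> \<sigma>" for \<sigma>
    proof -
      have "z \<in> \<tau>" if "z \<in> \<sigma>" for z
      proof (cases "z = v")
        case False
        then have "L v z" "z \<in> ?V" using \<open>\<sigma> \<in> _\<close> \<open>v \<in> \<sigma>\<close> that by (auto simp: inner_triangles_def)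
        then show ?thesis using nbr by (auto simp: \<tau>_def)
      qed (simp add: \<tau>_def)
      then have "\<sigma> \<subseteq> \<tau>" by blast
      moreover have "card \<tau> = card \<sigma>" using that \<tau> by (auto simp: inner_triangles_def)
      moreover have "finite \<tau>" by (simp add: \<tau>_def)
      ultimately show ?thesis using card_subset_eq by metis
    qed
    have tri': "inner_triangles L ?V' = inner_triangles L ?V - {\<tau>}"
    proof -
      have "inner_triangles L ?V' = {\<sigma> \<in> inner_triangles L ?V. v \<notin> \<sigma>}"
        unfolding V' inner_triangles_def by blast
      moreover have "v \<in> \<tau>" by (simp add: \<tau>_def)
      ultimately show ?thesis using only by blast
    qed
    have star': "triangles_at L ?V' w = triangles_at L ?V w - {\<tau>}" for w
      unfolding triangles_at_def tri' by auto
    have "v \<in> \<tau>" by (simp add: \<tau>_def)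
    then have starv: "triangles_at L ?V v = {\<tau>}" using only \<tau> unfolding triangles_at_def by blast
    have succ': "successively L ?vs'"
    proof -
      have "successively L ((lo # as) @ (v # bs @ [hi]))" using ch ws by (simp add: link_chain_def)
      then have "successively L (lo # as)" "successively L (v # bs @ [hi])"
        unfolding successively_append_iff by blast+
      moreover from this(2) have "successively L (bs @ [hi])" by (auto simp: successively_Cons)
      ultimately have "successively L ((lo # as) @ (bs @ [hi]))"
        using Lxy unfolding successively_append_iff x_def y_def by simp
      then show ?thesis by simp
    qed
    have ch': "link_chain ?vs'"
      using ch succ' unfolding link_chain_def ws by (auto simp: sorted_wrt_append)
    have IH: "int (card (sdrs (map (triangles_at L ?V') (as @ bs))))
        = continuant (map (int \<circ> card \<circ> triangles_at L ?V') (as @ bs)) \<and> sdrs (map (triangles_at L ?V') (as @ bs)) \<noteq> {}"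
      using Suc.hyps(1)[OF _ ch'] Suc.hyps(2) ws by simp
    have m: "map (triangles_at L ?V) ws = map (triangles_at L ?V) as @ {\<tau>} # map (triangles_at L ?V) bs"
      using starv by (simp add: ws)
    have m': "map (triangles_at L ?V') (as @ bs) = map (\<lambda>S. S - {\<tau>}) (map (triangles_at L ?V) as @ map (triangles_at L ?V) bs)"
      using star' by simp
    have g: "(int \<circ> card \<circ> triangles_at L ?V') w = (int \<circ> card \<circ> triangles_at L ?V) w - (if w = last (lo # as) \<or> w = hd (bs @ [hi]) then 1 else 0)"
      if w: "w \<in> set as \<union> set bs" for w
    proof -
      have "finite (triangles_at L ?V w)" using ch w unfolding ws by (intro finite_triangles_at) (auto simp: link_chain_def)
      moreover have "w \<noteq> v" using sorted w unfolding ws by (auto simp: sorted_wrt_append)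
      then have "\<tau> \<in> triangles_at L ?V w \<longleftrightarrow> w = x \<or> w = y" using \<tau> by (auto simp: triangles_at_def \<tau>_def)
      ultimately have "int (card (triangles_at L ?V w - {\<tau>})) = int (card (triangles_at L ?V w)) - (if w = x \<or> w = y then 1 else 0)"
        using card_Suc_Diff1[of "triangles_at L ?V w" \<tau>] by (cases "\<tau> \<in> triangles_at L ?V w") auto
      then show ?thesis using star' by (simp add: x_def y_def)
    qed
    have "continuant (map (int \<circ> card \<circ> triangles_at L ?V) (as @ v # bs)) = continuant (map (int \<circ> card \<circ> triangles_at L ?V') (as @ bs))"
    proof (rule continuant_cut_ear[OF g])
      show "(int \<circ> card \<circ> triangles_at L ?V) v = 1" by (simp add: starv)
      show "distinct (lo # as @ v # bs @ [hi])"
        using sorted strict_sorted_iff[of ?vs] unfolding ws by simp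
    qed
    moreover have "card (sdrs (map (triangles_at L ?V) ws)) = card (sdrs (map (triangles_at L ?V') (as @ bs)))"
      unfolding m m' by (rule card_sdrs_insert_singleton)
    moreover have "sdrs (map (triangles_at L ?V) ws) \<noteq> {}"
    proof -
      have "sdrs (map (\<lambda>S. S - {\<tau>}) (map (triangles_at L ?V) as @ map (triangles_at L ?V) bs)) \<noteq> {}"
        using IH unfolding m' by (rule conjunct2)
      then show ?thesis unfolding m by (rule sdrs_insert_singleton_nonempty)
    qed
    ultimately show ?thesis using IH unfolding ws by simp
  qed
qed
end

section \<open>The disc model of the strip\<close>

definition closed_strip :: "complex set" where
  "closed_strip = {z. 0 \<le> Im z \<and> Im z \<le> 1}"

text \<open>The conformal map of the strip onto the unit disc that sends the limit points to \<open>\<plusminus>1\<close>: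
  an exponential onto the right half-plane followed by a Cayley transform.\<close>

definition to_disc :: "complex \<Rightarrow> complex" where
  "to_disc z = (exp (of_real pi * (z - \<i> / 2)) - 1) / (exp (of_real pi * (z - \<i> / 2)) + 1)"

text \<open>The principal branch of the logarithm is the right one: for \<open>c\<close> in the
  closed disc other than 1 and -1 the quotient is a nonzero point of the closed right half-plane,
  away from the branch cut.\<close>

definition from_disc :: "complex \<Rightarrow> complex" where
  "from_disc c = Ln ((1 + c) / (1 - c)) / of_real pi + \<i> / 2"

fun disc_end :: "strip_end \<Rightarrow> complex" where
  "disc_end (Point z) = to_disc z"
| "disc_end PosLimit = 1"
| "disc_end NegLimit = -1"

definition strip_ends :: "strip_end set" where
  "strip_ends = insert PosLimit (insert NegLimit (Point ` closed_strip))"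

lemma norm_diff_one_iff:
  "norm (v - 1) \<le> norm (v + 1) \<longleftrightarrow> 0 \<le> Re v" "norm (v - 1) < norm (v + 1) \<longleftrightarrow> 0 < Re v"
proof -
  have "(norm (v + 1))\<^sup>2 = (norm (v - 1))\<^sup>2 + 4 * Re v"
    unfolding cmod_power2 by (simp add: power2_eq_square algebra_simps)
  moreover have "norm (v - 1) \<le> norm (v + 1) \<longleftrightarrow> (norm (v - 1))\<^sup>2 \<le> (norm (v + 1))\<^sup>2"
    by (simp add: power_mono_iff)
  moreover have "norm (v - 1) < norm (v + 1) \<longleftrightarrow> (norm (v - 1))\<^sup>2 < (norm (v + 1))\<^sup>2"
    by (metis abs_norm_cancel abs_le_square_iff linorder_not_less)
  ultimately show "norm (v - 1) \<le> norm (v + 1) \<longleftrightarrow> 0 \<le> Re v" "norm (v - 1) < norm (v + 1) \<longleftrightarrow> 0 < Re v"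
    by linarith+
qed

lemma cayley_norm:
  assumes "0 \<le> Re v"
  shows "norm ((v - 1) / (v + 1)) \<le> 1" "norm ((v - 1) / (v + 1)) < 1 \<longleftrightarrow> 0 < Re v"
    "v + 1 \<noteq> 0"
proof -
  show ne: "v + 1 \<noteq> 0" using assms by (auto simp: complex_eq_iff)
  then have "0 < norm (v + 1)" by simp
  then show "norm ((v - 1) / (v + 1)) \<le> 1" "norm ((v - 1) / (v + 1)) < 1 \<longleftrightarrow> 0 < Re v"
    using norm_diff_one_iff[of v] assms by (auto simp: norm_divide divide_le_eq divide_less_eq)
qed

lemma cayley_Re:
  assumes "c \<noteq> 1"
  shows "0 \<le> Re ((1 + c) / (1 - c)) \<longleftrightarrow> norm c \<le> 1" "0 < Re ((1 + c) / (1 - c)) \<longleftrightarrow> norm c < 1"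
proof -
  have "(1 + c) / (1 - c) - 1 = 2 * c / (1 - c)" "(1 + c) / (1 - c) + 1 = 2 / (1 - c)"
    using assms by (auto simp: field_simps)
  then have "norm ((1 + c) / (1 - c) - 1) = 2 * norm c / norm (1 - c)"
    "norm ((1 + c) / (1 - c) + 1) = 2 / norm (1 - c)"
    by (auto simp: norm_divide norm_mult)
  moreover have "0 < norm (1 - c)" using assms by simp
  ultimately show "0 \<le> Re ((1 + c) / (1 - c)) \<longleftrightarrow> norm c \<le> 1" "0 < Re ((1 + c) / (1 - c)) \<longleftrightarrow> norm c < 1"
    using norm_diff_one_iff[of "(1 + c) / (1 - c)"] by (auto simp: divide_le_cancel divide_less_cancel)
qed

lemma Re_strip_exp:
  "Re (exp (of_real pi * (z - \<i> / 2))) = exp (pi * Re z) * sin (pi * Im z)"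
  by (simp add: Re_exp cos_diff algebra_simps)

lemma sin_strip:
  "z \<in> closed_strip \<Longrightarrow> 0 \<le> sin (pi * Im z)"
  "z \<in> closed_strip \<Longrightarrow> 0 < sin (pi * Im z) \<longleftrightarrow> z \<in> open_strip"
proof -
  assume z: "z \<in> closed_strip"
  show "0 \<le> sin (pi * Im z)" using z by (intro sin_ge_zero) (auto simp: closed_strip_def)
  show "0 < sin (pi * Im z) \<longleftrightarrow> z \<in> open_strip"
  proof
    assume "0 < sin (pi * Im z)"
    then have "Im z \<noteq> 0" "Im z \<noteq> 1" by auto
    then show "z \<in> open_strip" using z by (auto simp: closed_strip_def open_strip_def)
  qed (auto intro!: sin_gt_zero simp: open_strip_def)
qed

lemma open_strip_subset: "open_strip \<subseteq> closed_strip"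
  by (auto simp: open_strip_def closed_strip_def)

lemma to_disc_norm:
  assumes "z \<in> closed_strip"
  shows "norm (to_disc z) \<le> 1" "norm (to_disc z) < 1 \<longleftrightarrow> z \<in> open_strip"
    "exp (of_real pi * (z - \<i> / 2)) + 1 \<noteq> 0"
proof -
  let ?v = "exp (of_real pi * (z - \<i> / 2))"
  have "0 \<le> Re ?v" unfolding Re_strip_exp using sin_strip(1)[OF assms] by simp
  from cayley_norm[OF this] show "norm (to_disc z) \<le> 1" "?v + 1 \<noteq> 0"
    "norm (to_disc z) < 1 \<longleftrightarrow> z \<in> open_strip"
    using sin_strip(2)[OF assms] unfolding to_disc_def Re_strip_exp by (auto simp: zero_less_mult_iff)
qed

lemma to_disc_ne: "z \<in> closed_strip \<Longrightarrow> to_disc z \<noteq> 1 \<and> to_disc z \<noteq> -1"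
  using to_disc_norm(3)[of z] by (auto simp: to_disc_def field_simps)

lemma cayley_to_disc:
  assumes "z \<in> closed_strip"
  shows "(1 + to_disc z) / (1 - to_disc z) = exp (of_real pi * (z - \<i> / 2))"
proof -
  define v where "v = exp (of_real pi * (z - \<i> / 2))"
  have v: "v + 1 \<noteq> 0" using to_disc_norm(3)[OF assms] by (simp add: v_def)
  have "1 + to_disc z = 2 * v / (v + 1)" "1 - to_disc z = 2 / (v + 1)"
    using v unfolding to_disc_def v_def[symmetric] by (auto simp: field_simps)
  then show ?thesis using v by (simp add: v_def)
qed

lemma from_to_disc: "z \<in> closed_strip \<Longrightarrow> from_disc (to_disc z) = z"
proof -
  assume z: "z \<in> closed_strip"
  have "- (pi / 2) \<le> pi * (Im z - 1 / 2)" "pi * (Im z - 1 / 2) \<le> pi / 2"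
    using z mult_left_mono[of "Im z" 1 pi] by (auto simp: closed_strip_def algebra_simps)
  then have "Ln (exp (of_real pi * (z - \<i> / 2))) = of_real pi * (z - \<i> / 2)"
    using pi_gt_zero by (intro Ln_exp) (simp_all del: pi_gt_zero)
  then show ?thesis unfolding from_disc_def cayley_to_disc[OF z] by (simp add: field_simps)
qed

lemma to_from_disc:
  assumes "norm c \<le> 1" "c \<noteq> 1" "c \<noteq> -1"
  shows "from_disc c \<in> closed_strip" "to_disc (from_disc c) = c"
    "norm c < 1 \<Longrightarrow> from_disc c \<in> open_strip"
proof -
  define v where "v = (1 + c) / (1 - c)"
  have v0: "v \<noteq> 0" using assms by (auto simp: v_def add_eq_0_iff)
  have Rev: "0 \<le> Re v" using cayley_Re(1)[OF assms(2)] assms(1) by (simp add: v_def)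
  have im: "Im (from_disc c) = Im (Ln v) / pi + 1 / 2" by (simp add: from_disc_def v_def)
  have "\<bar>Im (Ln v)\<bar> \<le> pi / 2" using Re_Ln_pos_le[OF v0] Rev by auto
  then show S: "from_disc c \<in> closed_strip"
    using pi_gt_zero unfolding closed_strip_def mem_Collect_eq im abs_le_iff by (auto simp: field_simps)
  have "exp (of_real pi * (from_disc c - \<i> / 2)) = v"
    using v0 by (simp add: from_disc_def v_def[symmetric])
  then have "to_disc (from_disc c) = (v - 1) / (v + 1)" by (simp add: to_disc_def)
  moreover have "v - 1 = 2 * c / (1 - c)" "v + 1 = 2 / (1 - c)"
    using assms by (auto simp: v_def field_simps)
  ultimately show T: "to_disc (from_disc c) = c" using assms by simp
  show "norm c < 1 \<Longrightarrow> from_disc c \<in> open_strip" using to_disc_norm(2)[OF S] T by simp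
qed

lemma inj_on_to_disc: "inj_on to_disc closed_strip"
  by (metis inj_onI from_to_disc)

lemma continuous_on_to_disc: "continuous_on closed_strip to_disc"
  unfolding to_disc_def by (intro continuous_intros) (use to_disc_norm(3) in auto)

lemma continuous_on_from_disc: "continuous_on (cball 0 1 - {1, -1}) from_disc"
  unfolding from_disc_def
proof (intro continuous_intros)
  show "(1 + z) / (1 - z) \<notin> \<real>\<^sub>\<le>\<^sub>0" if z: "z \<in> cball 0 1 - {1, -1}" for z :: complex
  proof
    assume *: "(1 + z) / (1 - z) \<in> \<real>\<^sub>\<le>\<^sub>0"
    have "0 \<le> Re ((1 + z) / (1 - z))" using cayley_Re(1)[of z] z by auto
    then have "(1 + z) / (1 - z) = 0" using * by (auto simp: complex_nonpos_Reals_iff complex_eq_iff)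
    then show False using z by (auto simp: add_eq_0_iff)
  qed
qed auto

lemma to_disc_image: "to_disc ` closed_strip = cball 0 1 - {1, -1}"
proof (intro equalityI subsetI)
  fix c :: complex assume "c \<in> cball 0 1 - {1, -1}"
  then show "c \<in> to_disc ` closed_strip" using to_from_disc[of c] by (intro image_eqI[of _ _ "from_disc c"]) auto
qed (use to_disc_norm(1) to_disc_ne in auto)

lemma to_disc_image_open: "to_disc ` open_strip = ball 0 1"
proof (intro equalityI subsetI)
  fix c :: complex assume "c \<in> ball 0 1"
  then show "c \<in> to_disc ` open_strip" using to_from_disc[of c] by (intro image_eqI[of _ _ "from_disc c"]) force+
qed (use to_disc_norm(2) open_strip_subset in auto)

lemma closed_closed_strip: "closed closed_strip"
  unfolding closed_strip_def Collect_conj_eq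
  by (intro closed_Int closed_Collect_le continuous_intros)

lemma open_open_strip: "open open_strip"
  unfolding open_strip_def Collect_conj_eq
  by (intro open_Int open_Collect_less continuous_intros)

lemma inj_on_disc_end: "inj_on disc_end strip_ends"
proof (rule inj_onI)
  fix p q assume "p \<in> strip_ends" "q \<in> strip_ends" "disc_end p = disc_end q"
  then show "p = q"
    using to_disc_ne inj_onD[OF inj_on_to_disc]
    by (cases p; cases q) (auto simp: strip_ends_def dest: to_disc_ne[of _] sym)
qed

lemma norm_strip_exp: "norm (exp (of_real pi * (z - \<i> / 2))) = exp (pi * Re z)"
  by (simp add: norm_exp_eq_Re)

text \<open>After this the three kinds of ends are alike, namely limits in the closed disc. At a
  limit point the real part diverges exactly if the exponential tends to infinity or to 0, and the
  Cayley transform takes these values to 1 and -1.\<close>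

lemma approaches_iff_tendsto_to_disc:
  assumes p: "p \<in> strip_ends" and S: "\<forall>\<^sub>F x in F. f x \<in> closed_strip"
  shows "approaches f p F \<longleftrightarrow> ((\<lambda>x. to_disc (f x)) \<longlongrightarrow> disc_end p) F"
proof -
  let ?v = "\<lambda>x. exp (of_real pi * (f x - \<i> / 2))"
  have v: "\<forall>\<^sub>F x in F. (1 + to_disc (f x)) / (1 - to_disc (f x)) = ?v x"
    using S by eventually_elim (rule cayley_to_disc)
  have v1: "\<forall>\<^sub>F x in F. ?v x + 1 \<noteq> 0"
    using S by eventually_elim (rule to_disc_norm(3))
  have ne: "\<forall>\<^sub>F x in F. to_disc (f x) \<noteq> 1"
    using S by eventually_elim (use to_disc_ne in blast)
  consider w where "p = Point w" "w \<in> closed_strip" | "p = PosLimit" | "p = NegLimit"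
    using p by (auto simp: strip_ends_def)
  then show ?thesis
  proof cases
    case 1
    show ?thesis
    proof
      assume "approaches f p F"
      then have "(f \<longlongrightarrow> w) F" using 1 by simp
      then have "((\<lambda>x. to_disc (f x)) \<longlongrightarrow> to_disc w) F"
        unfolding to_disc_def by (intro tendsto_intros) (use to_disc_norm(3) 1 in auto)
      then show "((\<lambda>x. to_disc (f x)) \<longlongrightarrow> disc_end p) F" using 1 by simp
    next
      assume t: "((\<lambda>x. to_disc (f x)) \<longlongrightarrow> disc_end p) F"
      have D: "\<forall>\<^sub>F x in F. to_disc (f x) \<in> cball 0 1 - {1, -1}"
        using S by eventually_elim (use to_disc_image in blast)
      have "((\<lambda>x. from_disc (to_disc (f x))) \<longlongrightarrow> from_disc (to_disc w)) F"
        by (rule continuous_on_tendsto_compose[OF continuous_on_from_disc]) (use t 1 D to_disc_norm(1) to_disc_ne in auto)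
      moreover have "\<forall>\<^sub>F x in F. from_disc (to_disc (f x)) = f x"
        using S by eventually_elim (rule from_to_disc)
      ultimately have "(f \<longlongrightarrow> w) F" using 1 from_to_disc by (simp add: tendsto_cong)
      then show "approaches f p F" using 1 by simp
    qed
  next
    case 2
    have "approaches f p F \<longleftrightarrow> filterlim (\<lambda>x. exp (pi * Re (f x))) at_top F"
    proof -
      have "filterlim (\<lambda>x. Re (f x)) at_top F \<longleftrightarrow> filterlim (\<lambda>x. pi * Re (f x)) at_top F"
        by (subst filterlim_tendsto_pos_mult_at_top_iff[OF tendsto_const]) auto
      also have "\<dots> \<longleftrightarrow> filterlim (\<lambda>x. exp (pi * Re (f x))) at_top F"
      proof
        assume "filterlim (\<lambda>x. exp (pi * Re (f x))) at_top F"
        from filterlim_compose[OF ln_at_top this] show "filterlim (\<lambda>x. pi * Re (f x)) at_top F" by simp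
      qed (rule filterlim_compose[OF exp_at_top])
      finally show ?thesis using 2 by simp
    qed
    also have "\<dots> \<longleftrightarrow> filterlim ?v at_infinity F"
      unfolding filterlim_at_infinity_conv_norm_at_top norm_strip_exp ..
    also have "\<dots> \<longleftrightarrow> ((\<lambda>x. to_disc (f x)) \<longlongrightarrow> 1) F"
    proof
      assume "filterlim ?v at_infinity F"
      then have "filterlim (\<lambda>x. ?v x + 1) at_infinity F"
        by (intro tendsto_add_filterlim_at_infinity') (auto intro: tendsto_const)
      then have "((\<lambda>x. 1 - 2 / (?v x + 1)) \<longlongrightarrow> 1 - 0) F"
        by (intro tendsto_diff tendsto_const tendsto_divide_0[OF tendsto_const])
      moreover have "\<forall>\<^sub>F x in F. 1 - 2 / (?v x + 1) = to_disc (f x)"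
        using v1 by eventually_elim (auto simp: to_disc_def field_simps)
      ultimately show "((\<lambda>x. to_disc (f x)) \<longlongrightarrow> 1) F" by (simp add: tendsto_cong)
    next
      assume t: "((\<lambda>x. to_disc (f x)) \<longlongrightarrow> 1) F"
      have "filterlim (\<lambda>x. 1 - to_disc (f x)) (at 0) F"
        unfolding filterlim_at using t ne tendsto_diff[OF tendsto_const[of 1] t]
        by (auto elim: eventually_mono)
      moreover have "((\<lambda>x. 1 + to_disc (f x)) \<longlongrightarrow> 2) F"
        using tendsto_add[OF tendsto_const[of 1] t] by simp
      ultimately have "filterlim (\<lambda>x. (1 + to_disc (f x)) * inverse (1 - to_disc (f x))) at_infinity F"
        by (intro tendsto_mult_filterlim_at_infinity filterlim_compose[OF filterlim_inverse_at_infinity])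
          auto
      then have "filterlim (\<lambda>x. (1 + to_disc (f x)) / (1 - to_disc (f x))) at_infinity F"
        by (simp add: divide_inverse)
      then show "filterlim ?v at_infinity F"
        using filterlim_cong[OF refl refl v] by blast
    qed
    finally show ?thesis using 2 by simp
  next
    case 3
    have "approaches f p F \<longleftrightarrow> ((\<lambda>x. exp (pi * Re (f x))) \<longlongrightarrow> 0) F"
    proof -
      have "filterlim (\<lambda>x. Re (f x)) at_bot F \<longleftrightarrow> filterlim (\<lambda>x. pi * Re (f x)) at_bot F"
        by (subst filterlim_tendsto_pos_mult_at_bot_iff[OF tendsto_const]) auto
      also have "\<dots> \<longleftrightarrow> ((\<lambda>x. exp (pi * Re (f x))) \<longlongrightarrow> 0) F"
      proof
        assume "((\<lambda>x. exp (pi * Re (f x))) \<longlongrightarrow> 0) F"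
        then have "filterlim (\<lambda>x. exp (pi * Re (f x))) (at_right 0) F"
          by (auto simp: filterlim_at)
        from filterlim_compose[OF ln_at_0 this] show "filterlim (\<lambda>x. pi * Re (f x)) at_bot F" by simp
      qed (rule filterlim_compose[OF exp_at_bot])
      finally show ?thesis using 3 by simp
    qed
    also have "\<dots> \<longleftrightarrow> (?v \<longlongrightarrow> 0) F"
      unfolding norm_strip_exp[symmetric] by (rule tendsto_norm_zero_iff)
    also have "\<dots> \<longleftrightarrow> ((\<lambda>x. to_disc (f x)) \<longlongrightarrow> -1) F"
    proof
      assume t: "(?v \<longlongrightarrow> 0) F"
      have "((\<lambda>x. (?v x - 1) / (?v x + 1)) \<longlongrightarrow> (0 - 1) / (0 + 1)) F"
        by (intro tendsto_intros t) auto
      then show "((\<lambda>x. to_disc (f x)) \<longlongrightarrow> -1) F" by (simp add: to_disc_def)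
    next
      assume t: "((\<lambda>x. to_disc (f x)) \<longlongrightarrow> -1) F"
      have "((\<lambda>x. (1 + to_disc (f x)) / (1 - to_disc (f x))) \<longlongrightarrow> (1 + -1) / (1 - -1)) F"
        by (intro tendsto_intros t) auto
      then show "(?v \<longlongrightarrow> 0) F" using tendsto_cong[OF v] by simp
    qed
    finally show ?thesis using 3 by simp
  qed
qed

section \<open>Curves of the strip as paths in the disc\<close>

lemma eventually_ivl_ends:
  fixes P :: "real \<Rightarrow> bool"
  assumes "\<And>t. 0 < t \<Longrightarrow> t < 1 \<Longrightarrow> P t"
  shows "eventually P (at_right 0)" "eventually P (at_left 1)"
proof -
  show "eventually P (at_right 0)"
    unfolding eventually_at_right_field using assms by (intro exI[of _ 1]) auto
  show "eventually P (at_left 1)"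
    unfolding eventually_at_left_field using assms by (intro exI[of _ 0]) auto
qed

text \<open>\<open>simple_curve\<close> itself does not say where finite ends lie; they belong to
  the closed strip because it is closed and contains the curve.\<close>

lemma simple_curveD:
  assumes "simple_curve p q c"
  shows "0 < t \<Longrightarrow> t < 1 \<Longrightarrow> c t \<in> open_strip" "0 < t \<Longrightarrow> t < 1 \<Longrightarrow> c t \<in> closed_strip"
    "p \<in> strip_ends" "q \<in> strip_ends"
    "((\<lambda>t. to_disc (c t)) \<longlongrightarrow> disc_end p) (at_right 0)"
    "((\<lambda>t. to_disc (c t)) \<longlongrightarrow> disc_end q) (at_left 1)"
proof -
  have tr: "c t \<in> open_strip" if "0 < t" "t < 1" for t
    using assms that unfolding simple_curve_def curve_trace_def by auto
  then show "0 < t \<Longrightarrow> t < 1 \<Longrightarrow> c t \<in> open_strip" "0 < t \<Longrightarrow> t < 1 \<Longrightarrow> c t \<in> closed_strip"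
    using open_strip_subset by auto
  have ev: "\<forall>\<^sub>F t in at_right 0. c t \<in> closed_strip" "\<forall>\<^sub>F t in at_left 1. c t \<in> closed_strip"
    using eventually_ivl_ends[of "\<lambda>t. c t \<in> closed_strip"] tr open_strip_subset by auto
  have ap: "approaches c p (at_right 0)" "approaches c q (at_left 1)"
    using assms unfolding simple_curve_def by auto
  have S: "e \<in> strip_ends" if "approaches c e F" "\<forall>\<^sub>F t in F. c t \<in> closed_strip" "F \<noteq> bot" for e and F :: "real filter"
  proof (cases e)
    case (Point w)
    then have "w \<in> closed_strip"
      using Lim_in_closed_set[OF closed_closed_strip that(2,3)] that(1) by simp
    then show ?thesis by (simp add: strip_ends_def Point)
  qed (auto simp: strip_ends_def)
  show pq: "p \<in> strip_ends" "q \<in> strip_ends" using S ap ev by (auto simp: trivial_limit_at_right_real)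
  show "((\<lambda>t. to_disc (c t)) \<longlongrightarrow> disc_end p) (at_right 0)"
    "((\<lambda>t. to_disc (c t)) \<longlongrightarrow> disc_end q) (at_left 1)"
    using approaches_iff_tendsto_to_disc pq ev ap by blast+
qed

lemma simple_curve_unique_ends:
  assumes "simple_curve p q c" "simple_curve p' q' c"
  shows "p = p'" "q = q'"
proof -
  have "disc_end p = disc_end p'"
    using simple_curveD(5)[OF assms(1)] simple_curveD(5)[OF assms(2)]
    by (intro tendsto_unique[of "at_right (0::real)"]) auto
  moreover have "disc_end q = disc_end q'"
    using simple_curveD(6)[OF assms(1)] simple_curveD(6)[OF assms(2)]
    by (intro tendsto_unique[of "at_left (1::real)"]) auto
  ultimately show "p = p'" "q = q'"
    using simple_curveD(3,4)[OF assms(1)] simple_curveD(3,4)[OF assms(2)] inj_onD[OF inj_on_disc_end] by auto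
qed

lemma filterlim_flip:
  "filterlim (\<lambda>t::real. 1 - t) (at_left 1) (at_right 0)"
  "filterlim (\<lambda>t::real. 1 - t) (at_right 0) (at_left 1)"
  unfolding filterlim_at
  by (auto intro!: tendsto_eq_intros eventually_ivl_ends)

lemma approaches_compose:
  assumes "approaches c p F" "filterlim g F G"
  shows "approaches (\<lambda>x. c (g x)) p G"
  using assms by (cases p) (auto intro: filterlim_compose)

lemma curve_trace_flip: "curve_trace (\<lambda>t. c (1 - t)) = curve_trace c"
proof -
  have "(\<lambda>t. 1 - t) ` {0<..<1} = {0<..<1::real}" by (auto intro!: image_eqI[of _ _ "1 - _"])
  then show ?thesis unfolding curve_trace_def by (metis image_image)
qed

lemma simple_curve_flip:
  assumes "simple_curve p q c"
  shows "simple_curve q p (\<lambda>t. c (1 - t))"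
proof -
  have c: "continuous_on {0<..<1} c" "inj_on c {0<..<1}" "curve_trace c \<subseteq> open_strip"
    and ap: "approaches c p (at_right 0)" "approaches c q (at_left 1)"
    using assms unfolding simple_curve_def by auto
  have "continuous_on {0<..<1} (\<lambda>t. c (1 - t))"
    by (rule continuous_on_compose2[OF c(1)]) (auto intro!: continuous_intros)
  moreover have "inj_on (\<lambda>t. c (1 - t)) {0<..<1}"
  proof (rule inj_onI)
    fix s t :: real assume "s \<in> {0<..<1}" "t \<in> {0<..<1}" "c (1 - s) = c (1 - t)"
    then have "1 - s = 1 - t" by (intro inj_onD[OF c(2)]) auto
    then show "s = t" by simp
  qed
  moreover have "approaches (\<lambda>t. c (1 - t)) q (at_right 0)" "approaches (\<lambda>t. c (1 - t)) p (at_left 1)"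
    using approaches_compose[OF ap(2) filterlim_flip(1)] approaches_compose[OF ap(1) filterlim_flip(2)] .
  ultimately show ?thesis unfolding simple_curve_def curve_trace_flip using c(3) by blast
qed

text \<open>The values of \<open>c\<close> outside the open interval are arbitrary, so the two ends
  are put in by hand to get a path on the closed interval.\<close>

definition disc_path :: "strip_end \<Rightarrow> strip_end \<Rightarrow> (real \<Rightarrow> complex) \<Rightarrow> real \<Rightarrow> complex" where
  "disc_path p q c t = (if t \<le> 0 then disc_end p else if 1 \<le> t then disc_end q else to_disc (c t))"

lemma disc_path_ends [simp]:
  "pathstart (disc_path p q c) = disc_end p" "pathfinish (disc_path p q c) = disc_end q"
  by (auto simp: pathstart_def pathfinish_def disc_path_def)

lemma path_image_disc_path:
  "path_image (disc_path p q c) = {disc_end p, disc_end q} \<union> to_disc ` curve_trace c"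
proof -
  have "{0..1} = {0, 1} \<union> {0<..<1::real}" by auto
  then show ?thesis unfolding path_image_def curve_trace_def by (auto simp: disc_path_def image_iff)
qed

lemma path_disc_path:
  assumes "simple_curve p q c"
  shows "path (disc_path p q c)"
  unfolding path_def
proof (rule continuous_on_IccI)
  note D = simple_curveD[OF assms]
  have "\<forall>\<^sub>F t in at_right 0. to_disc (c t) = disc_path p q c t"
    "\<forall>\<^sub>F t in at_left 1. to_disc (c t) = disc_path p q c t"
    by (intro eventually_ivl_ends; simp add: disc_path_def)+
  then show "(disc_path p q c \<longlongrightarrow> disc_path p q c 0) (at_right 0)"
    "(disc_path p q c \<longlongrightarrow> disc_path p q c 1) (at_left 1)"
    using D(5,6) by (auto simp: disc_path_def[of _ _ _ 0] disc_path_def[of _ _ _ 1] elim: Lim_transform_eventually)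
  fix t :: real assume t: "0 < t" "t < 1"
  have "continuous_on {0<..<1} (\<lambda>t. to_disc (c t))"
    by (rule continuous_on_compose2[OF continuous_on_to_disc])
      (use assms D(2) in \<open>auto simp: simple_curve_def\<close>)
  then have "((\<lambda>t. to_disc (c t)) \<longlongrightarrow> to_disc (c t)) (at t)"
    using t by (simp add: continuous_on_eq_continuous_at isCont_def)
  moreover have "\<forall>\<^sub>F s in at t. s \<in> {0<..<1}"
    using t by (intro eventually_at_in_open') auto
  then have "\<forall>\<^sub>F s in at t. to_disc (c s) = disc_path p q c s"
    by eventually_elim (auto simp: disc_path_def)
  ultimately show "disc_path p q c \<midarrow>t\<rightarrow> disc_path p q c t"
    using t by (auto simp: disc_path_def[of _ _ _ t] elim: Lim_transform_eventually)
qed auto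

text \<open>The ends are two different points of the unit circle, while the rest of the path is in
  the open disc; so injectivity on the open interval extends to the closed one.\<close>

lemma arc_disc_path:
  assumes "simple_curve p q c" "p \<noteq> q" "norm (disc_end p) = 1" "norm (disc_end q) = 1"
  shows "arc (disc_path p q c)"
  unfolding arc_def
proof
  note D = simple_curveD[OF assms(1)]
  show "path (disc_path p q c)" using path_disc_path[OF assms(1)] .
  have ne: "disc_end p \<noteq> disc_end q" using D(3,4) assms(2) inj_onD[OF inj_on_disc_end] by blast
  have lt: "norm (to_disc (c t)) < 1" if "0 < t" "t < 1" for t
    using to_disc_norm(2)[OF D(2)] D(1) that by blast
  have inj: "s = t" if "to_disc (c s) = to_disc (c t)" "0 < t" "t < 1" "0 < s" "s < 1" for s t
    using inj_onD[OF inj_on_to_disc that(1)] D(2) that assms(1) unfolding simple_curve_def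
    by (auto dest: inj_onD)
  show "inj_on (disc_path p q c) {0..1}"
  proof (rule inj_onI)
    fix s t :: real assume "s \<in> {0..1}" "t \<in> {0..1}" "disc_path p q c s = disc_path p q c t"
    then show "s = t"
      using ne lt[of s] lt[of t] inj[of s t] assms(3,4)
      by (auto simp: disc_path_def split: if_splits)
  qed
qed

section \<open>Arcs as unordered pairs of ends\<close>

lemma homotopic_curves_same_ends:
  assumes "simple_curve p q c" "simple_curve p q d"
  shows "homotopic_curves p q c d"
proof -
  define H where "H = (\<lambda>x. of_real (1 - fst x) * c (snd x) + of_real (fst x) * d (snd x))"
  note C = simple_curveD[OF assms(1)] and D = simple_curveD[OF assms(2)]
  have cc: "continuous_on {0<..<1} c" and cd: "continuous_on {0<..<1} d"
    and ap: "approaches c p (at_right 0)" "approaches d p (at_right 0)"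
      "approaches c q (at_left 1)" "approaches d q (at_left 1)"
    using assms unfolding simple_curve_def by auto
  have conv: "convex open_strip"
    unfolding open_strip_def Collect_conj_eq
    by (intro convex_Int) (auto simp: convex_halfspace_Im_gt convex_halfspace_Im_lt)
  have Hconv: "H (s, t) \<in> S" if "convex S" "c t \<in> S" "d t \<in> S" "s \<in> {0..1}" for s t S
    using convexD_alt[OF that(1-3), of s] that(4) by (simp add: H_def scaleR_conv_of_real)
  have "continuous_on ({0..1} \<times> {0<..<1}) H"
    unfolding H_def
    by (intro continuous_intros continuous_on_compose2[OF cc] continuous_on_compose2[OF cd]) auto
  moreover have "H ` ({0..1} \<times> {0<..<1}) \<subseteq> open_strip"
    using Hconv[OF conv] C(1) D(1) by auto
  moreover have "\<forall>t\<in>{0<..<1}. H (0, t) = c t \<and> H (1, t) = d t" by (simp add: H_def)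
  moreover have "approaches H e (principal {0..1} \<times>\<^sub>F F)" if c: "approaches c e F" and d: "approaches d e F" for e F
  proof -
    \<comment> \<open>Every end has a basis of convex neighbourhoods, namely balls or the
      half-planes to the right or left of a vertical line. The straight-line homotopy lies in such a
      set as soon as both curves do, for all values of the deformation parameter at once.\<close>
    have ev: "eventually (\<lambda>x. H x \<in> S) (principal {0..1} \<times>\<^sub>F F)"
      if "convex S" "eventually (\<lambda>t. c t \<in> S) F" "eventually (\<lambda>t. d t \<in> S) F" for S
      unfolding eventually_prod_filter
      by (intro exI[of _ "\<lambda>s. s \<in> {0..1}"] exI[of _ "\<lambda>t. c t \<in> S \<and> d t \<in> S"])
        (use that Hconv[OF that(1)] in \<open>auto simp: eventually_principal eventually_conj_iff\<close>)
    show ?thesis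
    proof (cases e)
      case (Point w)
      have "(H \<longlongrightarrow> w) (principal {0..1} \<times>\<^sub>F F)"
      proof (rule tendstoI)
        fix \<epsilon> :: real assume "0 < \<epsilon>"
        then have "eventually (\<lambda>t. c t \<in> ball w \<epsilon>) F" "eventually (\<lambda>t. d t \<in> ball w \<epsilon>) F"
          using tendstoD[of c w F \<epsilon>] tendstoD[of d w F \<epsilon>] c d Point by (auto simp: dist_commute)
        from ev[OF convex_ball this] show "\<forall>\<^sub>F x in principal {0..1} \<times>\<^sub>F F. dist (H x) w < \<epsilon>"
          by (simp add: dist_commute)
      qed
      then show ?thesis using Point by simp
    next
      case PosLimit
      have "filterlim (\<lambda>x. Re (H x)) at_top (principal {0..1} \<times>\<^sub>F F)"
        unfolding filterlim_at_top_dense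
        using ev[OF convex_halfspace_Re_gt] c d PosLimit by (auto simp: filterlim_at_top_dense)
      then show ?thesis using PosLimit by simp
    next
      case NegLimit
      have "filterlim (\<lambda>x. Re (H x)) at_bot (principal {0..1} \<times>\<^sub>F F)"
        unfolding filterlim_at_bot_dense
        using ev[OF convex_halfspace_Re_lt] c d NegLimit by (auto simp: filterlim_at_bot_dense)
      then show ?thesis using NegLimit by simp
    qed
  qed
  ultimately show ?thesis unfolding homotopic_curves_def using ap by blast
qed

definition ends_class :: "strip_end \<Rightarrow> strip_end \<Rightarrow> strip_arc" where
  "ends_class p q = {d. simple_curve p q d \<or> simple_curve q p d}"

lemma arc_class_eq: "simple_curve p q c \<Longrightarrow> arc_class p q c = ends_class p q"
  unfolding arc_class_def ends_class_def
  using homotopic_curves_same_ends simple_curve_flip by blast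

lemma ends_class_commute: "ends_class p q = ends_class q p"
  by (auto simp: ends_class_def)

text \<open>A curve determines its ends, hence a single common member identifies the pairs of ends
  of two classes.\<close>

lemma ends_class_eq_iff:
  assumes "c \<in> ends_class p q"
  shows "c \<in> ends_class r s \<longleftrightarrow> {p, q} = {r, s}"
  using assms simple_curve_unique_ends unfolding ends_class_def
  by (auto simp: doubleton_eq_iff)

definition strip_points :: "real set \<Rightarrow> strip_end set" where
  "strip_points A = insert PosLimit (insert NegLimit (Point ` vertices A))"

definition adjacent :: "real set \<Rightarrow> strip_end \<Rightarrow> strip_end \<Rightarrow> bool" where
  "adjacent A p q \<longleftrightarrow> (\<exists>v w. neighbouring A v w \<and> p = Point v \<and> q = Point w)"

lemma adjacent_sym: "adjacent A p q \<Longrightarrow> adjacent A q p"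
  unfolding adjacent_def neighbouring_def by (metis open_segment_commute)

lemma adjacentD: "adjacent A p q \<Longrightarrow> p \<in> strip_points A \<and> q \<in> strip_points A \<and> p \<noteq> q"
  by (auto simp: adjacent_def neighbouring_def strip_points_def)

lemma vertices_Im: "v \<in> vertices A \<Longrightarrow> Im v = 0 \<or> Im v = 1"
  "v \<in> lower_vertices \<Longrightarrow> Im v = 0" "v \<in> upper_vertices A \<Longrightarrow> Im v = 1"
  by (auto simp: vertices_def lower_vertices_def lower_vertex_def upper_vertices_def)

text \<open>The distinction of the four types of arcs ends here: it only serves to exclude boundary
  segments, and what follows treats all pairs of ends alike.\<close>

lemma arc_ends_iff:
  "(bridging_ends A p q \<or> peripheral_ends A p q \<or> asymptotic_ends A p q \<or> generic_ends p q)
    \<longleftrightarrow> p \<in> strip_points A \<and> q \<in> strip_points A \<and> p \<noteq> q \<and> \<not> adjacent A p q" (is "?l = ?r")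
proof
  assume ?l
  then show ?r
  proof (elim disjE)
    assume "bridging_ends A p q"
    then obtain v w where vw: "v \<in> lower_vertices" "w \<in> upper_vertices A" "{p, q} = {Point v, Point w}"
      unfolding bridging_ends_def by blast
    have "Im v = 0" "Im w = 1" using vw vertices_Im by auto
    then show ?r using vw by (auto simp: doubleton_eq_iff strip_points_def vertices_def adjacent_def neighbouring_def)
  next
    assume "peripheral_ends A p q"
    then show ?r by (auto simp: peripheral_ends_def strip_points_def adjacent_def)
  next
    assume "asymptotic_ends A p q"
    then show ?r by (auto simp: asymptotic_ends_def doubleton_eq_iff strip_points_def adjacent_def)
  next
    assume "generic_ends p q"
    then show ?r by (auto simp: generic_ends_def doubleton_eq_iff strip_points_def adjacent_def)
  qed
next
  assume r: ?r
  show ?l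
  proof (cases p)
    case (Point v)
    then have v: "v \<in> vertices A" using r by (auto simp: strip_points_def)
    show ?thesis
    proof (cases q)
      case (Point w)
      then have w: "w \<in> vertices A" using r by (auto simp: strip_points_def)
      show ?thesis
      proof (cases "Im v = Im w")
        case True
        then have "peripheral_ends A p q"
          unfolding peripheral_ends_def using v w r \<open>p = Point v\<close> \<open>q = Point w\<close>
          by (intro bexI[of _ v] bexI[of _ w]) (auto simp: adjacent_def)
        then show ?thesis by blast
      next
        case False
        then have "v \<in> lower_vertices \<and> w \<in> upper_vertices A \<or> w \<in> lower_vertices \<and> v \<in> upper_vertices A"
          using v w vertices_Im unfolding vertices_def by (metis Un_iff)
        then have "bridging_ends A p q"
          unfolding bridging_ends_def \<open>p = Point v\<close> \<open>q = Point w\<close> by (metis insert_commute)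
        then show ?thesis by blast
      qed
    next
      case PosLimit
      then have "asymptotic_ends A p q" using v Point by (auto simp: asymptotic_ends_def)
      then show ?thesis by blast
    next
      case NegLimit
      then have "asymptotic_ends A p q" using v Point by (auto simp: asymptotic_ends_def)
      then show ?thesis by blast
    qed
  next
    case PosLimit
    show ?thesis
    proof (cases q)
      case (Point w)
      then have "asymptotic_ends A p q" using r PosLimit by (auto simp: asymptotic_ends_def strip_points_def)
      then show ?thesis by blast
    qed (use r PosLimit in \<open>auto simp: generic_ends_def\<close>)
  next
    case NegLimit
    show ?thesis
    proof (cases q)
      case (Point w)
      then have "asymptotic_ends A p q" using r NegLimit by (auto simp: asymptotic_ends_def strip_points_def)
      then show ?thesis by blast
    qed (use r NegLimit in \<open>auto simp: generic_ends_def\<close>)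
  qed
qed

lemma vertices_closed_strip: "vertices A \<subseteq> closed_strip"
  using vertices_Im(1) by (force simp: closed_strip_def)

lemma strip_points_subset: "strip_points A \<subseteq> strip_ends"
  using vertices_closed_strip by (auto simp: strip_points_def strip_ends_def)

lemma norm_disc_end_strip_points:
  assumes "p \<in> strip_points A" shows "norm (disc_end p) = 1"
proof -
  have "norm (to_disc v) = 1" if "v \<in> vertices A" for v
  proof -
    have "v \<in> closed_strip" "v \<notin> open_strip"
      using that vertices_closed_strip vertices_Im(1)[OF that] by (auto simp: open_strip_def)
    then show ?thesis using to_disc_norm(1,2)[of v] by force
  qed
  then show ?thesis using assms by (auto simp: strip_points_def)
qed

section \<open>Crossing arcs and geodesics\<close>

text \<open>The boundary point \<open>N + 1/2\<close> of the strip is never the end of an arc; a Moebius map sends it to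
  infinity and the disc to the upper half-plane, so that \<open>position N\<close> is the real coordinate of an
  end there. The parameter \<open>\<kappa>\<close> is \<open>kappa N\<close>, the image of that point under \<open>exp (pi * z)\<close>.\<close>

definition kappa :: "int \<Rightarrow> real" where
  "kappa N = exp (pi * (of_int N + 1 / 2))"

fun position :: "int \<Rightarrow> strip_end \<Rightarrow> real" where
  "position N (Point z) = 1 / (kappa N - (if Im z = 0 then exp (pi * Re z) else - exp (pi * Re z)))"
| "position N PosLimit = 0"
| "position N NegLimit = 1 / kappa N"

text \<open>With \<open>w = \<i> * (1 + c) / (1 - c)\<close>, which is \<open>exp (pi * z)\<close>
  if \<open>c = to_disc z\<close>, this is \<open>1 / (\<kappa> - w)\<close>. The form without the
  inner quotient makes sense also for \<open>c = 1\<close>, the image of the limit point on the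
  right. The only pole is \<open>(\<kappa> - \<i>) / (\<kappa> + \<i>)\<close>, on the unit
  circle.\<close>

definition half_plane :: "real \<Rightarrow> complex \<Rightarrow> complex" where
  "half_plane \<kappa> c = (c - 1) / (\<i> * (1 + c) - of_real \<kappa> * (1 - c))"

definition from_half_plane :: "real \<Rightarrow> complex \<Rightarrow> complex" where
  "from_half_plane \<kappa> u = ((of_real \<kappa> - \<i>) * u - 1) / ((of_real \<kappa> + \<i>) * u - 1)"

lemma half_plane_denom_disc:
  assumes "norm c < 1" shows "\<i> * (1 + c) - of_real \<kappa> * (1 - c) \<noteq> 0"
proof
  assume "\<i> * (1 + c) - of_real \<kappa> * (1 - c) = 0"
  then have "(of_real \<kappa> + \<i>) * c = of_real \<kappa> - \<i>" by (simp add: algebra_simps)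
  then have "norm (of_real \<kappa> + \<i>) * norm c = norm (of_real \<kappa> - \<i>)" by (metis norm_mult)
  moreover have "norm (of_real \<kappa> + \<i>) = norm (of_real \<kappa> - \<i>)" by (simp add: cmod_def)
  moreover have "norm (of_real \<kappa> + \<i>) \<noteq> 0" by (auto simp: complex_eq_iff)
  ultimately show False using assms by simp
qed

lemma from_half_plane_denom:
  assumes "0 \<le> Im u" shows "(of_real \<kappa> + \<i>) * u - 1 \<noteq> 0"
proof
  assume "(of_real \<kappa> + \<i>) * u - 1 = 0"
  then have "\<kappa> * Re u - Im u = 1" "\<kappa> * Im u + Re u = 0" by (auto simp: complex_eq_iff)
  then have "- (\<kappa> * \<kappa> * Im u) - Im u = 1" by (simp add: add_eq_0_iff2 algebra_simps)
  then show False using assms mult_nonneg_nonneg[OF zero_le_square[of \<kappa>] assms] by linarith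
qed

lemma Im_half_plane:
  "Im (half_plane \<kappa> c) = (1 - (norm c)\<^sup>2) / (norm (\<i> * (1 + c) - of_real \<kappa> * (1 - c)))\<^sup>2"
  unfolding half_plane_def Im_divide cmod_power2
  by (simp add: power2_eq_square algebra_simps)

lemma from_half_plane_inverse:
  assumes "\<i> * (1 + c) - of_real \<kappa> * (1 - c) \<noteq> 0"
  shows "from_half_plane \<kappa> (half_plane \<kappa> c) = c"
proof -
  define d where "d = \<i> * (1 + c) - of_real \<kappa> * (1 - c)"
  have d: "d \<noteq> 0" using assms by (simp add: d_def)
  have "(of_real \<kappa> - \<i>) * ((c - 1) / d) - 1 = ((of_real \<kappa> - \<i>) * (c - 1) - d) / d"
    "(of_real \<kappa> + \<i>) * ((c - 1) / d) - 1 = ((of_real \<kappa> + \<i>) * (c - 1) - d) / d"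
    using d by (auto simp: field_simps)
  moreover have "(of_real \<kappa> - \<i>) * (c - 1) - d = - (2 * \<i>) * c" "(of_real \<kappa> + \<i>) * (c - 1) - d = - (2 * \<i>)"
    by (auto simp: d_def algebra_simps)
  ultimately show ?thesis using d by (simp add: from_half_plane_def half_plane_def d_def[symmetric])
qed

lemma half_plane_inverse:
  assumes "0 \<le> Im u" "u \<noteq> 0"
  shows "half_plane \<kappa> (from_half_plane \<kappa> u) = u"
proof -
  define d where "d = (of_real \<kappa> + \<i>) * u - 1"
  have d: "d \<noteq> 0" using from_half_plane_denom[OF assms(1)] by (simp add: d_def)
  define c where "c = from_half_plane \<kappa> u"
  have c: "c = ((of_real \<kappa> - \<i>) * u - 1) / d" by (simp add: c_def from_half_plane_def d_def)
  have n: "c - 1 = - (2 * \<i> * u) / d" and e: "\<i> * (1 + c) - of_real \<kappa> * (1 - c) = - (2 * \<i>) / d"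
    using d by (auto simp: c field_simps) (auto simp: d_def field_simps)
  have "half_plane \<kappa> c = u" unfolding half_plane_def n e using d by simp
  then show ?thesis by (simp add: c_def)
qed

lemma norm_from_half_plane:
  assumes "0 < Im u" shows "norm (from_half_plane \<kappa> u) < 1"
proof -
  have "(norm ((of_real \<kappa> + \<i>) * u - 1))\<^sup>2 = (norm ((of_real \<kappa> - \<i>) * u - 1))\<^sup>2 + 4 * Im u"
    unfolding cmod_power2 by (simp add: power2_eq_square algebra_simps)
  then have "(norm ((of_real \<kappa> - \<i>) * u - 1))\<^sup>2 < (norm ((of_real \<kappa> + \<i>) * u - 1))\<^sup>2"
    using assms by simp
  then have "norm ((of_real \<kappa> - \<i>) * u - 1) < norm ((of_real \<kappa> + \<i>) * u - 1)"
    by (rule power2_less_imp_less) simp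
  then show ?thesis using from_half_plane_denom[of u \<kappa>] assms
    by (simp add: from_half_plane_def norm_divide divide_less_eq)
qed

lemma kappa_pos [simp]: "0 < kappa N"
  by (simp add: kappa_def)

lemma kappa_neq: "exp (pi * of_int k) \<noteq> kappa N"
proof
  assume "exp (pi * of_int k) = kappa N"
  then have "real_of_int k = of_int N + 1 / 2" by (simp add: kappa_def)
  then have "2 * real_of_int k = of_int (2 * N + 1)" by simp
  then have "2 * k = 2 * N + 1" by linarith
  then show False by presburger
qed

lemma half_plane_disc_end:
  assumes "p \<in> strip_points A"
  shows "half_plane (kappa N) (disc_end p) = of_real (position N p)"
    "\<i> * (1 + disc_end p) - of_real (kappa N) * (1 - disc_end p) \<noteq> 0"
proof -
  have "half_plane (kappa N) (disc_end p) = of_real (position N p) \<and>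
    \<i> * (1 + disc_end p) - of_real (kappa N) * (1 - disc_end p) \<noteq> 0"
  proof (cases p)
    case (Point z)
    then have z: "z \<in> vertices A" using assms by (auto simp: strip_points_def)
    then have zc: "z \<in> closed_strip" using vertices_closed_strip by blast
    define w where "w = (if Im z = 0 then exp (pi * Re z) else - exp (pi * Re z))"
    define v where "v = exp (of_real pi * (z - \<i> / 2))"
    \<comment> \<open>On the lower boundary the value \<open>kappa N\<close> belongs to a
      half-integer and is missed by the vertices; on the upper boundary \<open>w\<close> is
      negative.\<close>
    have wc: "w \<noteq> kappa N"
    proof (cases "Im z = 0")
      case True
      then obtain k where "Re z = of_int k"
        using z by (auto simp: vertices_def lower_vertices_def lower_vertex_def upper_vertices_def)
      then show ?thesis using kappa_neq True by (simp add: w_def)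
    next
      case False
      moreover have "- exp (pi * Re z) < kappa N" by (metis kappa_pos exp_gt_zero neg_less_0_iff_less less_trans)
      ultimately show ?thesis by (simp add: w_def)
    qed
    have v: "v = - \<i> * of_real w"
    proof (cases "Im z = 0")
      case True
      then show ?thesis by (simp add: v_def w_def complex_eq_iff Re_exp Im_exp algebra_simps)
    next
      case False
      then have "Im z = 1" using vertices_Im(1)[OF z] by simp
      then show ?thesis using False by (simp add: v_def w_def complex_eq_iff Re_exp Im_exp algebra_simps)
    qed
    have v1: "v + 1 \<noteq> 0" using to_disc_norm(3)[OF zc] by (simp add: v_def)
    have c: "disc_end p = (v - 1) / (v + 1)" by (simp add: Point to_disc_def v_def)
    have n: "disc_end p - 1 = - 2 / (v + 1)" and e: "1 - disc_end p = 2 / (v + 1)" "1 + disc_end p = 2 * v / (v + 1)"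
      using v1 by (auto simp: c field_simps)
    have "\<i> * (1 + disc_end p) - of_real (kappa N) * (1 - disc_end p) = (2 * (\<i> * v) - 2 * of_real (kappa N)) / (v + 1)"
      unfolding e by (simp add: diff_divide_distrib mult_ac)
    also have "\<i> * v = of_real w" by (simp add: v)
    finally have d: "\<i> * (1 + disc_end p) - of_real (kappa N) * (1 - disc_end p) = 2 * (of_real w - of_real (kappa N)) / (v + 1)"
      by (simp add: algebra_simps)
    have wc': "of_real w - of_real (kappa N) \<noteq> (0::complex)" using wc by simp
    have "half_plane (kappa N) (disc_end p) = - 1 / (of_real w - of_real (kappa N))"
    proof -
      have "- 2 / x / (2 * y / x) = - 1 / y" if "x \<noteq> 0" "y \<noteq> 0" for x y :: complex
        using that by (simp add: field_simps)
      from this[OF v1 wc'] show ?thesis unfolding half_plane_def d n .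
    qed
    also have "\<dots> = of_real (position N p)" using wc' by (simp add: Point w_def[symmetric] field_simps)
    finally show ?thesis unfolding d using v1 wc' by simp
  next
    case NegLimit
    have "kappa N \<noteq> 0" using kappa_pos[of N] by linarith
    then show ?thesis by (simp add: NegLimit half_plane_def)
  qed (simp add: half_plane_def)
  then show "half_plane (kappa N) (disc_end p) = of_real (position N p)"
    "\<i> * (1 + disc_end p) - of_real (kappa N) * (1 - disc_end p) \<noteq> 0" by blast+
qed

lemma from_half_plane_position:
  "p \<in> strip_points A \<Longrightarrow> from_half_plane (kappa N) (of_real (position N p)) = disc_end p"
  using half_plane_disc_end from_half_plane_inverse by metis

lemma inj_on_position: "inj_on (position N) (strip_points A)"
proof (rule inj_onI)
  fix p q assume pq: "p \<in> strip_points A" "q \<in> strip_points A" "position N p = position N q"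
  then have "disc_end p = disc_end q" using from_half_plane_position by metis
  then show "p = q" using inj_onD[OF inj_on_disc_end] pq strip_points_subset by blast
qed

section \<open>Interlaced ends force a crossing\<close>

lemma complex_fashoda_interlace:
  fixes f g :: "real \<Rightarrow> complex"
  assumes "path f" "path g" "path_image f \<subseteq> {z. 0 \<le> Im z}" "path_image g \<subseteq> {z. 0 \<le> Im z}"
    and "pathstart f = of_real a" "pathfinish f = of_real b" "pathstart g = of_real c" "pathfinish g = of_real d"
    and "a < c" "c < b" "b < d"
  shows "path_image f \<inter> path_image g \<noteq> {}"
proof -
  define T :: "complex \<Rightarrow> real^2" where "T = (\<lambda>z. \<chi> i. if i = 1 then Re z else Im z)"
  have T: "T z $ 1 = Re z" "T z $ 2 = Im z" for z by (auto simp: T_def)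
  have cT: "continuous_on UNIV T"
    unfolding T_def
  proof (rule continuous_on_vec_lambda)
    show "continuous_on UNIV (\<lambda>z. if i = 1 then Re z else Im z)" for i :: 2
      by (cases "i = 1") (auto intro: continuous_intros)
  qed
  obtain B where B: "\<And>z. z \<in> path_image f \<union> path_image g \<Longrightarrow> norm z \<le> B"
    using bounded_Un[of "path_image f" "path_image g"] bounded_path_image assms(1,2)
    by (metis bounded_iff)
  \<comment> \<open>The bottom edge of this box is on the real axis and contains the four ends, in
    the interlaced order that Fashoda's theorem asks for.\<close>
  define lo hi :: "real^2" where "lo = vector [- B, 0]" and "hi = vector [B, B]"
  have box: "T z \<in> cbox lo hi" if "z \<in> path_image f \<union> path_image g" for z
    using B[OF that] abs_Re_le_cmod[of z] abs_Im_le_cmod[of z] that assms(3,4)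
    by (auto simp: mem_box_cart forall_2 T lo_def hi_def)
  obtain w where "w \<in> path_image (T \<circ> f)" "w \<in> path_image (T \<circ> g)"
  proof (rule fashoda_interlace[of "T \<circ> f" "T \<circ> g" lo hi])
    show "path (T \<circ> f)" "path (T \<circ> g)"
      by (auto intro!: path_continuous_image assms continuous_on_subset[OF cT])
    show "path_image (T \<circ> f) \<subseteq> cbox lo hi" "path_image (T \<circ> g) \<subseteq> cbox lo hi"
      using box by (auto simp: path_image_compose)
  qed (use assms in \<open>auto simp: pathstart_compose pathfinish_compose T lo_def\<close>)
  moreover have "inj T" by (metis T injI complex_eqI)
  ultimately show ?thesis by (auto simp: path_image_compose dest: injD)
qed

lemma interlaced_curves_meet:
  assumes c: "simple_curve p q c" and d: "simple_curve r s d"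
    and E: "p \<in> strip_points A" "q \<in> strip_points A" "r \<in> strip_points A" "s \<in> strip_points A"
    and lt: "position N p < position N r" "position N r < position N q" "position N q < position N s"
  shows "curve_trace c \<inter> curve_trace d \<noteq> {}"
proof -
  let ?M = "half_plane (kappa N)"
  have cont: "continuous_on {w. \<i> * (1 + w) - of_real (kappa N) * (1 - w) \<noteq> 0} ?M"
    unfolding half_plane_def by (intro continuous_intros) auto
  have pI: "path (?M \<circ> disc_path a b e)" "path_image (?M \<circ> disc_path a b e) = {of_real (position N a), of_real (position N b)} \<union> ?M ` to_disc ` curve_trace e"
    "\<And>w. w \<in> ?M ` to_disc ` curve_trace e \<Longrightarrow> 0 < Im w" if e: "simple_curve a b e" "a \<in> strip_points A" "b \<in> strip_points A" for a b e
  proof -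
    have tr: "norm w < 1" if w: "w \<in> to_disc ` curve_trace e" for w
    proof -
      have "curve_trace e \<subseteq> open_strip" using e(1) by (simp add: simple_curve_def)
      then have "to_disc ` curve_trace e \<subseteq> ball 0 1" using to_disc_image_open by blast
      then show ?thesis using w by auto
    qed
    have "path_image (disc_path a b e) \<subseteq> {w. \<i> * (1 + w) - of_real (kappa N) * (1 - w) \<noteq> 0}"
      unfolding path_image_disc_path using half_plane_disc_end(2) e half_plane_denom_disc[OF tr] by auto
    then show "path (?M \<circ> disc_path a b e)"
      using path_continuous_image[OF path_disc_path[OF e(1)]] continuous_on_subset[OF cont] by blast
    show "path_image (?M \<circ> disc_path a b e) = {of_real (position N a), of_real (position N b)} \<union> ?M ` to_disc ` curve_trace e"
      unfolding path_image_compose path_image_disc_path using half_plane_disc_end(1) e by auto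
    show "0 < Im w" if "w \<in> ?M ` to_disc ` curve_trace e" for w
      using that tr half_plane_denom_disc
      by (auto simp: Im_half_plane abs_square_less_1 intro!: divide_pos_pos)
  qed
  have "path_image (?M \<circ> disc_path p q c) \<inter> path_image (?M \<circ> disc_path r s d) \<noteq> {}"
  proof (rule complex_fashoda_interlace[where a = "position N p" and b = "position N q"
        and c = "position N r" and d = "position N s"])
    show "path_image (?M \<circ> disc_path p q c) \<subseteq> {z. 0 \<le> Im z}" "path_image (?M \<circ> disc_path r s d) \<subseteq> {z. 0 \<le> Im z}"
      unfolding pI(2)[OF c E(1,2)] pI(2)[OF d E(3,4)] using pI(3)[OF c E(1,2)] pI(3)[OF d E(3,4)] by force+
  qed (use pI(1) c d E lt half_plane_disc_end(1) in \<open>auto simp: pathstart_compose pathfinish_compose\<close>)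
  then obtain w where w: "w \<in> path_image (?M \<circ> disc_path p q c)" "w \<in> path_image (?M \<circ> disc_path r s d)" by blast
  \<comment> \<open>On the real axis the two paths have only their ends, and these are four
    different points. So the common point comes from the interiors of both curves.\<close>
  have "Im w = 0 \<Longrightarrow> w \<in> {of_real (position N p), of_real (position N q)} \<and> w \<in> {of_real (position N r), of_real (position N s)}"
    using w pI(3)[OF c E(1,2), of w] pI(3)[OF d E(3,4), of w] unfolding pI(2)[OF c E(1,2)] pI(2)[OF d E(3,4)] by auto
  then have "Im w \<noteq> 0" using lt by auto
  then have "w \<noteq> of_real x" for x by auto
  then have "w \<in> ?M ` to_disc ` curve_trace c" "w \<in> ?M ` to_disc ` curve_trace d"
    using w unfolding pI(2)[OF c E(1,2)] pI(2)[OF d E(3,4)] by blast+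
  then obtain y z where yz: "y \<in> curve_trace c" "z \<in> curve_trace d" "w = ?M (to_disc y)" "w = ?M (to_disc z)" by auto
  have S: "y \<in> open_strip" "z \<in> open_strip" using yz c d by (auto simp: simple_curve_def)
  then have "norm (to_disc y) < 1" "norm (to_disc z) < 1" using to_disc_image_open by auto
  then have "to_disc y = to_disc z" using yz from_half_plane_inverse half_plane_denom_disc by metis
  then have "y = z" using inj_onD[OF inj_on_to_disc] S open_strip_subset by blast
  then show ?thesis using yz by blast
qed

text \<open>The hyperbolic geodesic of the upper half-plane from \<open>a\<close> to
  \<open>b\<close>. The signs place it above the axis and make it start at \<open>a\<close>.\<close>

definition half_circle :: "real \<Rightarrow> real \<Rightarrow> real \<Rightarrow> complex" where
  "half_circle a b t = of_real ((a + b) / 2) - of_real ((b - a) / 2) * cis (- (pi * t))"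

lemma half_circle:
  assumes "a < b"
  shows "half_circle a b 0 = of_real a" "half_circle a b 1 = of_real b"
    "0 < t \<Longrightarrow> t < 1 \<Longrightarrow> 0 < Im (half_circle a b t)"
    "(Re (half_circle a b t) - a) * (b - Re (half_circle a b t)) = (Im (half_circle a b t))\<^sup>2"
    "inj_on (half_circle a b) {0..1}" "continuous_on UNIV (half_circle a b)"
proof -
  show "half_circle a b 0 = of_real a" "half_circle a b 1 = of_real b"
    by (auto simp: half_circle_def complex_eq_iff field_simps)
  have R: "Re (half_circle a b t) = (a + b) / 2 - (b - a) / 2 * cos (pi * t)"
    and I: "Im (half_circle a b t) = (b - a) / 2 * sin (pi * t)" for t
    by (auto simp: half_circle_def)
  show "0 < t \<Longrightarrow> t < 1 \<Longrightarrow> 0 < Im (half_circle a b t)"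
    unfolding I using assms by (intro mult_pos_pos sin_gt_zero) auto
  have "(Im (half_circle a b t))\<^sup>2 = ((b - a) / 2)\<^sup>2 * (1 - (cos (pi * t))\<^sup>2)"
    unfolding I power_mult_distrib sin_squared_eq ..
  then show "(Re (half_circle a b t) - a) * (b - Re (half_circle a b t)) = (Im (half_circle a b t))\<^sup>2"
    unfolding R by (simp add: power2_eq_square field_simps)
  show "inj_on (half_circle a b) {0..1}"
  proof (rule inj_onI)
    fix s t :: real assume st: "s \<in> {0..1}" "t \<in> {0..1}" and eq: "half_circle a b s = half_circle a b t"
    have "(b - a) / 2 * cos (pi * s) = (b - a) / 2 * cos (pi * t)"
      using R[of s] R[of t] unfolding eq by linarith
    moreover have "(b - a) / 2 \<noteq> 0" using assms by simp
    ultimately have "cos (pi * s) = cos (pi * t)" by (metis mult_left_cancel)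
    moreover have "0 \<le> pi * s" "pi * s \<le> pi" "0 \<le> pi * t" "pi * t \<le> pi"
      using st mult_left_mono[of s 1 pi] mult_left_mono[of t 1 pi] by auto
    ultimately have "pi * s = pi * t" using cos_inj_pi by blast
    then show "s = t" by simp
  qed
  show "continuous_on UNIV (half_circle a b)"
    unfolding half_circle_def cis_conv_exp by (intro continuous_intros)
qed

definition geodesic :: "int \<Rightarrow> strip_end \<Rightarrow> strip_end \<Rightarrow> real \<Rightarrow> complex" where
  "geodesic N p q t = from_disc (from_half_plane (kappa N) (half_circle (position N p) (position N q) t))"

lemma simple_curve_geodesic:
  assumes E: "p \<in> strip_points A" "q \<in> strip_points A" and lt: "position N p < position N q"
  shows "simple_curve p q (geodesic N p q)"
proof -
  define h where "h = half_circle (position N p) (position N q)"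
  define g where "g = (\<lambda>t. from_half_plane (kappa N) (h t))"
  note H = half_circle[OF lt, folded h_def]
  have im: "0 \<le> Im (h t)" if "t \<in> {0..1}" for t
    using H(1,2) H(3)[of t] that by (cases "t = 0"; cases "t = 1") auto
  have gn: "norm (g t) < 1" if "0 < t" "t < 1" for t
    unfolding g_def by (rule norm_from_half_plane[OF H(3)[OF that]])
  have cg: "continuous_on {0..1} g"
    unfolding g_def from_half_plane_def
    by (intro continuous_intros continuous_on_subset[OF H(6)]) (use from_half_plane_denom im in auto)
  have g01: "g 0 = disc_end p" "g 1 = disc_end q"
    unfolding g_def H(1,2) using from_half_plane_position E by auto
  have gne: "g t \<noteq> 1" "g t \<noteq> -1" if "0 < t" "t < 1" for t using gn[OF that] by auto
  have geo: "geodesic N p q t = from_disc (g t)" for t by (simp add: geodesic_def g_def h_def)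
  have S: "geodesic N p q t \<in> open_strip" "to_disc (geodesic N p q t) = g t" if "0 < t" "t < 1" for t
    unfolding geo using to_from_disc[of "g t"] gn gne that by force+
  have "continuous_on {0<..<1} (geodesic N p q)"
    unfolding geo by (rule continuous_on_compose2[OF continuous_on_from_disc continuous_on_subset[OF cg]])
      (use gn gne in force)+
  moreover have "inj_on (geodesic N p q) {0<..<1}"
  proof (rule inj_onI)
    fix s t assume st: "s \<in> {0<..<1}" "t \<in> {0<..<1}" "geodesic N p q s = geodesic N p q t"
    then have "g s = g t" using S(2)[of s] S(2)[of t] by auto
    moreover have "half_plane (kappa N) (g r) = h r" if "r \<in> {0<..<1}" for r
      unfolding g_def using H(3)[of r] that by (intro half_plane_inverse) auto
    ultimately have "h s = h t" using st by metis
    then show "s = t" using inj_onD[OF H(5), of s t] st by auto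
  qed
  moreover have "curve_trace (geodesic N p q) \<subseteq> open_strip"
    using S by (auto simp: curve_trace_def)
  moreover have "approaches (geodesic N p q) p (at_right 0)"
  proof (subst approaches_iff_tendsto_to_disc)
    show "\<forall>\<^sub>F x in at_right 0. geodesic N p q x \<in> closed_strip"
      using S open_strip_subset by (intro eventually_ivl_ends) auto
    have "(g \<longlongrightarrow> g 0) (at_right 0)"
      using continuous_on_Icc_at_rightD[OF cg] by simp
    moreover have "\<forall>\<^sub>F x in at_right 0. g x = to_disc (geodesic N p q x)"
      using S by (intro eventually_ivl_ends) auto
    ultimately show "((\<lambda>x. to_disc (geodesic N p q x)) \<longlongrightarrow> disc_end p) (at_right 0)"
      unfolding g01 by (rule Lim_transform_eventually)
  qed (use E strip_points_subset in blast)
  moreover have "approaches (geodesic N p q) q (at_left 1)"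
  proof (subst approaches_iff_tendsto_to_disc)
    show "\<forall>\<^sub>F x in at_left 1. geodesic N p q x \<in> closed_strip"
      using S open_strip_subset by (intro eventually_ivl_ends) auto
    have "(g \<longlongrightarrow> g 1) (at_left 1)"
      using continuous_on_Icc_at_leftD[OF cg] by simp
    moreover have "\<forall>\<^sub>F x in at_left 1. g x = to_disc (geodesic N p q x)"
      using S by (intro eventually_ivl_ends) auto
    ultimately show "((\<lambda>x. to_disc (geodesic N p q x)) \<longlongrightarrow> disc_end q) (at_left 1)"
      unfolding g01 by (rule Lim_transform_eventually)
  qed (use E strip_points_subset in blast)
  ultimately show ?thesis unfolding simple_curve_def by blast
qed

text \<open>Above the abscissa \<open>x\<close> the half-circle over the interval from
  \<open>a\<close> to \<open>b\<close> has the squared height \<open>(x - a) * (b - x)\<close>,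
  which grows strictly with the interval. Two intervals that contain \<open>x\<close> and are not
  interlaced are nested, so the heights differ.\<close>

lemma geodesics_disjoint:
  assumes E: "p \<in> strip_points A" "q \<in> strip_points A" "r \<in> strip_points A" "s \<in> strip_points A"
    and lt: "position N p < position N q" "position N r < position N s"
    and ne: "(p, q) \<noteq> (r, s)"
    and nc: "\<not> (position N p < position N r \<and> position N r < position N q \<and> position N q < position N s)"
      "\<not> (position N r < position N p \<and> position N p < position N s \<and> position N s < position N q)"
  shows "curve_trace (geodesic N p q) \<inter> curve_trace (geodesic N r s) = {}"
proof (rule ccontr)
  define a b c d where abcd: "a = position N p" "b = position N q" "c = position N r" "d = position N s"
  assume "\<not> ?thesis"
  then obtain t t' where t: "0 < t" "t < 1" "0 < t'" "t' < 1" "geodesic N p q t = geodesic N r s t'"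
    unfolding curve_trace_def by auto
  have geo: "half_plane (kappa N) (to_disc (geodesic N v w u)) = half_circle (position N v) (position N w) u"
    if "position N v < position N w" "0 < u" "u < 1" for v w u
  proof -
    have im: "0 < Im (half_circle (position N v) (position N w) u)" using half_circle(3) that by blast
    define c where "c = from_half_plane (kappa N) (half_circle (position N v) (position N w) u)"
    have "norm c < 1" unfolding c_def using norm_from_half_plane[OF im] .
    then have "norm c \<le> 1" "c \<noteq> 1" "c \<noteq> -1" by auto
    then have "to_disc (from_disc c) = c" by (rule to_from_disc(2))
    then have "half_plane (kappa N) (to_disc (geodesic N v w u)) = half_plane (kappa N) c"
      by (simp add: geodesic_def c_def)
    also have "\<dots> = half_circle (position N v) (position N w) u"
      unfolding c_def using im by (intro half_plane_inverse) auto
    finally show ?thesis .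
  qed
  define x where "x = Re (half_circle a b t)"
  have "half_circle a b t = half_circle c d t'"
    using geo[OF lt(1) t(1,2)] geo[OF lt(2) t(3,4)] t(5) by (simp add: abcd)
  then have eq: "(x - a) * (b - x) = (x - c) * (d - x)" and pos: "0 < (x - a) * (b - x)"
    using half_circle(4)[OF lt(1), of t] half_circle(4)[OF lt(2), of t'] half_circle(3)[OF lt(1) t(1,2)]
    by (auto simp: abcd x_def)
  have ab: "a < b" "c < d" using lt by (auto simp: abcd)
  have "a < x" "x < b" using pos ab by (auto simp: zero_less_mult_iff)
  have "c < x" "x < d" using pos ab unfolding eq by (auto simp: zero_less_mult_iff)
  have neq: "a \<noteq> c \<or> b \<noteq> d"
    using ne E inj_onD[OF inj_on_position[of N A]] by (auto simp: abcd)
  have strict: "False" if "a' \<le> c'" "d' \<le> b'" "c' < x" "x < d'" "a' \<noteq> c' \<or> b' \<noteq> d'"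
    "(x - a') * (b' - x) = (x - c') * (d' - x)" for a' b' c' d'
  proof -
    have "(x - c') * (d' - x) \<le> (x - a') * (d' - x)" by (rule mult_right_mono) (use that in linarith)+
    moreover have "(x - a') * (d' - x) \<le> (x - a') * (b' - x)" by (rule mult_left_mono) (use that in linarith)+
    ultimately have e: "(x - c') * (d' - x) = (x - a') * (d' - x)" "(x - a') * (d' - x) = (x - a') * (b' - x)"
      using that(6) by linarith+
    have "d' - x \<noteq> 0" "x - a' \<noteq> 0" using that by auto
    with e have "x - c' = x - a'" "d' - x = b' - x" unfolding mult_cancel_left mult_cancel_right by auto
    then show False using that(5) by auto
  qed
  have nc': "\<not> (a < c \<and> b < d)" "\<not> (c < a \<and> d < b)"
    using nc \<open>a < x\<close> \<open>x < b\<close> \<open>c < x\<close> \<open>x < d\<close> unfolding abcd[symmetric] by auto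
  then consider "a \<le> c" "d \<le> b" | "c \<le> a" "b \<le> d" by linarith
  then show False
  proof cases
    case 1
    show False by (rule strict[OF 1 \<open>c < x\<close> \<open>x < d\<close> neq eq])
  next
    case 2
    show False by (rule strict[OF 2 \<open>a < x\<close> \<open>x < b\<close> _ eq[symmetric]]) (use neq in blast)
  qed
qed

section \<open>Triangles in a drawing\<close>

text \<open>Frontiers of regions and closures of sides are taken in the plane. In the disc the same
  closures can only gain 1 and -1, the images of the limit points.\<close>

lemma closure_strip_iff:
  assumes "s \<subseteq> closed_strip"
  shows "closure s = {z \<in> closed_strip. to_disc z \<in> closure (to_disc ` s)}"
proof (intro equalityI subsetI)
  fix z assume z: "z \<in> closure s"
  have cs: "closure s \<subseteq> closed_strip" by (rule closure_minimal[OF assms closed_closed_strip])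
  have "to_disc ` closure s \<subseteq> closure (to_disc ` s)"
    by (rule image_closure_subset[OF continuous_on_subset[OF continuous_on_to_disc cs] closed_closure closure_subset])
  then show "z \<in> {z \<in> closed_strip. to_disc z \<in> closure (to_disc ` s)}" using z cs by auto
next
  fix z assume "z \<in> {z \<in> closed_strip. to_disc z \<in> closure (to_disc ` s)}"
  then have z: "z \<in> closed_strip" "to_disc z \<in> closure (to_disc ` s)" by auto
  then obtain x where x: "\<And>n. x n \<in> to_disc ` s" "x \<longlonglongrightarrow> to_disc z"
    unfolding closure_sequential by blast
  have D: "x n \<in> cball 0 1 - {1, -1}" for n using x(1)[of n] assms to_disc_image by blast
  have "(\<lambda>n. from_disc (x n)) \<longlonglongrightarrow> from_disc (to_disc z)"
    by (rule continuous_on_tendsto_compose[OF continuous_on_from_disc x(2)])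
      (use z(1) to_disc_norm(1) to_disc_ne D in auto)
  then have "(\<lambda>n. from_disc (x n)) \<longlonglongrightarrow> z" using from_to_disc z by simp
  moreover have "from_disc (x n) \<in> s" for n
    using x(1)[of n] assms from_to_disc by fastforce
  ultimately show "z \<in> closure s"
    unfolding closure_sequential by (intro exI[of _ "\<lambda>n. from_disc (x n)"]) auto
qed

text \<open>A common form for arcs and boundary segments: the side without its ends is
  \<open>s\<close>, and \<open>g\<close> is the closed arc in the disc that also contains those ends
  which are limit points.\<close>

definition side_path :: "real set \<Rightarrow> strip_end \<Rightarrow> strip_end \<Rightarrow> complex set \<Rightarrow> (real \<Rightarrow> complex) \<Rightarrow> bool" where
  "side_path A p q s g \<longleftrightarrow> arc g \<and> pathstart g = disc_end p \<and> pathfinish g = disc_end q \<and>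
     g ` {0<..<1} = to_disc ` s \<and> s \<subseteq> closed_strip \<and> s \<inter> vertices A = {} \<and>
     p \<in> strip_points A \<and> q \<in> strip_points A"

lemma side_path_image:
  assumes "side_path A p q s g"
  shows "path_image g = {disc_end p, disc_end q} \<union> to_disc ` s"
    "closure s = {z \<in> closed_strip. to_disc z \<in> path_image g}"
    "path_image g \<subseteq> cball 0 1"
proof -
  have g: "path g" "g 0 = disc_end p" "g 1 = disc_end q" "g ` {0<..<1} = to_disc ` s" "s \<subseteq> closed_strip"
    "p \<in> strip_points A" "q \<in> strip_points A"
    using assms by (auto simp: side_path_def arc_def pathstart_def pathfinish_def)
  have "{0..1} = {0, 1} \<union> {0<..<1::real}" by auto
  then show im: "path_image g = {disc_end p, disc_end q} \<union> to_disc ` s"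
    unfolding path_image_def g(4)[symmetric] g(2)[symmetric] g(3)[symmetric] by auto
  have "path_image g = closure (to_disc ` s)"
  proof
    have c: "closure {0<..<1} = {0..1::real}" by simp
    have "g ` closure {0<..<1} \<subseteq> closure (g ` {0<..<1})"
      by (rule image_closure_subset) (use g(1) in \<open>auto simp: path_def closure_subset\<close>)
    then show "path_image g \<subseteq> closure (to_disc ` s)" unfolding c g(4) path_image_def .
    show "closure (to_disc ` s) \<subseteq> path_image g"
      by (rule closure_minimal) (use im closed_path_image[OF g(1)] in auto)
  qed
  then show "closure s = {z \<in> closed_strip. to_disc z \<in> path_image g}"
    using closure_strip_iff[OF g(5)] by simp
  have "norm (disc_end e) \<le> 1" if "e \<in> strip_points A" for e
    using norm_disc_end_strip_points[OF that] by simp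
  then show "path_image g \<subseteq> cball 0 1"
    unfolding im using g to_disc_norm(1) by auto
qed

lemma disc_end_not_in_side:
  assumes "s \<subseteq> closed_strip" "s \<inter> vertices A = {}" "e \<in> strip_points A"
  shows "disc_end e \<notin> to_disc ` s"
proof
  assume "disc_end e \<in> to_disc ` s"
  then obtain z where z: "z \<in> s" "disc_end e = to_disc z" by auto
  have zs: "z \<in> closed_strip" using z assms by blast
  show False
  proof (cases e)
    case (Point v)
    then have "v \<in> vertices A" using assms(3) by (auto simp: strip_points_def)
    moreover have "v = z"
      using inj_onD[OF inj_on_to_disc, of v z] z zs Point vertices_closed_strip calculation by auto
    ultimately show False using z assms(2) by blast
  qed (use z to_disc_ne[OF zs] in auto)
qed

text \<open>The region enclosed by three sides. In the disc it is the inside of a Jordan curve, and it is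
  the only set with this frontier that can be a region: the outside stays connected when the two
  limit points are removed, but it is unbounded.\<close>

locale strip_triangle =
  fixes A p q r s t u g1 g2 g3
  assumes g: "side_path A p q s g1" "side_path A q r t g2" "side_path A r p u g3"
    and distinct: "p \<noteq> q" "q \<noteq> r" "r \<noteq> p"
    and disjoint: "s \<inter> t = {}" "t \<inter> u = {}" "s \<inter> u = {}"
begin

definition jordan :: "complex set" where "jordan = path_image g1 \<union> path_image g2 \<union> path_image g3"

definition boundary :: "complex set" where "boundary = closure s \<union> closure t \<union> closure u"

definition enclosed :: "complex set" where "enclosed = {z \<in> open_strip. to_disc z \<in> inside jordan}"

lemma pts: "p \<in> strip_points A" "q \<in> strip_points A" "r \<in> strip_points A"
  and sides: "s \<subseteq> closed_strip" "t \<subseteq> closed_strip" "u \<subseteq> closed_strip"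
    "s \<inter> vertices A = {}" "t \<inter> vertices A = {}" "u \<inter> vertices A = {}"
  using g by (auto simp: side_path_def)

lemma jordan_eq: "jordan = {disc_end p, disc_end q, disc_end r} \<union> to_disc ` s \<union> to_disc ` t \<union> to_disc ` u"
  unfolding jordan_def g[THEN side_path_image(1)] by auto

lemma disc_end_inj: "e \<in> strip_points A \<Longrightarrow> e' \<in> strip_points A \<Longrightarrow> disc_end e = disc_end e' \<Longrightarrow> e = e'"
  using inj_onD[OF inj_on_disc_end] strip_points_subset by blast

lemma disc_end_in_jordan:
  assumes "e \<in> strip_points A"
  shows "disc_end e \<in> jordan \<longleftrightarrow> e \<in> {p, q, r}"
proof -
  have "disc_end e = disc_end a \<longleftrightarrow> e = a" if "a \<in> strip_points A" for a
    using disc_end_inj[OF assms that] by blast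
  then show ?thesis
    unfolding jordan_eq using pts disc_end_not_in_side[OF _ _ assms] sides by simp
qed

text \<open>The three arcs meet in the corners only, so their join is a simple closed path. It lies
  in the closed disc, hence so does its inside, and being open the inside misses the unit
  circle.\<close>

lemma jordan_props:
  shows "open (inside jordan)" "connected (inside jordan)" "inside jordan \<noteq> {}" "bounded (inside jordan)"
    "open (outside jordan)" "connected (outside jordan)" "\<not> bounded (outside jordan)" "frontier (inside jordan) = jordan"
    "inside jordan \<subseteq> ball 0 1"
proof -
  define j where "j = g1 +++ (g2 +++ g3)"
  have arcs: "arc g1" "arc g2" "arc g3"
    and e: "pathstart g1 = disc_end p" "pathfinish g1 = disc_end q" "pathstart g2 = disc_end q"
      "pathfinish g2 = disc_end r" "pathstart g3 = disc_end r" "pathfinish g3 = disc_end p"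
    using g by (auto simp: side_path_def)
  note im = g[THEN side_path_image(1)]
  have disj: "to_disc ` s \<inter> to_disc ` t = {}" "to_disc ` t \<inter> to_disc ` u = {}" "to_disc ` s \<inter> to_disc ` u = {}"
    using disjoint inj_on_image_Int[OF inj_on_to_disc] sides by (metis image_is_empty)+
  have dn: "disc_end e \<notin> to_disc ` s" "disc_end e \<notin> to_disc ` t" "disc_end e \<notin> to_disc ` u"
    if "e \<in> {p, q, r}" for e
    using disc_end_not_in_side sides pts that by blast+
  have ne: "disc_end p \<noteq> disc_end q" "disc_end q \<noteq> disc_end r" "disc_end r \<noteq> disc_end p"
    using distinct disc_end_inj pts by blast+
  have "arc (g2 +++ g3)"
    by (rule arc_join) (use arcs e im disj dn ne in auto)
  then have "simple_path j"
    unfolding j_def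
    by (rule simple_path_join_loop[OF arcs(1)]) (use arcs e im disj dn ne in \<open>auto simp: path_image_join\<close>)
  moreover have "pathfinish j = pathstart j" "path_image j = jordan"
    unfolding j_def jordan_def using e by (auto simp: path_image_join)
  ultimately show jordan: "open (inside jordan)" "connected (inside jordan)" "inside jordan \<noteq> {}" "bounded (inside jordan)"
    "open (outside jordan)" "connected (outside jordan)" "\<not> bounded (outside jordan)" "frontier (inside jordan) = jordan"
    using Jordan_inside_outside[of j] by auto
  have "jordan \<subseteq> cball 0 1" unfolding jordan_def using g[THEN side_path_image(3)] by auto
  then have "- cball 0 1 \<subseteq> outside jordan" by (intro outside_subset_convex) auto
  then have "inside jordan \<subseteq> cball 0 1" using inside_Int_outside[of jordan] by blast
  then have "inside jordan \<subseteq> interior (cball 0 1)" using jordan(1) by (rule interior_maximal)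
  then show "inside jordan \<subseteq> ball 0 1" by simp
qed

lemma boundary_iff: "boundary = {z \<in> closed_strip. to_disc z \<in> jordan}"
  unfolding boundary_def jordan_def using g[THEN side_path_image(2)] by auto

lemma boundary_open_strip:
  assumes "z \<in> boundary" "z \<in> open_strip" shows "z \<in> s \<union> t \<union> u"
proof -
  have "norm (to_disc z) < 1" using assms(2) to_disc_image_open by auto
  then have "to_disc z \<in> to_disc ` s \<union> to_disc ` t \<union> to_disc ` u"
    using assms(1) norm_disc_end_strip_points pts unfolding boundary_iff jordan_eq by force
  then show ?thesis
    using inj_onD[OF inj_on_to_disc] sides assms(2) open_strip_subset by blast
qed

lemma to_disc_enclosed: "to_disc ` enclosed = inside jordan"
proof (intro equalityI subsetI)
  fix c assume c: "c \<in> inside jordan"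
  then have "c \<in> to_disc ` open_strip" using jordan_props(9) to_disc_image_open by blast
  then show "c \<in> to_disc ` enclosed" using c by (auto simp: enclosed_def)
qed (auto simp: enclosed_def)

lemma enclosed_open_strip: "enclosed \<subseteq> open_strip"
  by (auto simp: enclosed_def)

lemma enclosed_nonempty: "enclosed \<noteq> {}"
  using to_disc_enclosed jordan_props(3) by auto

lemma connected_enclosed: "connected enclosed"
proof -
  have "enclosed = from_disc ` inside jordan"
  proof -
    have "from_disc ` to_disc ` enclosed = enclosed"
      using enclosed_open_strip open_strip_subset from_to_disc by (force simp: image_image)
    then show ?thesis by (simp add: to_disc_enclosed)
  qed
  moreover have "inside jordan \<subseteq> cball 0 1 - {1, -1}" using jordan_props(9) by force
  ultimately show ?thesis
    using connected_continuous_image[OF continuous_on_subset[OF continuous_on_from_disc] jordan_props(2)] by metis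
qed

lemma closure_inside: "closure (inside jordan) = inside jordan \<union> jordan" "inside jordan \<inter> jordan = {}"
  using jordan_props(8) closure_Un_frontier[of "inside jordan"] inside_no_overlap[of jordan] by auto

text \<open>The inside is in the open disc and the ends are on its boundary circle, so an end can
  only be reached on the Jordan curve itself. This confines an arc drawn inside the region to the
  corners, and it recovers the corners from the region.\<close>

lemma corner_iff:
  assumes "e \<in> strip_points A"
  shows "disc_end e \<in> closure (to_disc ` enclosed) \<longleftrightarrow> e \<in> {p, q, r}"
  using norm_disc_end_strip_points[OF assms] jordan_props(9) disc_end_in_jordan[OF assms]
  unfolding to_disc_enclosed closure_inside(1) by auto

lemma frontier_enclosed: "frontier enclosed = boundary"
proof -
  have "open enclosed"
  proof -
    have "enclosed = open_strip \<inter> to_disc -` inside jordan" by (auto simp: enclosed_def)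
    then show ?thesis
      using continuous_open_preimage[OF continuous_on_subset[OF continuous_on_to_disc open_strip_subset] open_open_strip jordan_props(1)]
      by simp
  qed
  then have "frontier enclosed = closure enclosed - enclosed" by (simp add: frontier_def interior_open)
  also have "closure enclosed = {z \<in> closed_strip. to_disc z \<in> inside jordan \<union> jordan}"
    using closure_strip_iff[of enclosed] enclosed_open_strip open_strip_subset to_disc_enclosed closure_inside(1) by auto
  also have "\<dots> - enclosed = boundary"
  proof -
    have "z \<in> open_strip" if "z \<in> closed_strip" "to_disc z \<in> inside jordan" for z
      using to_disc_norm(2)[OF that(1)] that(2) jordan_props(9) by auto
    then show ?thesis using closure_inside(2) unfolding boundary_iff enclosed_def by blast
  qed
  finally show ?thesis .
qed

lemma connected_subset_enclosed:
  assumes "connected X" "X \<inter> boundary = {}" "X \<inter> enclosed \<noteq> {}"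
  shows "X \<subseteq> enclosed"
  using connected_Int_frontier[OF assms(1,3)] assms(2) frontier_enclosed by blast

lemma region_meets_enclosed:
  assumes R: "R \<subseteq> open_strip" "R \<noteq> {}" "R \<inter> boundary = {}" and fr: "frontier R = boundary"
  shows "R \<inter> enclosed \<noteq> {}"
proof
  assume dis: "R \<inter> enclosed = {}"
  define X where "X = to_disc ` R"
  have Rc: "R \<subseteq> closed_strip" using R(1) open_strip_subset by blast
  have X: "X \<subseteq> ball 0 1" "X \<noteq> {}" unfolding X_def using R to_disc_image_open by auto
  have X_out: "X \<subseteq> outside jordan"
  proof
    fix x assume "x \<in> X"
    then obtain z where z: "z \<in> R" "x = to_disc z" by (auto simp: X_def)
    have "x \<notin> jordan" using z R Rc by (auto simp: boundary_iff)
    moreover have "x \<notin> inside jordan" using z R(1) dis by (auto simp: enclosed_def)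
    ultimately show "x \<in> outside jordan" using inside_Un_outside[of jordan] by blast
  qed
  have "open R"
  proof -
    have "R \<inter> frontier R = {}" using R fr by simp
    then show ?thesis using frontier_disjoint_eq by (metis Int_commute)
  qed
  have "open X"
  proof -
    have cont: "continuous_on (ball 0 1) from_disc"
      by (rule continuous_on_subset[OF continuous_on_from_disc]) force
    have "X = ball 0 1 \<inter> from_disc -` R"
    proof (intro equalityI subsetI)
      fix x assume "x \<in> X" then show "x \<in> ball 0 1 \<inter> from_disc -` R"
        using X Rc from_to_disc by (auto simp: X_def subset_iff)
    next
      fix x :: complex assume x: "x \<in> ball 0 1 \<inter> from_disc -` R"
      then have "norm x \<le> 1" "x \<noteq> 1" "x \<noteq> -1" by auto
      then have "to_disc (from_disc x) = x" by (rule to_from_disc(2))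
      then show "x \<in> X" using x unfolding X_def by force
    qed
    then show ?thesis using continuous_open_preimage[OF cont open_ball \<open>open R\<close>] by simp
  qed
  \<comment> \<open>The passage to the disc may add 1 and -1 to the frontier even if they are no
    corners, since \<open>R\<close> may be unbounded in the strip. This is why these two points are
    removed from the outside below.\<close>
  have frX: "frontier X \<subseteq> jordan \<union> {1, -1}"
  proof
    fix x assume x: "x \<in> frontier X"
    have xX: "x \<in> closure X" "x \<notin> X" using x \<open>open X\<close> by (auto simp: frontier_def interior_open)
    have "closure X \<subseteq> cball 0 1" by (rule closure_minimal) (use X in auto)
    then have xc: "norm x \<le> 1" using xX by auto
    show "x \<in> jordan \<union> {1, -1}"
    proof (rule ccontr)
      assume n: "x \<notin> jordan \<union> {1, -1}"
      define z where "z = from_disc x"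
      have z: "z \<in> closed_strip" "to_disc z = x" unfolding z_def using to_from_disc xc n by auto
      then have "z \<in> closure R" using closure_strip_iff[OF Rc] xX by (simp add: X_def)
      moreover have "z \<notin> R" using xX z by (auto simp: X_def)
      ultimately have "z \<in> frontier R" using \<open>open R\<close> by (simp add: frontier_def interior_open)
      then show False using fr n z by (simp add: boundary_iff)
    qed
  qed
  have "connected (outside jordan - {1, -1})"
    by (rule connected_open_delete_finite[OF jordan_props(5,6)]) auto
  moreover have "(outside jordan - {1, -1}) \<inter> X \<noteq> {}" using X X_out by force
  moreover have "(outside jordan - {1, -1}) \<inter> frontier X = {}" using frX outside_no_overlap[of jordan] by blast
  ultimately have "outside jordan - {1, -1} \<subseteq> X" using connected_Int_frontier by blast
  then have "outside jordan \<subseteq> cball 0 1" using X by force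
  then show False using jordan_props(7) bounded_subset[OF bounded_cball] by blast
qed

lemma component_eq_enclosed:
  assumes "R \<in> components Z" "Z \<subseteq> open_strip" "Z \<inter> boundary = {}" "enclosed \<subseteq> Z" "frontier R = boundary"
  shows "R = enclosed"
proof -
  have R: "R \<subseteq> Z" "R \<noteq> {}" "connected R" using assms(1) by (auto simp: in_components_maximal)
  have "R \<inter> enclosed \<noteq> {}" by (rule region_meets_enclosed) (use R assms in auto)
  then have "R \<subseteq> enclosed" "enclosed \<subseteq> R"
    using connected_subset_enclosed[OF R(3)] R(1) assms(3) components_maximal[OF assms(1) connected_enclosed assms(4)] by auto
  then show ?thesis by blast
qed

lemma enclosed_component:
  assumes "Z \<inter> boundary = {}" "enclosed \<subseteq> Z"
  shows "enclosed \<in> components Z"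
  unfolding in_components_maximal
proof (intro conjI allI impI)
  fix X assume X: "X \<noteq> {} \<and> enclosed \<subseteq> X \<and> X \<subseteq> Z \<and> connected X"
  then have "X \<inter> enclosed \<noteq> {}" "X \<inter> boundary = {}" using enclosed_nonempty assms(1) by blast+
  then show "X = enclosed" using connected_subset_enclosed[of X] X by blast
qed (use enclosed_nonempty connected_enclosed assms(2) in auto)

end

section \<open>Linked ends and the sides of regions\<close>

lemma exists_simple_curve:
  assumes "p \<in> strip_points A" "q \<in> strip_points A" "p \<noteq> q"
  shows "\<exists>c. simple_curve p q c"
proof -
  have "position 0 p \<noteq> position 0 q" using inj_onD[OF inj_on_position] assms by blast
  then consider "position 0 p < position 0 q" | "position 0 q < position 0 p" by linarith
  then show ?thesis
    using simple_curve_geodesic simple_curve_flip assms by cases blast+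
qed

lemma strip_arcs_eq:
  "strip_arcs A = {ends_class p q | p q. p \<in> strip_points A \<and> q \<in> strip_points A \<and> p \<noteq> q \<and> \<not> adjacent A p q}"
proof (intro equalityI subsetI)
  fix \<alpha> assume "\<alpha> \<in> strip_arcs A"
  then obtain p q c where c: "\<alpha> = arc_class p q c" "arc_curve A p q c" by (auto simp: strip_arcs_def)
  then show "\<alpha> \<in> {ends_class p q | p q. p \<in> strip_points A \<and> q \<in> strip_points A \<and> p \<noteq> q \<and> \<not> adjacent A p q}"
    using arc_class_eq arc_ends_iff unfolding arc_curve_def by blast
next
  fix \<alpha> assume "\<alpha> \<in> {ends_class p q | p q. p \<in> strip_points A \<and> q \<in> strip_points A \<and> p \<noteq> q \<and> \<not> adjacent A p q}"
  then obtain p q where pq: "\<alpha> = ends_class p q" "p \<in> strip_points A" "q \<in> strip_points A" "p \<noteq> q" "\<not> adjacent A p q"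
    by blast
  obtain c where c: "simple_curve p q c" using exists_simple_curve pq by blast
  then have "arc_curve A p q c" unfolding arc_curve_def arc_ends_iff using pq by blast
  then show "\<alpha> \<in> strip_arcs A" unfolding strip_arcs_def using arc_class_eq[OF c] pq(1) by blast
qed

definition linked :: "real set \<Rightarrow> strip_arc set \<Rightarrow> strip_end \<Rightarrow> strip_end \<Rightarrow> bool" where
  "linked A T p q \<longleftrightarrow> p \<in> strip_points A \<and> q \<in> strip_points A \<and> p \<noteq> q \<and> (adjacent A p q \<or> ends_class p q \<in> T)"

lemma linked_sym: "linked A T p q \<Longrightarrow> linked A T q p"
  unfolding linked_def using adjacent_sym ends_class_commute by metis

lemma open_segment_horizontal:
  assumes "a < b"
  shows "open_segment (Complex a h) (Complex b h) = {z. Im z = h \<and> a < Re z \<and> Re z < b}"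
proof (rule set_eqI)
  fix z
  have cl: "closed_segment (Complex a h) (Complex b h) = {z. Im z = h \<and> a \<le> Re z \<and> Re z \<le> b}"
    by (subst closed_segment_same_Im) (use assms in \<open>auto simp: closed_segment_eq_real_ivl\<close>)
  show "z \<in> open_segment (Complex a h) (Complex b h) \<longleftrightarrow>
      z \<in> {z. Im z = h \<and> a < Re z \<and> Re z < b}"
    unfolding open_segment_def cl using assms by (cases z) auto
qed

lemma neighbouring_form:
  assumes "neighbouring A v w"
  obtains a b h where "a < b" "h = 0 \<or> h = 1" "{v, w} = {Complex a h, Complex b h}"
    "open_segment v w = {z. Im z = h \<and> a < Re z \<and> Re z < b}"
    "\<forall>x. Complex x h \<in> vertices A \<longrightarrow> \<not> (a < x \<and> x < b)"
proof -
  have n: "v \<in> vertices A" "v \<noteq> w" "Im v = Im w" "open_segment v w \<inter> vertices A = {}"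
    using assms by (auto simp: neighbouring_def)
  define a b where "a = min (Re v) (Re w)" and "b = max (Re v) (Re w)"
  have "Re v \<noteq> Re w" using n by (auto simp: complex_eq_iff)
  then have ab: "a < b" by (auto simp: a_def b_def)
  have vw: "v = Complex a (Im v) \<and> w = Complex b (Im v) \<or> w = Complex a (Im v) \<and> v = Complex b (Im v)"
    using n by (auto simp: a_def b_def min_def max_def complex_eq_iff)
  then have o: "open_segment v w = {z. Im z = Im v \<and> a < Re z \<and> Re z < b}"
    using open_segment_horizontal[OF ab, of "Im v"] by (metis open_segment_commute)
  show ?thesis
  proof (rule that[OF ab vertices_Im(1)[OF n(1)] _ o])
    show "{v, w} = {Complex a (Im v), Complex b (Im v)}" using vw by auto
    show "\<forall>x. Complex x (Im v) \<in> vertices A \<longrightarrow> \<not> (a < x \<and> x < b)"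
    proof (intro allI impI notI)
      fix x assume x: "Complex x (Im v) \<in> vertices A" "a < x \<and> x < b"
      then have "Complex x (Im v) \<in> open_segment v w" unfolding o by simp
      then show False using n(4) x(1) by blast
    qed
  qed
qed

text \<open>If two such segments overlap and are different, an end of one lies inside the other,
  where there are no vertices.\<close>

lemma neighbouring_segments_disjoint:
  assumes "neighbouring A v w" "neighbouring A v' w'" "{v, w} \<noteq> {v', w'}"
  shows "open_segment v w \<inter> open_segment v' w' = {}"
proof (rule ccontr)
  assume *: "\<not> ?thesis"
  obtain a b h where 1: "a < b" "h = 0 \<or> h = 1" "{v, w} = {Complex a h, Complex b h}"
    "open_segment v w = {z. Im z = h \<and> a < Re z \<and> Re z < b}"
    "\<forall>x. Complex x h \<in> vertices A \<longrightarrow> \<not> (a < x \<and> x < b)"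
    by (rule neighbouring_form[OF assms(1)])
  obtain a' b' h' where 2: "a' < b'" "h' = 0 \<or> h' = 1" "{v', w'} = {Complex a' h', Complex b' h'}"
    "open_segment v' w' = {z. Im z = h' \<and> a' < Re z \<and> Re z < b'}"
    "\<forall>x. Complex x h' \<in> vertices A \<longrightarrow> \<not> (a' < x \<and> x < b')"
    by (rule neighbouring_form[OF assms(2)])
  have "{v, w} \<subseteq> vertices A" "{v', w'} \<subseteq> vertices A" using assms by (auto simp: neighbouring_def)
  then have V: "Complex a h \<in> vertices A" "Complex b h \<in> vertices A"
    "Complex a' h' \<in> vertices A" "Complex b' h' \<in> vertices A" unfolding 1(3) 2(3) by auto
  obtain x where x: "h = h'" "a < x" "x < b" "a' < x" "x < b'" using * unfolding 1(4) 2(4) by auto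
  then have "a = a'" "b = b'" using 1(5)[rule_format, of a'] 1(5)[rule_format, of b'] 2(5)[rule_format, of a] 2(5)[rule_format, of b] V by force+
  then show False using assms(3) 1(3) 2(3) x(1) by simp
qed

lemma open_segment_not_open_strip:
  assumes "neighbouring A v w" shows "open_segment v w \<inter> open_strip = {}"
  by (rule neighbouring_form[OF assms]) (auto simp: open_strip_def)

lemma curve_trace_not_vertex: "simple_curve p q c \<Longrightarrow> curve_trace c \<inter> vertices A = {}"
  using vertices_Im(1)[of _ A] unfolding simple_curve_def open_strip_def by force

lemma side_path_arc:
  assumes "simple_curve p q c" "p \<in> strip_points A" "q \<in> strip_points A" "p \<noteq> q"
  shows "side_path A p q (curve_trace c) (disc_path p q c)"
proof -
  have "disc_path p q c ` {0<..<1} = to_disc ` curve_trace c"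
    unfolding curve_trace_def image_image by (rule image_cong) (auto simp: disc_path_def)
  moreover have "curve_trace c \<subseteq> closed_strip"
    using assms(1) open_strip_subset unfolding simple_curve_def by blast
  moreover have "arc (disc_path p q c)"
    by (rule arc_disc_path) (use assms norm_disc_end_strip_points in auto)
  ultimately show ?thesis unfolding side_path_def
    using curve_trace_not_vertex[OF assms(1)] assms(2,3) by simp
qed

lemma side_path_segment:
  assumes "neighbouring A v w"
  shows "side_path A (Point v) (Point w) (open_segment v w) (to_disc \<circ> linepath v w)"
proof -
  have n: "v \<in> vertices A" "w \<in> vertices A" "v \<noteq> w" "open_segment v w \<inter> vertices A = {}"
    using assms by (auto simp: neighbouring_def)
  have "convex closed_strip"
    unfolding closed_strip_def Collect_conj_eq
    by (intro convex_Int) (auto simp: convex_halfspace_Im_ge convex_halfspace_Im_le)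
  then have cs: "closed_segment v w \<subseteq> closed_strip"
    using n vertices_closed_strip by (intro closed_segment_subset) auto
  have "arc (to_disc \<circ> linepath v w)"
    unfolding arc_def
  proof
    show "path (to_disc \<circ> linepath v w)"
      using cs by (intro path_continuous_image continuous_on_subset[OF continuous_on_to_disc]) auto
    show "inj_on (to_disc \<circ> linepath v w) {0..1}"
    proof (rule comp_inj_on)
      show "inj_on (linepath v w) {0..1}" using arc_linepath[OF n(3)] by (simp add: arc_def)
      show "inj_on to_disc (linepath v w ` {0..1})"
        using inj_on_subset[OF inj_on_to_disc cs] by (simp add: linepath_image_01)
    qed
  qed
  moreover have "linepath v w ` {0<..<1} = open_segment v w"
    using n(3) by (simp add: open_segment_image_interval linepath_def)
  then have "(to_disc \<circ> linepath v w) ` {0<..<1} = to_disc ` open_segment v w"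
    by (metis image_comp)
  moreover have "open_segment v w \<subseteq> closed_strip" using cs by (auto simp: open_segment_def)
  ultimately show ?thesis
    unfolding side_path_def using n by (auto simp: pathstart_compose pathfinish_compose strip_points_def)
qed

locale strip_drawing =
  fixes A :: "real set" and T D
  assumes arcs: "T \<subseteq> strip_arcs A" and drawing: "drawing T D"
begin

abbreviation complement :: "complex set" where
  "complement \<equiv> open_strip - (\<Union>\<alpha>\<in>T. curve_trace (D \<alpha>))"

lemma drawn_arc:
  assumes "\<alpha> \<in> T"
  obtains p q where "simple_curve p q (D \<alpha>)" "\<alpha> = ends_class p q" "p \<in> strip_points A" "q \<in> strip_points A"
    "p \<noteq> q" "\<not> adjacent A p q"
proof -
  obtain p q where pq: "\<alpha> = ends_class p q" "p \<in> strip_points A" "q \<in> strip_points A" "p \<noteq> q" "\<not> adjacent A p q"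
    using assms arcs unfolding strip_arcs_eq by blast
  have "D \<alpha> \<in> \<alpha>" using drawing assms by (auto simp: drawing_def)
  then have "simple_curve p q (D \<alpha>) \<or> simple_curve q p (D \<alpha>)" by (simp add: pq(1) ends_class_def)
  then show ?thesis
  proof
    assume "simple_curve p q (D \<alpha>)" then show ?thesis using that pq by blast
  next
    assume c: "simple_curve q p (D \<alpha>)"
    have "\<alpha> = ends_class q p" "\<not> adjacent A q p" using pq ends_class_commute adjacent_sym by blast+
    then show ?thesis using that[OF c] pq by blast
  qed
qed

lemma drawn_arc_ends:
  assumes "\<alpha> \<in> T" "simple_curve p q (D \<alpha>)"
  shows "\<alpha> = ends_class p q" "linked A T p q" "\<not> adjacent A p q"
proof -
  obtain p' q' where "simple_curve p' q' (D \<alpha>)" "\<alpha> = ends_class p' q'" "p' \<in> strip_points A" "q' \<in> strip_points A"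
    "p' \<noteq> q'" "\<not> adjacent A p' q'"
    using drawn_arc[OF assms(1)] by blast
  moreover from this have "p' = p" "q' = q" using simple_curve_unique_ends assms(2) by blast+
  ultimately show "\<alpha> = ends_class p q" "linked A T p q" "\<not> adjacent A p q"
    using assms(1) by (auto simp: linked_def)
qed

lemma side_cases:
  assumes "side A T D p q s"
  obtains (arc) \<alpha> where "\<alpha> \<in> T" "\<alpha> = ends_class p q" "s = curve_trace (D \<alpha>)" "\<not> adjacent A p q"
      "simple_curve p q (D \<alpha>) \<or> simple_curve q p (D \<alpha>)" "linked A T p q"
    | (segment) v w where "neighbouring A v w" "p = Point v" "q = Point w" "s = open_segment v w"
      "linked A T p q"
proof -
  consider \<alpha> where "\<alpha> \<in> T" "simple_curve p q (D \<alpha>)" "s = curve_trace (D \<alpha>)"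
    | \<alpha> where "\<alpha> \<in> T" "simple_curve q p (D \<alpha>)" "s = curve_trace (D \<alpha>)"
    | v w where "neighbouring A v w" "p = Point v" "q = Point w" "s = open_segment v w"
    using assms unfolding side_def by metis
  then show ?thesis
  proof cases
    case (1 \<alpha>)
    show ?thesis
      by (rule arc[OF 1(1) drawn_arc_ends(1)[OF 1(1,2)] 1(3) drawn_arc_ends(3)[OF 1(1,2)] _ drawn_arc_ends(2)[OF 1(1,2)]])
        (simp add: 1)
  next
    case (2 \<alpha>)
    note d = drawn_arc_ends[OF 2(1,2)]
    have "\<alpha> = ends_class p q" using d(1) ends_class_commute[of p q] by simp
    moreover have "\<not> adjacent A p q" using d(3) adjacent_sym by blast
    ultimately show ?thesis using linked_sym[OF d(2)] 2 by (intro arc[of \<alpha>]) simp_all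
  next
    case (3 v w)
    then have "adjacent A p q" by (auto simp: adjacent_def)
    then have "linked A T p q" using adjacentD[of A p q] by (simp add: linked_def)
    with 3 show ?thesis by (rule segment)
  qed
qed

lemma side_linked: "side A T D p q s \<Longrightarrow> linked A T p q"
  by (erule side_cases)

lemma side_sym: "side A T D p q s \<Longrightarrow> side A T D q p s"
  unfolding side_def neighbouring_def by (metis open_segment_commute)

lemma linked_side:
  assumes "linked A T p q" shows "\<exists>s. side A T D p q s"
proof (cases "adjacent A p q")
  case True
  then show ?thesis unfolding side_def adjacent_def by blast
next
  case False
  then have \<alpha>: "ends_class p q \<in> T" using assms by (simp add: linked_def)
  then have "D (ends_class p q) \<in> ends_class p q" using drawing by (auto simp: drawing_def)
  then show ?thesis unfolding side_def using \<alpha> by (auto simp: ends_class_def)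
qed

text \<open>Arcs never join neighbouring vertices, and an arc is determined by its ends, so a pair
  of ends cannot carry two sides.\<close>

lemma side_unique:
  assumes "side A T D p q s" "side A T D p q s'"
  shows "s = s'"
  using assms(1)
proof (cases rule: side_cases)
  case (arc \<alpha>)
  show ?thesis using assms(2) by (cases rule: side_cases) (use arc in \<open>auto simp: adjacent_def\<close>)
next
  case (segment v w)
  show ?thesis using assms(2) by (cases rule: side_cases) (use segment in \<open>auto simp: adjacent_def\<close>)
qed

lemma side_not_in_complement:
  assumes "side A T D p q s" shows "s \<inter> complement = {}"
  using assms by (cases rule: side_cases) (use open_segment_not_open_strip in blast)+

lemma trace_open_strip: "\<alpha> \<in> T \<Longrightarrow> curve_trace (D \<alpha>) \<subseteq> open_strip"
  using drawn_arc unfolding simple_curve_def by metis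

lemma sides_disjoint:
  assumes "side A T D p q s" "side A T D p' q' s'" "{p, q} \<noteq> {p', q'}"
  shows "s \<inter> s' = {}"
  using assms(1)
proof (cases rule: side_cases)
  case (arc \<alpha>)
  note \<alpha> = this
  show ?thesis using assms(2)
  proof (cases rule: side_cases)
    case (arc \<beta>)
    have "D \<alpha> \<in> ends_class p q" using \<alpha> by (auto simp: ends_class_def)
    then have "\<alpha> \<noteq> \<beta>" using ends_class_eq_iff[of "D \<alpha>" p q p' q'] \<alpha> arc assms(3) by auto
    then show ?thesis using drawing \<alpha> arc by (auto simp: drawing_def pairwise_def)
  next
    case (segment v w)
    then show ?thesis using open_segment_not_open_strip[OF segment(1)] trace_open_strip[OF \<alpha>(1)] \<alpha>(3) by blast
  qed
next
  case (segment v w)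
  note vw = this
  show ?thesis using assms(2)
  proof (cases rule: side_cases)
    case (arc \<beta>)
    then show ?thesis using open_segment_not_open_strip[OF vw(1)] trace_open_strip[OF arc(1)] vw(4) by blast
  next
    case (segment v' w')
    then show ?thesis using neighbouring_segments_disjoint[OF vw(1) segment(1)] vw assms(3) by auto
  qed
qed

lemma side_path_exists:
  assumes "side A T D p q s" shows "\<exists>g. side_path A p q s g"
  using assms
proof (cases rule: side_cases)
  case (arc \<alpha>)
  obtain c where "simple_curve p q c" "curve_trace c = s"
    using arc simple_curve_flip curve_trace_flip by metis
  then show ?thesis using side_path_arc[of p q c A] arc(6) unfolding linked_def by blast
next
  case (segment v w)
  then show ?thesis using side_path_segment by blast
qed

lemma strip_triangle_exists:
  assumes "side A T D p q s" "side A T D q r t" "side A T D r p u" "p \<noteq> q" "q \<noteq> r" "r \<noteq> p"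
  shows "\<exists>g1 g2 g3. strip_triangle A p q r s t u g1 g2 g3"
proof -
  obtain g1 g2 g3 where "side_path A p q s g1" "side_path A q r t g2" "side_path A r p u g3"
    using side_path_exists assms by metis
  moreover have "s \<inter> t = {}" "t \<inter> u = {}" "s \<inter> u = {}"
    using sides_disjoint[OF assms(1,2)] sides_disjoint[OF assms(2,3)] sides_disjoint[OF assms(1,3)] assms(4-6)
    by (auto simp: doubleton_eq_iff)
  ultimately show ?thesis using assms(4-6) unfolding strip_triangle_def by blast
qed

text \<open>An arc that enters the region enclosed by three sides stays inside, so that it joins two of
  the three corners and is itself one of the sides.\<close>

lemma enclosed_region:
  assumes "side A T D p q s" "side A T D q r t" "side A T D r p u" "strip_triangle A p q r s t u g1 g2 g3"
  shows "strip_triangle.enclosed g1 g2 g3 \<subseteq> complement" "complement \<inter> strip_triangle.boundary s t u = {}"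
proof -
  interpret strip_triangle A p q r s t u g1 g2 g3 by (rule assms(4))
  show Z: "complement \<inter> boundary = {}"
    using boundary_open_strip side_not_in_complement assms(1-3) by blast
  have Rb: "enclosed \<inter> boundary = {}"
    using enclosed_open_strip closure_inside(2) unfolding enclosed_def boundary_iff by blast
  have sub: "x \<in> boundary" if "x \<in> s \<union> t \<union> u" for x
    using that closure_subset unfolding boundary_def by blast
  show "enclosed \<subseteq> complement"
  proof (rule ccontr)
    assume "\<not> enclosed \<subseteq> complement"
    then obtain \<alpha> z where \<alpha>: "\<alpha> \<in> T" "z \<in> curve_trace (D \<alpha>)" "z \<in> enclosed" using enclosed_open_strip by blast
    obtain e f where ef: "simple_curve e f (D \<alpha>)" "\<alpha> = ends_class e f" "e \<in> strip_points A" "f \<in> strip_points A"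
      "e \<noteq> f" "\<not> adjacent A e f"
      using drawn_arc[OF \<alpha>(1)] by blast
    \<comment> \<open>The point \<open>z\<close> of \<open>\<alpha>\<close> is in the enclosed
      region, while the sides are on its boundary; so \<open>\<alpha>\<close> is not the arc of a
      side.\<close>
    have other: "\<alpha> \<noteq> \<beta>" if "\<beta> \<in> T" "curve_trace (D \<beta>) \<subseteq> s \<union> t \<union> u" for \<beta>
      using that \<alpha> Rb sub by blast
    have dis: "curve_trace (D \<alpha>) \<inter> s' = {}" if "side A T D p' q' s'" "s' \<subseteq> s \<union> t \<union> u" for p' q' s'
      using that(1)
    proof (cases rule: side_cases)
      case (arc \<beta>)
      then have "\<alpha> \<noteq> \<beta>" using other that(2) by blast
      then show ?thesis using drawing \<alpha>(1) arc by (auto simp: drawing_def pairwise_def)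
    next
      case (segment v w)
      then show ?thesis using open_segment_not_open_strip[OF segment(1)] trace_open_strip[OF \<alpha>(1)] by blast
    qed
    have "curve_trace (D \<alpha>) \<inter> (s \<union> t \<union> u) = {}"
      using dis[OF assms(1)] dis[OF assms(2)] dis[OF assms(3)] by blast
    then have "curve_trace (D \<alpha>) \<inter> boundary = {}"
      using boundary_open_strip trace_open_strip[OF \<alpha>(1)] by blast
    moreover have "connected (curve_trace (D \<alpha>))"
      using ef(1) unfolding simple_curve_def curve_trace_def
      by (intro connected_continuous_image) auto
    ultimately have "curve_trace (D \<alpha>) \<subseteq> enclosed" using connected_subset_enclosed \<alpha> by blast
    then have cl: "closure (to_disc ` curve_trace (D \<alpha>)) \<subseteq> closure (to_disc ` enclosed)"
      by (intro closure_mono image_mono)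
    have ev: "\<forall>\<^sub>F t in at_right 0. to_disc (D \<alpha> t) \<in> closure (to_disc ` enclosed)"
      "\<forall>\<^sub>F t in at_left 1. to_disc (D \<alpha> t) \<in> closure (to_disc ` enclosed)"
      using cl closure_subset unfolding curve_trace_def by (intro eventually_ivl_ends; force)+
    have "disc_end e \<in> closure (to_disc ` enclosed)"
      using Lim_in_closed_set[OF closed_closure ev(1) _ simple_curveD(5)[OF ef(1)]] by simp
    moreover have "disc_end f \<in> closure (to_disc ` enclosed)"
      using Lim_in_closed_set[OF closed_closure ev(2) _ simple_curveD(6)[OF ef(1)]] by simp
    ultimately have "e \<in> {p, q, r}" "f \<in> {p, q, r}" using corner_iff ef by blast+
    then have "{e, f} = {p, q} \<or> {e, f} = {q, r} \<or> {e, f} = {r, p}" using ef(5) by auto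
    then obtain p' q' s' where s': "{e, f} = {p', q'}" "side A T D p' q' s'" "s' \<subseteq> s \<union> t \<union> u"
      using assms(1-3) by blast
    from s'(2) show False
    proof (cases rule: side_cases)
      case (arc \<beta>)
      have "ends_class p' q' = ends_class e f" using s'(1) ends_class_commute by (auto simp: doubleton_eq_iff)
      then show False using other[OF arc(1)] arc(2,3) ef(2) s'(3) by simp
    next
      case (segment v w)
      then have "adjacent A p' q'" by (auto simp: adjacent_def)
      then show False using s'(1) ef(6) adjacent_sym by (auto simp: doubleton_eq_iff)
    qed
  qed
qed

lemma triangle_corners_enclosed:
  assumes "triangle_corners A T D R p q r"
  obtains s t u g1 g2 g3 where "side A T D p q s" "side A T D q r t" "side A T D r p u"
    "strip_triangle A p q r s t u g1 g2 g3" "R = strip_triangle.enclosed g1 g2 g3"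
proof -
  obtain s t u where stu: "side A T D p q s" "side A T D q r t" "side A T D r p u"
    "frontier R = closure s \<union> closure t \<union> closure u" "R \<in> components complement" "p \<noteq> q" "q \<noteq> r" "r \<noteq> p"
    using assms unfolding triangle_corners_def regions_def by auto
  then obtain g1 g2 g3 where tri: "strip_triangle A p q r s t u g1 g2 g3" using strip_triangle_exists by blast
  interpret strip_triangle A p q r s t u g1 g2 g3 by (rule tri)
  have "R = enclosed"
    by (rule component_eq_enclosed[OF stu(5)])
      (use enclosed_region[OF stu(1-3) tri] stu(4) in \<open>auto simp: boundary_def\<close>)
  then show ?thesis using that stu tri by blast
qed

lemma triangle_exists:
  assumes "linked A T p q" "linked A T q r" "linked A T r p"
  shows "\<exists>R. triangle_corners A T D R p q r"
proof -
  have ne: "p \<noteq> q" "q \<noteq> r" "r \<noteq> p" using assms by (auto simp: linked_def)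
  obtain s t u where stu: "side A T D p q s" "side A T D q r t" "side A T D r p u"
    using linked_side assms by metis
  then obtain g1 g2 g3 where tri: "strip_triangle A p q r s t u g1 g2 g3" using strip_triangle_exists ne by blast
  interpret strip_triangle A p q r s t u g1 g2 g3 by (rule tri)
  have "enclosed \<in> regions T D" unfolding regions_def
    by (rule enclosed_component) (use enclosed_region[OF stu tri] in auto)
  then have "triangle_corners A T D enclosed p q r"
    unfolding triangle_corners_def using stu ne frontier_enclosed unfolding boundary_def by auto
  then show ?thesis by blast
qed

lemma triangle_corner_set:
  assumes "triangle_corners A T D R p q r"
  shows "{e \<in> strip_points A. disc_end e \<in> closure (to_disc ` R)} = {p, q, r}"
proof -
  obtain s t u g1 g2 g3 where tri: "strip_triangle A p q r s t u g1 g2 g3" "R = strip_triangle.enclosed g1 g2 g3"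
    using triangle_corners_enclosed[OF assms] by metis
  interpret strip_triangle A p q r s t u g1 g2 g3 by (rule tri)
  show ?thesis using corner_iff pts tri(2) by blast
qed

text \<open>The right-hand side depends only on the set of corners. Hence triangles whose corners
  are listed in different orders can be compared.\<close>

lemma triangle_frontier:
  assumes "triangle_corners A T D R p q r"
  shows "frontier R = \<Union> {closure s | s e f. e \<in> {p, q, r} \<and> f \<in> {p, q, r} \<and> side A T D e f s}"
proof -
  obtain s t u where stu: "side A T D p q s" "side A T D q r t" "side A T D r p u"
    "frontier R = closure s \<union> closure t \<union> closure u"
    using assms unfolding triangle_corners_def by auto
  have "s' = s \<or> s' = t \<or> s' = u" if "e \<in> {p, q, r}" "f \<in> {p, q, r}" "side A T D e f s'" for e f s'
  proof -
    have "e \<noteq> f" using side_linked[OF that(3)] by (simp add: linked_def)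
    with that(1,2) consider "e = p" "f = q" | "e = q" "f = p" | "e = q" "f = r" | "e = r" "f = q"
      | "e = r" "f = p" | "e = p" "f = r" by auto
    then show ?thesis
      using side_unique[OF that(3)] stu(1-3) stu(1-3)[THEN side_sym] by cases blast+
  qed
  then show ?thesis unfolding stu(4) using stu(1-3) by blast
qed

lemma triangle_unique:
  assumes "triangle_corners A T D R p q r" "triangle_corners A T D R' p' q' r'" "{p, q, r} = {p', q', r'}"
  shows "R = R'"
proof -
  obtain s t u g1 g2 g3 where stu: "side A T D p q s" "side A T D q r t" "side A T D r p u"
    and tri: "strip_triangle A p q r s t u g1 g2 g3" "R = strip_triangle.enclosed g1 g2 g3"
    using triangle_corners_enclosed[OF assms(1)] by metis
  interpret strip_triangle A p q r s t u g1 g2 g3 by (rule tri)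
  have "frontier R' = boundary"
    using triangle_frontier[OF assms(1)] triangle_frontier[OF assms(2)] assms(3) frontier_enclosed tri(2) by simp
  moreover have "R' \<in> components complement" using assms(2) by (simp add: triangle_corners_def regions_def)
  ultimately show ?thesis
    using component_eq_enclosed[of R' complement] enclosed_region[OF stu tri(1)] tri(2) by auto
qed

lemma triangle_corners_rotate: "triangle_corners A T D R p q r \<Longrightarrow> triangle_corners A T D R q r p"
  unfolding triangle_corners_def by (auto simp: Un_ac)

text \<open>It moves the count from the regions of a drawing to triples of linked ends, with one map
  for all \<open>k\<close>. A triple has only one region by \<open>triangle_unique\<close>, and a
  region only one triple because its corners can be read off its closure in the disc.\<close>

theorem incident_triangles_bij:
  obtains \<beta> where "inj_on \<beta> (inner_triangles (linked A T) (strip_points A))"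
    "\<And>k. incident_triangles A T D k = \<beta> ` triangles_at (linked A T) (strip_points A) (Point (lower_vertex k))"
proof -
  let ?I = "inner_triangles (linked A T) (strip_points A)"
  define rel where "rel \<tau> R \<longleftrightarrow> (\<exists>p q r. \<tau> = {p, q, r} \<and> triangle_corners A T D R p q r)" for \<tau> R
  define \<beta> where "\<beta> \<tau> = (SOME R. rel \<tau> R)" for \<tau>
  have ex: "\<exists>R. rel \<tau> R" if "\<tau> \<in> ?I" for \<tau>
  proof -
    have c: "card \<tau> = 3" "\<forall>p\<in>\<tau>. \<forall>q\<in>\<tau>. p \<noteq> q \<longrightarrow> linked A T p q" using that by (auto simp: inner_triangles_def)
    then obtain p q r where "\<tau> = {p, q, r}" "p \<noteq> q" "q \<noteq> r" "p \<noteq> r" by (auto simp: card_3_iff)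
    then show ?thesis using triangle_exists[of p q r] c(2) unfolding rel_def by (metis insertCI)
  qed
  have uniq: "R = R'" if "rel \<tau> R" "rel \<tau> R'" for \<tau> R R'
    using that triangle_unique unfolding rel_def by metis
  have inj: "\<tau> = \<tau>'" if "rel \<tau> R" "rel \<tau>' R" for \<tau> \<tau>' R
    using that triangle_corner_set unfolding rel_def by metis
  have inI: "\<tau> \<in> ?I" if R: "rel \<tau> R" for \<tau> R
  proof -
    obtain p q r where \<tau>: "\<tau> = {p, q, r}" "triangle_corners A T D R p q r"
      using R unfolding rel_def by blast
    then have L: "linked A T p q" "linked A T q r" "linked A T r p"
      unfolding triangle_corners_def using side_linked by blast+
    then have "p \<noteq> q" "q \<noteq> r" "r \<noteq> p" "p \<in> strip_points A" "q \<in> strip_points A" "r \<in> strip_points A"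
      by (auto simp: linked_def)
    then show ?thesis using L linked_sym unfolding \<tau>(1) by (auto simp: inner_triangles_def)
  qed
  have \<beta>: "rel \<tau> (\<beta> \<tau>)" if "\<tau> \<in> ?I" for \<tau> unfolding \<beta>_def using someI_ex[OF ex[OF that]] .
  show ?thesis
  proof
    show "inj_on \<beta> ?I"
      using \<beta> inj by (metis inj_onI)
    fix k
    let ?v = "Point (lower_vertex k)"
    show "incident_triangles A T D k = \<beta> ` triangles_at (linked A T) (strip_points A) ?v"
    proof (intro equalityI subsetI)
      fix R assume "R \<in> incident_triangles A T D k"
      then obtain q r where "triangle_corners A T D R ?v q r" by (auto simp: incident_triangles_def)
      then have r: "rel {?v, q, r} R" by (auto simp: rel_def)
      then have "{?v, q, r} \<in> triangles_at (linked A T) (strip_points A) ?v" using inI by (auto simp: triangles_at_def)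
      moreover have "R = \<beta> {?v, q, r}" using uniq r \<beta> inI by blast
      ultimately show "R \<in> \<beta> ` triangles_at (linked A T) (strip_points A) ?v" by blast
    next
      fix R assume "R \<in> \<beta> ` triangles_at (linked A T) (strip_points A) ?v"
      then obtain \<tau> where "\<tau> \<in> ?I" "?v \<in> \<tau>" "R = \<beta> \<tau>" by (auto simp: triangles_at_def)
      then obtain p q r where "?v \<in> {p, q, r}" "triangle_corners A T D R p q r"
        using \<beta> unfolding rel_def by metis
      then show "R \<in> incident_triangles A T D k"
        using triangle_corners_rotate unfolding incident_triangles_def by blast
    qed
  qed
qed

end

section \<open>The links of a triangulation\<close>

declare position.simps(1) [simp del]

lemma position_lower:
  "position N (Point (lower_vertex k)) = 1 / (kappa N - exp (pi * of_int k))"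
  "N < k \<Longrightarrow> kappa N < exp (pi * of_int k)" "k \<le> N \<Longrightarrow> exp (pi * of_int k) < kappa N"
proof -
  show "position N (Point (lower_vertex k)) = 1 / (kappa N - exp (pi * of_int k))"
    by (simp add: lower_vertex_def position.simps(1))
  show "kappa N < exp (pi * of_int k)" if "N < k"
  proof -
    have "of_int N + 1 / 2 < real_of_int k" using that by linarith
    then show ?thesis by (simp add: kappa_def)
  qed
  show "exp (pi * of_int k) < kappa N" if "k \<le> N"
  proof -
    have "real_of_int k < of_int N + 1 / 2" using that by linarith
    then show ?thesis by (simp add: kappa_def)
  qed
qed

text \<open>The restriction keeps the cut point \<open>N + 1/2\<close> from lying between the two
  vertices. From left to right the line carries the lower vertices beyond \<open>N\<close>, then
  \<open>PosLimit\<close> at 0, the upper vertices in reversed order, \<open>NegLimit\<close> at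
  \<open>1 / kappa N\<close>, and the lower vertices up to \<open>N\<close>.\<close>

lemma position_lower_less:
  assumes "k < l" "N < k \<or> l \<le> N"
  shows "position N (Point (lower_vertex k)) < position N (Point (lower_vertex l))"
proof -
  let ?x = "exp (pi * real_of_int k)" and ?y = "exp (pi * real_of_int l)"
  have xy: "?x < ?y" using assms(1) by simp
  consider "kappa N < ?x" | "?y < kappa N" using assms(2) position_lower(2,3) by blast
  then show ?thesis
  proof cases
    case 1
    then have "1 / (?y - kappa N) < 1 / (?x - kappa N)"
      using xy by (intro divide_strict_left_mono mult_pos_pos; linarith)
    then have "- (1 / (?x - kappa N)) < - (1 / (?y - kappa N))" by simp
    moreover have "- (1 / (?x - kappa N)) = 1 / (kappa N - ?x)" "- (1 / (?y - kappa N)) = 1 / (kappa N - ?y)"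
      by (metis minus_diff_eq minus_divide_right)+
    ultimately show ?thesis unfolding position_lower(1) by simp
  next
    case 2
    then show ?thesis
      unfolding position_lower(1) using xy by (intro divide_strict_left_mono mult_pos_pos; linarith)
  qed
qed

lemma position_lower_right: "N < k \<Longrightarrow> position N (Point (lower_vertex k)) < 0"
  using position_lower(2)[of N k] unfolding position_lower(1) by (simp add: divide_less_0_iff)

lemma position_lower_left: "k \<le> N \<Longrightarrow> 1 / kappa N < position N (Point (lower_vertex k))"
  using position_lower(3)[of k N] unfolding position_lower(1) by (intro divide_strict_left_mono) auto

lemma position_upper:
  "position N (Point (Complex x 1)) = 1 / (kappa N + exp (pi * x))"
  "0 < position N (Point (Complex x 1))" "position N (Point (Complex x 1)) < 1 / kappa N"
  "position N (Point (Complex x 1)) < position N (Point (Complex y 1)) \<longleftrightarrow> y < x"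
proof -
  show e: "position N (Point (Complex x 1)) = 1 / (kappa N + exp (pi * x))" for x by (simp add: position.simps(1))
  have pos: "0 < kappa N + exp (pi * x)" for x by (simp add: add_pos_pos)
  show "0 < position N (Point (Complex x 1))" unfolding e using pos by simp
  show "position N (Point (Complex x 1)) < 1 / kappa N"
    unfolding e using pos[of x] by (intro divide_strict_left_mono) (auto intro: mult_pos_pos)
  have "position N (Point (Complex x 1)) < position N (Point (Complex y 1)) \<longleftrightarrow>
      kappa N + exp (pi * y) < kappa N + exp (pi * x)"
    unfolding e using pos[of x] pos[of y] by (simp add: divide_less_eq less_divide_eq field_simps)
  then show "position N (Point (Complex x 1)) < position N (Point (Complex y 1)) \<longleftrightarrow> y < x" by simp
qed

lemma strip_points_cases:
  assumes "e \<in> strip_points A"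
  obtains (lower) k where "e = Point (lower_vertex k)" | (upper) x where "e = Point (Complex x 1)" "x \<in> A"
    | (pos) "e = PosLimit" | (neg) "e = NegLimit"
  using assms unfolding strip_points_def vertices_def lower_vertices_def upper_vertices_def by blast

lemma position_negative:
  assumes "e \<in> strip_points A" "position N e < 0"
  obtains k where "N < k" "e = Point (lower_vertex k)"
  using assms(1)
proof (cases rule: strip_points_cases)
  case (lower k)
  have "0 < 1 / kappa N" by simp
  then have "\<not> 1 / kappa N < position N e" using assms(2) by linarith
  then have "\<not> k \<le> N" using position_lower_left[of k N] lower by blast
  then show ?thesis using that[of k] lower by simp
next
  case (upper x)
  have "0 < position N e" unfolding upper(1) by (rule position_upper(2))
  then show ?thesis using assms(2) by linarith
next
  case neg
  have "0 < position N e" unfolding neg by simp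
  then show ?thesis using assms(2) by linarith
qed (use assms(2) in simp)

lemma position_large:
  assumes "e \<in> strip_points A" "1 / kappa N < position N e"
  obtains k where "k \<le> N" "e = Point (lower_vertex k)"
  using assms(1)
proof (cases rule: strip_points_cases)
  case (lower k)
  have "0 < 1 / kappa N" by simp
  then have "\<not> position N e < 0" using assms(2) by linarith
  then have "\<not> N < k" using position_lower_right[of N k] lower by blast
  then show ?thesis using that[of k] lower by simp
next
  case (upper x)
  have "position N e < 1 / kappa N" unfolding upper(1) by (rule position_upper(3))
  then show ?thesis using assms(2) by linarith
next
  case pos
  have "0 < 1 / kappa N" by simp
  moreover have "position N e = 0" by (simp add: pos)
  ultimately show ?thesis using assms(2) by linarith
qed (use assms(2) in simp)

text \<open>Negative positions belong only to lower vertices right of the cut point, and positions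
  above \<open>1 / kappa N\<close> only to those left of it. So nothing else can slip in
  between.\<close>

lemma position_lower_between:
  assumes "e \<in> strip_points A" "N < k \<or> l \<le> N"
    and "position N (Point (lower_vertex k)) < position N e" "position N e < position N (Point (lower_vertex l))"
    and "k < l"
  obtains m where "k < m" "m < l" "e = Point (lower_vertex m)"
  using assms(2)
proof
  assume N: "N < k"
  then have "position N e < 0" using position_lower_right[of N l] assms(4,5) by linarith
  then obtain m where m: "N < m" "e = Point (lower_vertex m)" using position_negative[OF assms(1)] by blast
  have "k < m" using position_lower_less[of m k N] m assms(3) by (cases m k rule: linorder_cases) auto
  moreover have "m < l" using position_lower_less[of l m N] m assms(4,5) N by (cases m l rule: linorder_cases) auto
  ultimately show ?thesis using that m by blast
next
  assume N: "l \<le> N"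
  then have "1 / kappa N < position N e" using position_lower_left[of k N] assms(3,5) by linarith
  then obtain m where m: "m \<le> N" "e = Point (lower_vertex m)" using position_large[OF assms(1)] by blast
  have "k < m" using position_lower_less[of m k N] m assms(3,5) N by (cases m k rule: linorder_cases) auto
  moreover have "m < l" using position_lower_less[of l m N] m assms(4) by (cases m l rule: linorder_cases) auto
  ultimately show ?thesis using that m by blast
qed

lemma lower_between_in_segment:
  assumes "i < k" "k < j"
  shows "lower_vertex k \<in> open_segment (lower_vertex i) (lower_vertex j)"
proof -
  have "open_segment (lower_vertex i) (lower_vertex j)
      = {z. Im z = 0 \<and> real_of_int i < Re z \<and> Re z < real_of_int j}"
    using assms unfolding lower_vertex_def by (intro open_segment_horizontal) simp
  then show ?thesis using assms by (simp add: lower_vertex_def)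
qed

lemma neighbouring_lower:
  assumes "neighbouring A (lower_vertex i) w"
  shows "w = lower_vertex (i + 1) \<or> w = lower_vertex (i - 1)"
proof -
  have w: "w \<in> vertices A" "Im w = 0" "w \<noteq> lower_vertex i"
    and s: "open_segment (lower_vertex i) w \<inter> vertices A = {}"
    using assms by (auto simp: neighbouring_def lower_vertex_def)
  then obtain j where j: "w = lower_vertex j"
    by (auto simp: vertices_def lower_vertices_def upper_vertices_def)
  have V: "lower_vertex k \<in> vertices A" for k by (auto simp: vertices_def lower_vertices_def)
  have "\<not> i + 1 < j" using lower_between_in_segment[of i "i + 1" j] s V j by auto
  moreover have "\<not> j < i - 1"
    using lower_between_in_segment[of j "i - 1" i] s V[of "i - 1"] j by (auto simp: open_segment_commute)
  moreover have "j \<noteq> i" using w j by auto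
  ultimately have "j = i + 1 \<or> j = i - 1" by linarith
  then show ?thesis using j by auto
qed

lemma lower_vertex_in_strip_points: "Point (lower_vertex k) \<in> strip_points A"
  by (auto simp: strip_points_def vertices_def lower_vertices_def)

lemma linked_lower: "linked A T (Point (lower_vertex k)) (Point (lower_vertex (k + 1)))"
proof -
  have "open_segment (lower_vertex k) (lower_vertex (k + 1)) \<inter> vertices A = {}"
  proof -
    have o: "open_segment (lower_vertex k) (lower_vertex (k + 1))
        = {z. Im z = 0 \<and> real_of_int k < Re z \<and> Re z < real_of_int (k + 1)}"
      unfolding lower_vertex_def by (intro open_segment_horizontal) simp
    show ?thesis unfolding o by (auto simp: vertices_def lower_vertices_def upper_vertices_def lower_vertex_def)
  qed
  then have "neighbouring A (lower_vertex k) (lower_vertex (k + 1))"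
    by (auto simp: neighbouring_def vertices_def lower_vertices_def) (auto simp: lower_vertex_def)
  then show ?thesis using adjacentD[of A] unfolding linked_def adjacent_def by blast
qed

text \<open>The second alternative is needed for the segment through the cut point: its ends
  \<open>N + 1\<close> and \<open>N\<close> are the first and the last point of the line. In neither
  case can another pair of ends be interlaced with those of the segment.\<close>

lemma adjacent_gap:
  assumes "adjacent A p q" "position N p < position N q"
  shows "(\<forall>e\<in>strip_points A. \<not> (position N p < position N e \<and> position N e < position N q)) \<or>
    (\<forall>e\<in>strip_points A. position N p \<le> position N e \<and> position N e \<le> position N q)"
proof -
  obtain v w where vw: "neighbouring A v w" "p = Point v" "q = Point w"
    using assms(1) by (auto simp: adjacent_def)
  have V: "v \<in> vertices A" "w \<in> vertices A" "Im v = Im w" "open_segment v w \<inter> vertices A = {}"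
    using vw(1) by (auto simp: neighbouring_def)
  show ?thesis
  proof (cases "Im v = 0")
    case True
    then obtain i where i: "v = lower_vertex i"
      using V(1) by (auto simp: vertices_def lower_vertices_def upper_vertices_def)
    have "w = lower_vertex (i + 1) \<or> w = lower_vertex (i - 1)"
      using neighbouring_lower[of A i w] vw(1) i by simp
    then show ?thesis
    proof
      assume w: "w = lower_vertex (i + 1)"
      have "i \<noteq> N"
      proof
        assume "i = N"
        then have "position N q < 0" "1 / kappa N < position N p"
          unfolding vw(2,3) i w by (auto intro: position_lower_right position_lower_left)
        moreover have "0 < 1 / kappa N" by simp
        ultimately show False using assms(2) by linarith
      qed
      then have N: "N < i \<or> i + 1 \<le> N" by presburger
      have "\<not> (position N p < position N e \<and> position N e < position N q)" if e: "e \<in> strip_points A" for e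
      proof
        assume pq: "position N p < position N e \<and> position N e < position N q"
        have "\<exists>m. i < m \<and> m < i + 1"
          by (rule position_lower_between[OF e N]) (use pq vw(2,3) i w in auto)
        then show False by linarith
      qed
      then show ?thesis by blast
    next
      assume w: "w = lower_vertex (i - 1)"
      have iN: "i = N + 1"
      proof (rule ccontr)
        assume "i \<noteq> N + 1"
        then have "N < i - 1 \<or> i \<le> N" by linarith
        then have "position N q < position N p" using position_lower_less[of "i - 1" i N] vw i w by simp
        then show False using assms(2) by simp
      qed
      have "position N p \<le> position N e" if e: "e \<in> strip_points A" for e
      proof (cases "position N e < 0")
        case True
        then obtain k where "N < k" "e = Point (lower_vertex k)" using position_negative[OF e] by blast
        then show ?thesis using position_lower_less[of i k N] vw i iN by (cases "k = i") auto
      next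
        case False
        then show ?thesis using position_lower_right[of N i] vw i iN by simp
      qed
      moreover have "position N e \<le> position N q" if e: "e \<in> strip_points A" for e
      proof (cases "1 / kappa N < position N e")
        case True
        then obtain k where "k \<le> N" "e = Point (lower_vertex k)" using position_large[OF e] by blast
        then show ?thesis using position_lower_less[of k N N] vw w iN by (cases "k = N") auto
      next
        case False
        then show ?thesis using position_lower_left[of N N] vw w iN by simp
      qed
      ultimately show ?thesis by blast
    qed
  next
    case False
    then have Im: "Im v = 1" "Im w = 1" using vertices_Im(1)[OF V(1)] V(3) by auto
    define x y where "x = Re v" and "y = Re w"
    have v: "v = Complex x 1" and w: "w = Complex y 1" using Im by (auto simp: x_def y_def complex_eq_iff)
    have yx: "y < x" using assms(2) position_upper(4) vw v w by simp
    have o: "open_segment v w = {z. Im z = 1 \<and> y < Re z \<and> Re z < x}"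
      unfolding v w using open_segment_horizontal[OF yx] by (simp add: open_segment_commute)
    have "False" if e: "e \<in> strip_points A" "position N p < position N e" "position N e < position N q" for e
      using e(1)
    proof (cases rule: strip_points_cases)
      case (lower k)
      then show False
        using e position_upper(2)[of N x] position_upper(3)[of N y] position_lower_right[of N k] position_lower_left[of k N] vw v w
        by (cases "k \<le> N") force+
    next
      case (upper z)
      then have "z < x" "y < z" using e position_upper(4) vw v w by auto
      then have "Complex z 1 \<in> open_segment v w" unfolding o by simp
      moreover have "Complex z 1 \<in> vertices A" using upper(2) by (auto simp: vertices_def upper_vertices_def)
      ultimately show False using V(4) by blast
    next
      case pos
      then show False using e position_upper(2)[of N x] vw v by simp
    next
      case neg
      then show False using e position_upper(3)[of N y] vw w by simp
    qed
    then show ?thesis by blast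
  qed
qed

section \<open>Noncrossing and maximality of the links\<close>

context
  fixes A :: "real set" and T :: "strip_arc set"
  assumes tri: "strip_triangulation A T"
begin

lemma T_arcs: "T \<subseteq> strip_arcs A"
  using tri by (simp add: strip_triangulation_def)

lemma ends_class_nonempty: "p \<in> strip_points A \<Longrightarrow> q \<in> strip_points A \<Longrightarrow> p \<noteq> q \<Longrightarrow> ends_class p q \<noteq> {}"
  using exists_simple_curve unfolding ends_class_def by blast

lemma ends_class_inject:
  assumes "p \<in> strip_points A" "q \<in> strip_points A" "p \<noteq> q" "ends_class p q = ends_class r s"
  shows "{p, q} = {r, s}"
proof -
  obtain c where "c \<in> ends_class p q" using ends_class_nonempty assms by blast
  then show ?thesis using ends_class_eq_iff assms(4) by blast
qed

lemma ends_class_oriented: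
  assumes "c \<in> ends_class p q"
  obtains c' where "simple_curve p q c'" "curve_trace c' = curve_trace c"
  using assms simple_curve_flip curve_trace_flip unfolding ends_class_def by blast

lemma linked_noncrossing:
  assumes "linked A T p q" "linked A T r s"
    and lt: "position N p < position N r" "position N r < position N q" "position N q < position N s"
  shows False
proof -
  have E: "p \<in> strip_points A" "q \<in> strip_points A" "r \<in> strip_points A" "s \<in> strip_points A" "p \<noteq> q" "r \<noteq> s"
    using assms(1,2) by (auto simp: linked_def)
  have "\<not> adjacent A p q"
  proof
    assume "adjacent A p q"
    from adjacent_gap[OF this, of N] show False using lt E(3,4) by force
  qed
  moreover have "\<not> adjacent A r s"
  proof
    assume "adjacent A r s"
    from adjacent_gap[OF this, of N] show False using lt E(1,2) by force
  qed
  ultimately have T: "ends_class p q \<in> T" "ends_class r s \<in> T" using assms(1,2) by (auto simp: linked_def)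
  moreover have "ends_class p q \<noteq> ends_class r s"
    using ends_class_inject[OF E(1,2,5), of r s] lt by (auto simp: doubleton_eq_iff)
  ultimately have "compatible (ends_class p q) (ends_class r s)"
    using tri by (auto simp: strip_triangulation_def pairwise_def)
  then obtain c d where "c \<in> ends_class p q" "d \<in> ends_class r s" "curve_trace c \<inter> curve_trace d = {}"
    by (auto simp: compatible_def)
  moreover obtain c' where "simple_curve p q c'" "curve_trace c' = curve_trace c"
    using ends_class_oriented calculation(1) by blast
  moreover obtain d' where "simple_curve r s d'" "curve_trace d' = curve_trace d"
    using ends_class_oriented calculation(2) by blast
  ultimately show False using interlaced_curves_meet[OF _ _ E(1-4) lt] by blast
qed

lemma arc_ordered:
  assumes "\<alpha> \<in> T"
  obtains p q where "\<alpha> = ends_class p q" "linked A T p q" "position N p < position N q"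
proof -
  obtain p q where pq: "\<alpha> = ends_class p q" "p \<in> strip_points A" "q \<in> strip_points A" "p \<noteq> q"
    using T_arcs assms unfolding strip_arcs_eq by blast
  then have l: "linked A T p q" using assms by (simp add: linked_def)
  have "position N p \<noteq> position N q" using inj_onD[OF inj_on_position] pq by blast
  then consider "position N p < position N q" | "position N q < position N p" by linarith
  then show ?thesis
  proof cases
    case 1 then show ?thesis using that pq l by blast
  next
    case 2 then show ?thesis using that[of q p] pq(1) linked_sym[OF l] ends_class_commute by simp
  qed
qed

lemma geodesic_in_class:
  "p \<in> strip_points A \<Longrightarrow> q \<in> strip_points A \<Longrightarrow> position N p < position N q \<Longrightarrow> geodesic N p q \<in> ends_class p q"
  using simple_curve_geodesic by (simp add: ends_class_def)

text \<open>Compatibility is a condition on pairs, and the representative of an arc may change with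
  the partner; a drawing needs one representative for all partners. Geodesics for a common cut point
  provide it, as their disjointness depends on the ends alone.\<close>

lemma drawing_exists: "\<exists>D. drawing T D"
proof -
  have "\<forall>\<alpha>. \<exists>p q. \<alpha> \<in> T \<longrightarrow> \<alpha> = ends_class p q \<and> linked A T p q \<and> position 0 p < position 0 q"
    using arc_ordered[where N = 0] by metis
  then obtain P Q where PQ: "\<And>\<alpha>. \<alpha> \<in> T \<Longrightarrow> \<alpha> = ends_class (P \<alpha>) (Q \<alpha>)"
    "\<And>\<alpha>. \<alpha> \<in> T \<Longrightarrow> linked A T (P \<alpha>) (Q \<alpha>)" "\<And>\<alpha>. \<alpha> \<in> T \<Longrightarrow> position 0 (P \<alpha>) < position 0 (Q \<alpha>)"
    by metis
  define D where "D \<alpha> = geodesic 0 (P \<alpha>) (Q \<alpha>)" for \<alpha>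
  have "D \<alpha> \<in> \<alpha>" if "\<alpha> \<in> T" for \<alpha>
    using geodesic_in_class[of "P \<alpha>" "Q \<alpha>" 0] PQ[OF that] unfolding D_def linked_def by metis
  moreover have "curve_trace (D \<alpha>) \<inter> curve_trace (D \<beta>) = {}" if "\<alpha> \<in> T" "\<beta> \<in> T" "\<alpha> \<noteq> \<beta>" for \<alpha> \<beta>
  proof -
    have "(P \<alpha>, Q \<alpha>) \<noteq> (P \<beta>, Q \<beta>)" using PQ(1)[OF that(1)] PQ(1)[OF that(2)] that(3) by auto
    then show ?thesis unfolding D_def
      using linked_noncrossing[OF PQ(2)[OF that(1)] PQ(2)[OF that(2)], of 0]
        linked_noncrossing[OF PQ(2)[OF that(2)] PQ(2)[OF that(1)], of 0]
        PQ(2)[OF that(1)] PQ(2)[OF that(2)] PQ(3)[OF that(1)] PQ(3)[OF that(2)]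
      by (intro geodesics_disjoint[where A = A]) (auto simp: linked_def)
  qed
  ultimately show ?thesis unfolding drawing_def pairwise_def by blast
qed

text \<open>The geodesic of an uncrossed pair avoids the geodesics of all other arcs in
  \<open>T\<close>. So its class can be added to \<open>T\<close>, and by maximality it was already
  there.\<close>

lemma linked_maximal:
  assumes E: "p \<in> strip_points A" "q \<in> strip_points A" and lt: "position N p < position N q"
    and nc: "\<And>r s. linked A T r s \<Longrightarrow> position N p < position N r \<Longrightarrow> position N r < position N q \<Longrightarrow>
      position N p \<le> position N s \<and> position N s \<le> position N q"
  shows "linked A T p q"
proof (cases "adjacent A p q")
  case True
  then show ?thesis using E lt by (auto simp: linked_def)
next
  case False
  let ?\<alpha> = "ends_class p q"
  have ne: "p \<noteq> q" using lt by auto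
  have comp: "compatible ?\<alpha> \<beta> \<and> compatible \<beta> ?\<alpha>" if \<beta>: "\<beta> \<in> T" "\<beta> \<noteq> ?\<alpha>" for \<beta>
  proof -
    obtain r s where rs: "\<beta> = ends_class r s" "linked A T r s" "position N r < position N s"
      using arc_ordered[OF \<beta>(1)] by blast
    then have E': "r \<in> strip_points A" "s \<in> strip_points A" by (auto simp: linked_def)
    have "curve_trace (geodesic N p q) \<inter> curve_trace (geodesic N r s) = {}"
    proof (rule geodesics_disjoint[OF E E' lt rs(3)])
      show "(p, q) \<noteq> (r, s)" using \<beta>(2) rs(1) by auto
      show "\<not> (position N p < position N r \<and> position N r < position N q \<and> position N q < position N s)"
        using nc[OF rs(2)] by auto
      show "\<not> (position N r < position N p \<and> position N p < position N s \<and> position N s < position N q)"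
        using nc[OF linked_sym[OF rs(2)]] by auto
    qed
    then show ?thesis unfolding compatible_def rs(1)
      using geodesic_in_class[OF E lt] geodesic_in_class[OF E' rs(3)] by blast
  qed
  have "insert ?\<alpha> T \<subseteq> strip_arcs A" using T_arcs E ne False unfolding strip_arcs_eq by blast
  moreover have "pairwise compatible (insert ?\<alpha> T)"
    using comp tri unfolding strip_triangulation_def pairwise_insert by blast
  ultimately have "insert ?\<alpha> T = T" using tri unfolding strip_triangulation_def by blast
  then show ?thesis using E ne by (auto simp: linked_def)
qed

lemma finite_linked:
  assumes "admissible T"
  shows "finite {x. linked A T (Point (lower_vertex k)) x}"
proof -
  let ?v = "Point (lower_vertex k)"
  have fin: "finite {\<alpha> \<in> T. arc_incident \<alpha> ?v}" using assms by (simp add: admissible_def)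
  let ?X = "{x. linked A T ?v x \<and> ends_class ?v x \<in> T}"
  have "inj_on (ends_class ?v) ?X"
  proof (rule inj_onI)
    fix x y assume "x \<in> ?X" "y \<in> ?X" "ends_class ?v x = ends_class ?v y"
    then have "{?v, x} = {?v, y}" using ends_class_inject[of ?v x ?v y] by (auto simp: linked_def)
    then show "x = y" by (auto simp: doubleton_eq_iff)
  qed
  moreover have "ends_class ?v ` ?X \<subseteq> {\<alpha> \<in> T. arc_incident \<alpha> ?v}"
  proof
    fix \<alpha> assume "\<alpha> \<in> ends_class ?v ` ?X"
    then obtain x where x: "\<alpha> = ends_class ?v x" "linked A T ?v x" "\<alpha> \<in> T" by auto
    then obtain c where c: "simple_curve ?v x c" using exists_simple_curve unfolding linked_def by blast
    then have "c \<in> \<alpha>" using x by (simp add: ends_class_def)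
    then show "\<alpha> \<in> {\<alpha> \<in> T. arc_incident \<alpha> ?v}" using c x(3) unfolding arc_incident_def by blast
  qed
  ultimately have "finite ?X" using fin finite_subset finite_imageD by blast
  moreover have "{x. linked A T ?v x} \<subseteq> ?X \<union> {Point (lower_vertex (k + 1)), Point (lower_vertex (k - 1))}"
    using neighbouring_lower by (fastforce simp: linked_def adjacent_def)
  ultimately show ?thesis by (auto intro: finite_subset)
qed

end

section \<open>Transport along injections\<close>

lemma sdrs_image:
  assumes "inj_on h (\<Union> (set Ss))"
  shows "sdrs (map ((`) h) Ss) = map h ` sdrs Ss"
  using assms
proof (induction Ss)
  case (Cons S Ss)
  then have IH: "sdrs (map ((`) h) Ss) = map h ` sdrs Ss" by (auto intro: inj_on_subset)
  have *: "h x \<notin> h ` set xs \<longleftrightarrow> x \<notin> set xs" if "x \<in> S" "xs \<in> sdrs Ss" for x xs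
    using inj_on_image_mem_iff[OF Cons.prems, of x "set xs"] set_sdr_subset[OF that(2)] that(1) by auto
  show ?case
  proof (intro equalityI subsetI)
    fix ys assume "ys \<in> sdrs (map ((`) h) (S # Ss))"
    then obtain x xs where "ys = h x # map h xs" "x \<in> S" "xs \<in> sdrs Ss" "h x \<notin> set (map h xs)"
      by (auto simp: sdrs_Cons IH)
    then show "ys \<in> map h ` sdrs (S # Ss)"
      using * by (intro image_eqI[of _ _ "x # xs"]) (auto simp: sdrs_Cons)
  next
    fix ys assume "ys \<in> map h ` sdrs (S # Ss)"
    then obtain x xs where "ys = h x # map h xs" "x \<in> S" "xs \<in> sdrs Ss" "x \<notin> set xs"
      by (auto simp: sdrs_Cons)
    then show "ys \<in> sdrs (map ((`) h) (S # Ss))"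
      using *[of x xs] by (simp add: sdrs_Cons IH)
  qed
qed simp

lemma card_sdrs_image:
  assumes "inj_on h (\<Union> (set Ss))"
  shows "card (sdrs (map ((`) h) Ss)) = card (sdrs Ss)"
proof -
  have "inj_on (map h) (sdrs Ss)"
  proof (rule inj_onI)
    fix xs ys assume "xs \<in> sdrs Ss" "ys \<in> sdrs Ss" "map h xs = map h ys"
    moreover from this have "inj_on h (set xs \<union> set ys)"
      using set_sdr_subset by (metis assms inj_on_subset Un_least)
    ultimately show "xs = ys" by (simp add: inj_on_map_eq_map)
  qed
  then show ?thesis unfolding sdrs_image[OF assms] by (rule card_image)
qed

lemma card_matchings: "card (matchings A T D i j) = card (sdrs (map (incident_triangles A T D) [i..j]))"
proof (rule bij_betw_same_card)
  let ?I = "incident_triangles A T D"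
  show "bij_betw (\<lambda>f. map f [i..j]) (matchings A T D i j) (sdrs (map ?I [i..j]))"
  proof (rule bij_betwI')
    fix f g assume fg: "f \<in> matchings A T D i j" "g \<in> matchings A T D i j"
    show "map f [i..j] = map g [i..j] \<longleftrightarrow> f = g"
    proof
      assume "map f [i..j] = map g [i..j]"
      then have eq: "f k = g k" if "k \<in> {i..j}" for k using that by simp
      have "f \<in> (\<Pi>\<^sub>E k\<in>{i..j}. ?I k)" "g \<in> (\<Pi>\<^sub>E k\<in>{i..j}. ?I k)"
        using fg by (simp_all add: matchings_def)
      then show "f = g" using eq by (rule PiE_ext)
    qed simp
  next
    fix f assume f: "f \<in> matchings A T D i j"
    then have "\<And>k. k \<in> {i..j} \<Longrightarrow> f k \<in> ?I k" "inj_on f {i..j}"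
      unfolding matchings_def by (auto dest: PiE_mem)
    then show "map f [i..j] \<in> sdrs (map ?I [i..j])"
      unfolding sdrs_def list_all2_map1 list_all2_map2 list_all2_same distinct_map mem_Collect_eq
      by simp
  next
    fix xs assume xs: "xs \<in> sdrs (map ?I [i..j])"
    then have len: "length xs = length [i..j]" and all: "list_all2 (\<lambda>x k. x \<in> ?I k) xs [i..j]" and d: "distinct xs"
      by (auto simp: sdrs_def list_all2_map2 dest: list_all2_lengthD)
    define f where "f = (\<lambda>k\<in>{i..j}. xs ! nat (k - i))"
    have nth: "f k = xs ! nat (k - i)" if "i \<le> k" "k \<le> j" for k using that by (simp add: f_def)
    have m: "map f [i..j] = xs"
      using len by (intro nth_equalityI) (auto simp: nth)
    have "f \<in> (\<Pi>\<^sub>E k\<in>{i..j}. ?I k)"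
    proof (rule PiE_I)
      fix k assume k: "k \<in> {i..j}"
      then have "nat (k - i) < length xs" "[i..j] ! nat (k - i) = k" using len by auto
      then show "f k \<in> ?I k" using list_all2_nthD[OF all, of "nat (k - i)"] nth k by simp
    qed (auto simp: f_def)
    moreover have "inj_on f {i..j}" using d m by (metis distinct_map set_upto)
    ultimately show "\<exists>f\<in>matchings A T D i j. xs = map f [i..j]"
      using m unfolding matchings_def by blast
  qed
qed

lemma inner_triangles_image:
  assumes "inj_on f S" "\<And>p q. p \<in> S \<Longrightarrow> q \<in> S \<Longrightarrow> L' (f p) (f q) \<longleftrightarrow> L p q"
  shows "inner_triangles L' (f ` S) = (`) f ` inner_triangles L S"
proof -
  have *: "f ` \<tau> \<in> inner_triangles L' (f ` S) \<longleftrightarrow> \<tau> \<in> inner_triangles L S" if "\<tau> \<subseteq> S" for \<tau>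
  proof -
    have "card (f ` \<tau>) = card \<tau>" by (rule card_image) (rule inj_on_subset[OF assms(1) that])
    moreover have "f p \<noteq> f q \<longleftrightarrow> p \<noteq> q" "L' (f p) (f q) \<longleftrightarrow> L p q" if "p \<in> \<tau>" "q \<in> \<tau>" for p q
      using that \<open>\<tau> \<subseteq> S\<close> inj_on_eq_iff[OF assms(1)] assms(2) by blast+
    ultimately show ?thesis
      unfolding inner_triangles_def mem_Collect_eq ball_simps using that by (metis (no_types, lifting) image_mono)
  qed
  show ?thesis
  proof (intro equalityI subsetI)
    fix \<sigma> assume \<sigma>: "\<sigma> \<in> inner_triangles L' (f ` S)"
    then have "\<sigma> \<subseteq> f ` S" by (auto simp: inner_triangles_def)
    then obtain \<tau> where "\<tau> \<subseteq> S" "\<sigma> = f ` \<tau>" by (auto simp: subset_image_iff)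
    then show "\<sigma> \<in> (`) f ` inner_triangles L S" using \<sigma> * by blast
  next
    fix \<sigma> assume "\<sigma> \<in> (`) f ` inner_triangles L S"
    then obtain \<tau> where "\<tau> \<in> inner_triangles L S" "\<sigma> = f ` \<tau>" by blast
    moreover from this have "\<tau> \<subseteq> S" by (auto simp: inner_triangles_def)
    ultimately show "\<sigma> \<in> inner_triangles L' (f ` S)" using * by blast
  qed
qed

lemma triangles_at_image:
  assumes "inj_on f S" "\<And>p q. p \<in> S \<Longrightarrow> q \<in> S \<Longrightarrow> L' (f p) (f q) \<longleftrightarrow> L p q" "v \<in> S"
  shows "triangles_at L' (f ` S) (f v) = (`) f ` triangles_at L S v"
proof -
  have mem: "f v \<in> f ` \<tau> \<longleftrightarrow> v \<in> \<tau>" if "\<tau> \<in> inner_triangles L S" for \<tau>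
    using that assms(3) inj_on_image_mem_iff[OF assms(1), of v \<tau>] by (auto simp: inner_triangles_def)
  have I: "inner_triangles L' (f ` S) = (`) f ` inner_triangles L S"
    by (rule inner_triangles_image[OF assms(1)]) (rule assms(2))
  show ?thesis
    unfolding triangles_at_def I
  proof (intro equalityI subsetI)
    fix \<sigma> assume "\<sigma> \<in> {\<sigma> \<in> (`) f ` inner_triangles L S. f v \<in> \<sigma>}"
    then obtain \<tau> where "\<tau> \<in> inner_triangles L S" "\<sigma> = f ` \<tau>" "f v \<in> f ` \<tau>" by auto
    then show "\<sigma> \<in> (`) f ` {\<tau> \<in> inner_triangles L S. v \<in> \<tau>}" using mem by blast
  next
    fix \<sigma> assume "\<sigma> \<in> (`) f ` {\<tau> \<in> inner_triangles L S. v \<in> \<tau>}"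
    then show "\<sigma> \<in> {\<sigma> \<in> (`) f ` inner_triangles L S. f v \<in> \<sigma>}" using mem by auto
  qed
qed

section \<open>Matchings in a triangulation\<close>

lemma noncrossing_links_position:
  assumes "strip_triangulation A T"
  shows "noncrossing_links (position N ` strip_points A)
    (\<lambda>a b. \<exists>p q. a = position N p \<and> b = position N q \<and> linked A T p q)"
proof
  have inj: "p = q" if "position N p = position N q" "p \<in> strip_points A" "q \<in> strip_points A" for p q
    using inj_onD[OF inj_on_position that(1)] that by blast
  have S: "p \<in> strip_points A" "q \<in> strip_points A" if "linked A T p q" for p q
    using that by (auto simp: linked_def)
  show "\<exists>p' q'. q = position N p' \<and> p = position N q' \<and> linked A T p' q'"
    if "\<exists>p' q'. p = position N p' \<and> q = position N q' \<and> linked A T p' q'" for p q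
    using that linked_sym by blast
  show "p \<in> position N ` strip_points A"
    if "\<exists>p' q'. p = position N p' \<and> q = position N q' \<and> linked A T p' q'" for p q
    using that S by blast
  show "\<not> (\<exists>p' q'. p = position N p' \<and> p = position N q' \<and> linked A T p' q')" for p
    using inj S by (metis linked_def)
  show False if "\<exists>p' q'. p = position N p' \<and> q = position N q' \<and> linked A T p' q'"
    "\<exists>p' q'. r = position N p' \<and> s = position N q' \<and> linked A T p' q'" "p < r" "r < q" "q < s" for p q r s
    using that linked_noncrossing[OF assms] by blast
  show "\<exists>p' q'. p = position N p' \<and> q = position N q' \<and> linked A T p' q'"
    if pE: "p \<in> position N ` strip_points A" "q \<in> position N ` strip_points A" and "p < q"
      and nc: "\<And>r s. \<exists>p' q'. r = position N p' \<and> s = position N q' \<and> linked A T p' q' \<Longrightarrow>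
        p < r \<Longrightarrow> r < q \<Longrightarrow> p \<le> s \<and> s \<le> q" for p q
  proof -
    obtain p' q' where pq: "p = position N p'" "q = position N q'" "p' \<in> strip_points A" "q' \<in> strip_points A"
      using pE by blast
    have "linked A T p' q'"
      using linked_maximal[OF assms pq(3,4), of N] nc \<open>p < q\<close> unfolding pq(1,2) by blast
    then show ?thesis using pq by blast
  qed
qed

lemma card_sdrs_incident:
  assumes tri: "strip_triangulation A T" and adm: "admissible T" and D: "drawing T D" and ij: "i \<le> j"
  shows "int (card (sdrs (map (incident_triangles A T D) [i..j])))
      = continuant (map (\<lambda>k. int (card (incident_triangles A T D k))) [i..j])"
    and "0 < int (card (sdrs (map (incident_triangles A T D) [i..j])))"
proof -
  \<comment> \<open>The cut point \<open>i - 3/2\<close> lies to the left of all vertices from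
    \<open>i - 1\<close> to \<open>j + 1\<close>, so their positions increase.\<close>
  define N where "N = i - 2"
  define pos where "pos = position N"
  define S where "S = strip_points A"
  define L where "L = (\<lambda>a b. \<exists>p q. a = pos p \<and> b = pos q \<and> linked A T p q)"
  define low where "low k = Point (lower_vertex k)" for k
  interpret noncrossing_links "pos ` S" L
    unfolding L_def pos_def S_def by (rule noncrossing_links_position[OF tri])
  interpret strip_drawing A T D by unfold_locales (use T_arcs[OF tri] D in auto)
  have inj: "inj_on pos S" unfolding pos_def S_def by (rule inj_on_position)
  have lowS: "low k \<in> S" for k unfolding low_def S_def by (rule lower_vertex_in_strip_points)
  have lS: "p \<in> S" "q \<in> S" if "linked A T p q" for p q using that by (auto simp: linked_def S_def)
  have Liff: "L (pos p) (pos q) \<longleftrightarrow> linked A T p q" if "p \<in> S" "q \<in> S" for p q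
    unfolding L_def using inj_onD[OF inj] lS that by metis
  \<comment> \<open>One more vertex on either side: the chain needs them as its ends, only the
    vertices of \<open>ws\<close> are matched.\<close>
  define vs where "vs = map (\<lambda>k. pos (low k)) [i - 1..j + 1]"
  define ws where "ws = map (\<lambda>k. pos (low k)) [i..j]"
  have vs: "vs = pos (low (i - 1)) # ws @ [pos (low (j + 1))]"
  proof -
    have "[i - 1..j + 1] = (i - 1) # [i..j + 1]" using ij by (simp add: upto_rec1)
    moreover have "[i..j + 1] = [i..j] @ [j + 1]" using ij upto_rec2[of i "j + 1"] by simp
    ultimately show ?thesis by (simp add: vs_def ws_def)
  qed
  have finL: "finite {x. L (pos (low k)) x}" for k
  proof (rule finite_subset)
    show "{x. L (pos (low k)) x} \<subseteq> pos ` {x. linked A T (low k) x}"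
    proof
      fix x assume "x \<in> {x. L (pos (low k)) x}"
      then obtain p q where pq: "pos (low k) = pos p" "x = pos q" "linked A T p q" by (auto simp: L_def)
      then have "p = low k" using inj_onD[OF inj pq(1)] lowS lS by auto
      then show "x \<in> pos ` {x. linked A T (low k) x}" using pq by blast
    qed
    show "finite (pos ` {x. linked A T (low k) x})"
      unfolding low_def using finite_linked[OF tri adm] by blast
  qed
  have ch: "link_chain vs"
    unfolding link_chain_def
  proof (intro conjI ballI)
    show "sorted_wrt (<) vs"
      unfolding vs_def sorted_wrt_map
    proof (rule sorted_wrt_mono_rel[OF _ sorted_wrt_upto])
      fix k l assume "k \<in> set [i - 1..j + 1]" "l \<in> set [i - 1..j + 1]" "k < l"
      then show "pos (low k) < pos (low l)"
        unfolding pos_def low_def by (intro position_lower_less) (auto simp: N_def)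
    qed
    show "successively L vs"
      unfolding vs_def successively_conv_nth
    proof (intro allI impI)
      fix n assume n: "Suc n < length (map (\<lambda>k. pos (low k)) [i - 1..j + 1])"
      have "linked A T (low (i - 1 + int n)) (low (i - 1 + int n + 1))"
        unfolding low_def by (rule linked_lower)
      then show "L (map (\<lambda>k. pos (low k)) [i - 1..j + 1] ! n) (map (\<lambda>k. pos (low k)) [i - 1..j + 1] ! Suc n)"
        using n Liff[OF lowS lowS] by (simp add: algebra_simps)
    qed
    fix v assume "v \<in> set vs"
    then show "v \<in> pos ` S" "finite {x. L v x}" using lowS finL by (auto simp: vs_def)
  qed
  \<comment> \<open>Consecutive lower vertices have no end between them, so this first chain cuts
    nothing off and its region is the whole strip.\<close>
  have E: "region_vertices vs = pos ` S"
  proof (intro equalityI subsetI)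
    fix x assume x: "x \<in> pos ` S"
    then obtain e where e: "e \<in> strip_points A" "x = position N e" by (auto simp: pos_def S_def)
    have "x \<in> set vs" if h: "pos (low (i - 1)) < x" "x < pos (low (j + 1))"
    proof -
      have "\<exists>m. i - 1 < m \<and> m < j + 1 \<and> e = low m"
        unfolding low_def
        by (rule position_lower_between[OF e(1), of N "i - 1" "j + 1"])
          (use h e ij in \<open>auto simp: pos_def low_def N_def\<close>)
      then show ?thesis using e(2) by (auto simp: vs_def pos_def)
    qed
    moreover have "hd vs = pos (low (i - 1))" "last vs = pos (low (j + 1))" unfolding vs by auto
    ultimately show "x \<in> region_vertices vs" using x unfolding region_vertices_def by force
  qed (auto simp: region_vertices_def)
  note main = sdrs_chain[OF ch[unfolded vs], folded vs, unfolded E]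
  obtain \<beta> where \<beta>: "inj_on \<beta> (inner_triangles (linked A T) S)"
    "\<And>k. incident_triangles A T D k = \<beta> ` triangles_at (linked A T) S (low k)"
    using incident_triangles_bij unfolding S_def low_def by blast
  define st where "st k = triangles_at (linked A T) S (low k)" for k
  have st: "triangles_at L (pos ` S) (pos (low k)) = (`) pos ` st k" for k
    unfolding st_def by (rule triangles_at_image[where L' = L, OF inj _ lowS]) (rule Liff)
  have sub: "\<Union> (set (map st [i..j])) \<subseteq> inner_triangles (linked A T) S" by (auto simp: st_def triangles_at_def)
  have inj1: "inj_on ((`) pos) (inner_triangles (linked A T) S)"
    by (rule inj_on_image, rule inj_on_subset[OF inj]) (auto simp: inner_triangles_def)
  have m1: "map (triangles_at L (pos ` S)) ws = map ((`) ((`) pos)) (map st [i..j])"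
    by (simp add: ws_def st)
  have m2: "map (incident_triangles A T D) [i..j] = map ((`) \<beta>) (map st [i..j])"
    by (simp add: \<beta>(2) st_def)
  have c: "card (sdrs (map (incident_triangles A T D) [i..j])) = card (sdrs (map (triangles_at L (pos ` S)) ws))"
    unfolding m1 m2 card_sdrs_image[OF inj_on_subset[OF inj1 sub]] card_sdrs_image[OF inj_on_subset[OF \<beta>(1) sub]] ..
  have ck: "card (incident_triangles A T D k) = card (triangles_at L (pos ` S) (pos (low k)))" for k
  proof -
    have "st k \<subseteq> inner_triangles (linked A T) S" by (auto simp: st_def triangles_at_def)
    then show ?thesis unfolding st \<beta>(2) st_def[symmetric]
      using card_image inj_on_subset inj1 \<beta>(1) by metis
  qed
  show "int (card (sdrs (map (incident_triangles A T D) [i..j])))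
      = continuant (map (\<lambda>k. int (card (incident_triangles A T D k))) [i..j])"
    unfolding c using main by (simp add: ws_def ck comp_def)
  have "finite (sdrs (map (triangles_at L (pos ` S)) ws))"
    using finite_triangles_at finL by (intro finite_sdrs) (auto simp: ws_def)
  then show "0 < int (card (sdrs (map (incident_triangles A T D) [i..j])))"
    unfolding c using conjunct2[OF main] by (simp add: card_gt_0_iff)
qed

theorem theorem5p6:
  fixes A :: "real set" and T :: "strip_arc set"
  assumes "A \<subseteq> \<rat>"
    and "strip_triangulation A T"
    and "admissible T"
  shows "(\<exists>D. drawing T D) \<and>
    (\<forall>D. drawing T D \<longrightarrow>
      (\<exists>m. infinite_frieze m \<and>
        (\<forall>i. quiddity_row m i = int (card (incident_triangles A T D i))) \<and>
        (\<forall>i j. i \<le> j \<longrightarrow> m i j = int (card (matchings A T D i j)))))"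
proof (intro conjI allI impI)
  show "\<exists>D. drawing T D" by (rule drawing_exists[OF assms(2)])
  fix D assume D: "drawing T D"
  define a where "a = (\<lambda>k. int (card (incident_triangles A T D k)))"
  \<comment> \<open>The entry 0 has to be set separately, because the list from \<open>i\<close> to
    \<open>i - 2\<close> is empty and its continuant is 1. The entries 1 of the frieze come from the
    empty list in the case \<open>j = i - 1\<close>.\<close>
  define m where "m i j = (if j = i - 2 then 0 else continuant (map a [i..j]))" for i j
  have M: "m i j = int (card (matchings A T D i j))" "0 < m i j" if "i \<le> j" for i j
    using card_sdrs_incident[OF assms(2,3) D that] that
    by (simp_all add: m_def a_def card_matchings)
  have "m i j * m (i + 1) (j + 1) - m (i + 1) j * m i (j + 1) = 1" if "i - 1 \<le> j" for i j
  proof (cases "j = i - 1")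
    \<comment> \<open>Here \<open>m (i + 1) j\<close> is one of the entries 0, which are not
      continuants, so \<open>continuant_frieze\<close> does not apply; the first product is 1 *
      1.\<close>
    case True
    then show ?thesis by (simp add: m_def)
  next
    case False
    then have ij: "i \<le> j" using that by simp
    define ms where "ms = [i + 1..j]"
    have u: "[i..j] = i # ms" "[i + 1..j + 1] = ms @ [j + 1]" "[i..j + 1] = i # ms @ [j + 1]"
      using ij upto_rec1[of i j] upto_rec2[of "i + 1" "j + 1"] upto_rec1[of i "j + 1"] by (simp_all add: ms_def)
    then have "m i j * m (i + 1) (j + 1) - m (i + 1) j * m i (j + 1)
      = continuant (a i # map a ms) * continuant (map a ms @ [a (j + 1)])
        - continuant (map a ms) * continuant (a i # map a ms @ [a (j + 1)])"
      using ij by (simp add: m_def ms_def)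
    then show ?thesis by (simp add: continuant_frieze)
  qed
  then have "infinite_frieze m"
    using M(2) by (auto simp: infinite_frieze_def m_def)
  moreover have "quiddity_row m i = int (card (incident_triangles A T D i))" for i
    by (simp add: quiddity_row_def m_def a_def)
  ultimately show "\<exists>m. infinite_frieze m \<and>
        (\<forall>i. quiddity_row m i = int (card (incident_triangles A T D i))) \<and>
        (\<forall>i j. i \<le> j \<longrightarrow> m i j = int (card (matchings A T D i j)))"
    using M(1) by blast
qed

end
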